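(* Let $M$ be a smooth immersed surface in $\mathbb R^4$ given locally, at a $P_3(c)$-point taken to be the origin, in Monge form $(z,w)=(f^1(x,y),f^2(x,y))$ whose $4$-jet at the origin is $$(x^2+xy^2+\alpha y^4,\; xy+\beta y^3+\phi(x,y)),$$ where $\alpha,\beta\in\mathbb R$ and $\phi$ is a homogeneous polynomial of degree $4$ in $x,y$. Then the moduli $\alpha$ and $\beta$ can be written as functions of the cross-ratio invariants (cr-invariants) of $M$ at the $P_3(c)$-point.
   Context: Two (multi-)germs $f,g$ are $\mathcal A$-equivalent if $g=k\circ f\circ h^{-1}$ for germs of diffeomorphisms $h$ of the source and $k$ of the target. For $\mathbf u=(u,v,w)\in(\mathbb R^3,0)$ the projection of $M$ along the direction $(u,1,v,w)$ is $P_{\mathbf u}(x,y)=(x-uy,\,f^1(x,y)-vy,\,f^2(x,y)-wy)$. The origin is a $P_3(c)$-point if the germ of $P_0$ at the origin is $\mathcal A$-equivalent to $(x,xy+y^3,xy^2+cy^4)$ for some $c\ne 0,\frac12,1,\frac32$. Curves through the $P_3(c)$-point. Put $a=\frac12f^1_{xx}$, $b=\frac12f^1_{xy}$, $c=\frac12f^1_{yy}$, $l=\frac12f^2_{xx}$, $m=\frac12f^2_{xy}$, $n=\frac12f^2_{yy}$. (1) $\Delta$ (parabolic curve): $(an-cl)^2-4(am-bl)(bn-cm)=0$. (2) $F_l$ (flecnodal curve): locus of inflections of the asymptotic curves, i.e. the projection to the $(x,y)$-plane of $\{F=F_y+pF_x=0\}$, where $F(x,y,p)=(am-bl)p^2+(an-cl)p+(bn-cm)$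 and $p=dx/dy$. (3) $B_2$-curve (resp. $S_2$-curve): points of $M$ near the origin at which some $P_{\mathbf u}$, $\mathbf u$ near $0$, has a singularity $\mathcal A$-equivalent to $(x,y^2,x^2y\pm y^5)$ (resp. $(x,y^2,y^3\pm x^3y)$). (4) $(A_0S_0)_2$-, $A_0S_1$- and $A_0S_0|A_1$-curves: points of $M$ near the origin at which (together with another point of $M$ near the origin) some $P_{\mathbf u}$, $\mathbf u$ near $0$, has a bi-germ of the following type. $(A_0S_0)_2$: a regular surface sheet transversal to a cross-cap but tangent to the double point curve at the cross-cap point, normal form $(x,y,0;\,Y^2,XY+Y^5,X)$. $A_0S_1^{\pm}$: a surface with an $S_1^\pm$ singularity $(x,y^2,y^3\pm x^2y)$ intersecting transversally a regular sheet, normal form $(x,y,0;\,Y^3\pm X^2Y,Y^2,X)$. $A_0S_0|A_1^{\pm}$: a regular sheet tangent to a cross-cap but transversal to the double point curve at the cross-cap point, normal form $(x,y,0;\,X,XY,Y^2\pm X^2)$. All the curves are (generically smooth and) tangent to $\Delta$ at the origin, each of the form $x=\kappa y^2+o(y^2)$. Lines. In the projective cotangent bundle $PT^*M$ use coordinates $(x,y,p)$ with $p=dx/dy$ and contact structure $dx-p\,dy=0$. The Legendrian lift of a curve consists of its points together with its tangent direction. The tangent lines at the $P_3(c)$-point to the Legendrian lifts of $\Delta,B_2,S_2,F_l,(A_0S_0)_2,A_0S_1,A_0S_0|A_1$ are denoted $l_P,l_B,l_S,l_F,l_{s_{02}},l_{s_1},l_{s_{01}}$; they all lie in the contact plane at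 that point, together with the vertical line $l_g$ (direction $\partial/\partial p$). The cross-ratio of four coplanar concurrent lines $l_i$ of slopes $c_i$ is $(l_1,l_2:l_3,l_4)=\frac{c_3-c_1}{c_3-c_2}\cdot\frac{c_4-c_2}{c_4-c_1}$, which equals $\frac{c_3-c_1}{c_4-c_1}$ when $l_2$ is vertical. The cr-invariants at the $P_3(c)$-point are the cross-ratios of any four of these lines (including $l_g$).
   Formalization: Assumed: all curves except (A_0S_0)_2 exist as smooth germs x=κy²+o(y²), for B_2, S_2 and bi-germ curves with u smooth along them, and l_P differs from every other line; if 4α+6β²=5β, l_P, l_B, l_S, l_F coincide and cross-ratios are undefined. l_{s02} need not exist. *)

theory Defs
  imports "HOL-Analysis.Analysis" "HOL-Library.Landau_Symbols"
begin

type_synonym R2 = "real \<times> real"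
type_synonym R3 = "real \<times> real \<times> real"

section \<open>Smooth maps and \<open>\<A>\<close>-equivalence\<close>

text \<open>Only used on open sets.\<close>

primrec Ck_on :: "nat \<Rightarrow> ('a::real_normed_vector \<Rightarrow> 'b::real_normed_vector) \<Rightarrow> 'a set \<Rightarrow> bool" where
  "Ck_on 0 f S \<longleftrightarrow> continuous_on S f"
| "Ck_on (Suc k) f S \<longleftrightarrow>
     f differentiable_on S \<and> (\<forall>v. Ck_on k (\<lambda>x. frechet_derivative f (at x) v) S)"

definition smooth_on :: "'a::real_normed_vector set \<Rightarrow> ('a \<Rightarrow> 'b::real_normed_vector) \<Rightarrow> bool" where
  "smooth_on S f \<longleftrightarrow> (\<forall>k. Ck_on k f S)"

definition diffeo_germ ::
  "('a::real_normed_vector \<Rightarrow> 'b::real_normed_vector) \<Rightarrow> 'a \<Rightarrow> 'b \<Rightarrow> bool" where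
  "diffeo_germ h a b \<longleftrightarrow>
     (\<exists>U V h'. open U \<and> a \<in> U \<and> open V \<and> homeomorphism U V h h' \<and>
        smooth_on U h \<and> smooth_on V h' \<and> h a = b)"

text \<open>A multi-germ is a list of pairs (map, source point) with a common image point. One
  diffeomorphism germ acts on the target, and one at each source point.\<close>

definition A_equivalent :: "((R2 \<Rightarrow> R3) \<times> R2) list \<Rightarrow> ((R2 \<Rightarrow> R3) \<times> R2) list \<Rightarrow> bool" where
  "A_equivalent F G \<longleftrightarrow>
     (\<exists>k c d. diffeo_germ k c d \<and>
        list_all2 (\<lambda>(f, a) (g, b). f a = c \<and> g b = d \<and>
            (\<exists>h. diffeo_germ h a b \<and> (\<forall>\<^sub>F m in nhds a. k (f m) = g (h m)))) F G)"

section \<open>Partial derivatives and jets\<close>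

definition dx :: "(R2 \<Rightarrow> real) \<Rightarrow> R2 \<Rightarrow> real" where
  "dx f = (\<lambda>(x, y). deriv (\<lambda>s. f (s, y)) x)"

definition dy :: "(R2 \<Rightarrow> real) \<Rightarrow> R2 \<Rightarrow> real" where
  "dy f = (\<lambda>(x, y). deriv (\<lambda>s. f (x, s)) y)"

definition same_jet :: "nat \<Rightarrow> (R2 \<Rightarrow> real) \<Rightarrow> (R2 \<Rightarrow> real) \<Rightarrow> bool" where
  "same_jet k f g \<longleftrightarrow>
     (\<forall>i j. i + j \<le> k \<longrightarrow> (dx ^^ i) ((dy ^^ j) f) (0, 0) = (dx ^^ i) ((dy ^^ j) g) (0, 0))"

section \<open>Projections of the surface\<close>

text \<open>Throughout, \<open>M\<close> is the graph \<open>{(x, y, f1 (x, y), f2 (x, y))}\<close>, and its points are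
  identified with their coordinates \<open>(x, y)\<close>.\<close>

definition proj :: "(R2 \<Rightarrow> real) \<Rightarrow> (R2 \<Rightarrow> real) \<Rightarrow> R3 \<Rightarrow> R2 \<Rightarrow> R3" where
  "proj f1 f2 = (\<lambda>(u, v, w) (x, y). (x - u * y, f1 (x, y) - v * y, f2 (x, y) - w * y))"

definition P3_point :: "(R2 \<Rightarrow> real) \<Rightarrow> (R2 \<Rightarrow> real) \<Rightarrow> bool" where
  "P3_point f1 f2 \<longleftrightarrow>
     (\<exists>c. c \<noteq> 0 \<and> c \<noteq> 1/2 \<and> c \<noteq> 1 \<and> c \<noteq> 3/2 \<and>
        A_equivalent [(proj f1 f2 (0, 0, 0), (0, 0))]
          [(\<lambda>(x, y). (x, x * y + y ^ 3, x * y ^ 2 + c * y ^ 4), (0, 0))])"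

section \<open>The curves through the \<open>P\<^sub>3(c)\<close>-point\<close>

definition parabolic_set :: "(R2 \<Rightarrow> real) \<Rightarrow> (R2 \<Rightarrow> real) \<Rightarrow> R2 set" where
  "parabolic_set f1 f2 = {q.
     let a = dx (dx f1) q / 2; b = dx (dy f1) q / 2; c = dy (dy f1) q / 2;
         l = dx (dx f2) q / 2; m = dx (dy f2) q / 2; n = dy (dy f2) q / 2
     in (a * n - c * l) ^ 2 - 4 * (a * m - b * l) * (b * n - c * m) = 0}"

text \<open>The binary differential equation of the asymptotic curves, \<open>p = dx/dy\<close>.\<close>

definition asymptotic_form :: "(R2 \<Rightarrow> real) \<Rightarrow> (R2 \<Rightarrow> real) \<Rightarrow> real \<Rightarrow> R2 \<Rightarrow> real" where
  "asymptotic_form f1 f2 p q =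
    (let a = dx (dx f1) q / 2; b = dx (dy f1) q / 2; c = dy (dy f1) q / 2;
         l = dx (dx f2) q / 2; m = dx (dy f2) q / 2; n = dy (dy f2) q / 2
     in (a * m - b * l) * p ^ 2 + (a * n - c * l) * p + (b * n - c * m))"

definition flecnodal_set :: "(R2 \<Rightarrow> real) \<Rightarrow> (R2 \<Rightarrow> real) \<Rightarrow> R2 set" where
  "flecnodal_set f1 f2 = {q. \<exists>p. asymptotic_form f1 f2 p q = 0 \<and>
     dy (asymptotic_form f1 f2 p) q + p * dx (asymptotic_form f1 f2 p) q = 0}"

text \<open>The remaining curves are loci of singularities of the projections. A stratum consists of
  the pairs (point of \<open>M\<close>, projection direction); \<open>r\<close> bounds the point, the direction and, for
  bi-germs, the second point.\<close>

definition stratum ::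
  "(R2 \<Rightarrow> real) \<Rightarrow> (R2 \<Rightarrow> real) \<Rightarrow> (R2 \<Rightarrow> R3) set \<Rightarrow> real \<Rightarrow> (R2 \<times> R3) set" where
  "stratum f1 f2 N r = {(q, d). q \<in> ball 0 r \<and> d \<in> ball 0 r \<and>
     (\<exists>g\<in>N. A_equivalent [(proj f1 f2 d, q)] [(g, (0, 0))])}"

text \<open>\<open>q\<close> is the point at which the projection is singular, \<open>q'\<close> the point on the regular sheet,
  whose normal form is \<open>(x, y, 0)\<close> in all three bi-germs.\<close>

definition bi_stratum ::
  "(R2 \<Rightarrow> real) \<Rightarrow> (R2 \<Rightarrow> real) \<Rightarrow> (R2 \<Rightarrow> R3) set \<Rightarrow> real \<Rightarrow> (R2 \<times> R3) set" where
  "bi_stratum f1 f2 N r = {(q, d). q \<in> ball 0 r \<and> d \<in> ball 0 r \<and>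
     (\<exists>q'\<in>ball 0 r. q' \<noteq> q \<and>
       (\<exists>g\<in>N. A_equivalent [(proj f1 f2 d, q'), (proj f1 f2 d, q)]
                 [(\<lambda>(x, y). (x, y, 0), (0, 0)), (g, (0, 0))]))}"

definition nf_B2 :: "(R2 \<Rightarrow> R3) set" where
  "nf_B2 = {\<lambda>(x, y). (x, y ^ 2, x ^ 2 * y + s * y ^ 5) | s. s \<in> {1, -1}}"

definition nf_S2 :: "(R2 \<Rightarrow> R3) set" where
  "nf_S2 = {\<lambda>(x, y). (x, y ^ 2, y ^ 3 + s * (x ^ 3 * y)) | s. s \<in> {1, -1}}"

definition nf_A0S0_2 :: "(R2 \<Rightarrow> R3) set" where
  "nf_A0S0_2 = {\<lambda>(x, y). (y ^ 2, x * y + y ^ 5, x)}"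

definition nf_A0S1 :: "(R2 \<Rightarrow> R3) set" where
  "nf_A0S1 = {\<lambda>(x, y). (y ^ 3 + s * (x ^ 2 * y), y ^ 2, x) | s. s \<in> {1, -1}}"

definition nf_A0S0_A1 :: "(R2 \<Rightarrow> R3) set" where
  "nf_A0S0_A1 = {\<lambda>(x, y). (x, x * y, y ^ 2 + s * x ^ 2) | s. s \<in> {1, -1}}"

section \<open>Curve germs and their Legendrian lifts\<close>

definition tangent_graph :: "(real \<Rightarrow> real) \<Rightarrow> bool" where
  "tangent_graph g \<longleftrightarrow> g 0 = 0 \<and> (\<exists>\<epsilon>>0. smooth_on {-\<epsilon><..<\<epsilon>} g) \<and>
     (\<exists>\<kappa>. (\<lambda>y. g y - \<kappa> * y ^ 2) \<in> o[at 0](\<lambda>y. y ^ 2))"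

text \<open>The origin is added since it belongs to the closure of the strata, but not to the strata
  themselves.\<close>

definition set_germ :: "R2 set \<Rightarrow> (real \<Rightarrow> real) \<Rightarrow> bool" where
  "set_germ Z g \<longleftrightarrow> tangent_graph g \<and>
     (\<forall>\<^sub>F q in nhds (0, 0). q \<in> insert (0, 0) Z \<longleftrightarrow> fst q = g (snd q))"

text \<open>A stratum is a smooth curve of pairs \<open>((g y, y), U y)\<close>, and the curve on \<open>M\<close> is its
  projection. Smoothness of \<open>U\<close> is part of the curve being smooth: it excludes strata
  that project to \<open>M\<close> with vanishing velocity at the origin, whose images
  may be graphs \<open>x = g y\<close> with arbitrary second order coefficient.\<close>

definition stratum_germ :: "(real \<Rightarrow> (R2 \<times> R3) set) \<Rightarrow> (real \<Rightarrow> real) \<Rightarrow> bool" where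
  "stratum_germ S g \<longleftrightarrow> tangent_graph g \<and>
     (\<exists>U. U 0 = 0 \<and> (\<exists>\<epsilon>>0. smooth_on {-\<epsilon><..<\<epsilon>} U) \<and>
       (\<exists>R>0. \<forall>r. 0 < r \<and> r < R \<longrightarrow>
         (\<forall>\<^sub>F z in nhds (0, 0). z \<in> insert (0, 0) (S r) \<longleftrightarrow>
            fst z = (g (snd (fst z)), snd (fst z)) \<and> snd z = U (snd (fst z)))))"

text \<open>Coordinates \<open>(x, y, p)\<close>, \<open>p = dx/dy\<close>.\<close>

definition legendrian_lift :: "(real \<Rightarrow> real) \<Rightarrow> real \<Rightarrow> R3" where
  "legendrian_lift g y = (g y, y, deriv g y)"

datatype line_label = LP | LB | LS | LF | Ls02 | Ls1 | Ls01 | Lg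

fun curve_of :: "(R2 \<Rightarrow> real) \<Rightarrow> (R2 \<Rightarrow> real) \<Rightarrow> line_label \<Rightarrow> (real \<Rightarrow> real) \<Rightarrow> bool" where
  "curve_of f1 f2 LP = set_germ (parabolic_set f1 f2)"
| "curve_of f1 f2 LB = stratum_germ (stratum f1 f2 nf_B2)"
| "curve_of f1 f2 LS = stratum_germ (stratum f1 f2 nf_S2)"
| "curve_of f1 f2 LF = set_germ (flecnodal_set f1 f2)"
| "curve_of f1 f2 Ls02 = stratum_germ (bi_stratum f1 f2 nf_A0S0_2)"
| "curve_of f1 f2 Ls1 = stratum_germ (bi_stratum f1 f2 nf_A0S1)"
| "curve_of f1 f2 Ls01 = stratum_germ (bi_stratum f1 f2 nf_A0S0_A1)"
| "curve_of f1 f2 Lg = (\<lambda>g. False)"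

text \<open>A line in the contact plane \<open>dx = 0\<close> at the origin is given by a direction vector. The
  vectors below are normalised (\<open>(0, 1, slope)\<close> or \<open>(0, 0, 1)\<close>), so that lines
  are equal iff their vectors are. The value is \<open>None\<close> if there is no such curve; otherwise
  the germ of \<open>g\<close>, and hence the vector, is unique.\<close>

definition line :: "(R2 \<Rightarrow> real) \<Rightarrow> (R2 \<Rightarrow> real) \<Rightarrow> line_label \<Rightarrow> R3 option" where
  "line f1 f2 L =
    (if L = Lg then Some (0, 0, 1)
     else if \<exists>g. curve_of f1 f2 L g
     then Some (THE v. \<exists>g. curve_of f1 f2 L g \<and>
                  v = vector_derivative (legendrian_lift g) (at 0))
     else None)"

section \<open>Cross-ratios\<close>

text \<open>For lines of slopes \<open>c\<close> and \<open>c'\<close> (vectors \<open>(0, 1, c)\<close> and \<open>(0, 1, c')\<close>) this is the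
  difference \<open>c' - c\<close>; in this homogeneous form it also covers the vertical line.\<close>

fun slope_diff :: "R3 \<Rightarrow> R3 \<Rightarrow> real" where
  "slope_diff (_, y, p) (_, y', p') = y * p' - y' * p"

definition cross_ratio :: "R3 \<Rightarrow> R3 \<Rightarrow> R3 \<Rightarrow> R3 \<Rightarrow> real" where
  "cross_ratio v1 v2 v3 v4 =
     (slope_diff v1 v3 * slope_diff v2 v4) / (slope_diff v2 v3 * slope_diff v1 v4)"

text \<open>The cross-ratio of four differently labelled lines, \<open>None\<close> if one of the lines does not
  exist or if the denominator of the cross-ratio vanishes.\<close>

definition cr_invariants ::
  "(R2 \<Rightarrow> real) \<Rightarrow> (R2 \<Rightarrow> real) \<Rightarrow>
     line_label \<times> line_label \<times> line_label \<times> line_label \<Rightarrow> real option" where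
  "cr_invariants f1 f2 = (\<lambda>(L1, L2, L3, L4).
     if distinct [L1, L2, L3, L4] then
       (case (line f1 f2 L1, line f1 f2 L2, line f1 f2 L3, line f1 f2 L4) of
          (Some v1, Some v2, Some v3, Some v4) \<Rightarrow>
            (if v2 \<noteq> v3 \<and> v1 \<noteq> v4 then Some (cross_ratio v1 v2 v3 v4) else None)
        | _ \<Rightarrow> None)
     else None)"

text \<open>\<open>\<phi> x y = (\<Sum>i\<le>4. e i * x ^ i * y ^ (4 - i))\<close> is the general homogeneous polynomial
  of degree 4.\<close>

definition monge_form ::
  "real \<Rightarrow> real \<Rightarrow> (nat \<Rightarrow> real) \<Rightarrow> (R2 \<Rightarrow> real) \<Rightarrow> (R2 \<Rightarrow> real) \<Rightarrow> bool" where
  "monge_form \<alpha> \<beta> e f1 f2 \<longleftrightarrow>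
     (\<exists>W. open W \<and> (0, 0) \<in> W \<and> smooth_on W f1 \<and> smooth_on W f2) \<and>
     same_jet 4 f1 (\<lambda>(x, y). x ^ 2 + x * y ^ 2 + \<alpha> * y ^ 4) \<and>
     same_jet 4 f2 (\<lambda>(x, y). x * y + \<beta> * y ^ 3 + (\<Sum>i\<le>4. e i * x ^ i * y ^ (4 - i)))"

text \<open>Standing assumptions under which the cr-invariants are considered: the curves have the
  form \<open>x = \<kappa> y\<^sup>2 + o(y\<^sup>2)\<close>, and the tangent line \<open>LP\<close> is none of the others
  (otherwise the denominators of the cross-ratios based at \<open>LP\<close> vanish). Existence
  is not required for \<open>Ls02\<close>.\<close>

definition lines_in_general_position :: "(R2 \<Rightarrow> real) \<Rightarrow> (R2 \<Rightarrow> real) \<Rightarrow> bool" where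
  "lines_in_general_position f1 f2 \<longleftrightarrow>
     (\<forall>L. L \<noteq> Ls02 \<longrightarrow> line f1 f2 L \<noteq> None) \<and>
     (\<forall>L. L \<noteq> LP \<longrightarrow> line f1 f2 L \<noteq> line f1 f2 LP)"

end

theory Submission
  imports Defs
begin

text \<open>Every curve is \<open>x = K / 2 * y ^ 2 + o(y ^ 2)\<close>, and its line has slope \<open>K\<close>.
  Composing the projection with the inverse of the source diffeomorphism turns an
  \<open>\<A>\<close>-equivalence into a chart in which the projection is a Lipschitz function of the
  normal form; comparing Taylor coefficients in this chart gives polynomial equations between the
  partial derivatives of \<open>f1\<close>, \<open>f2\<close> at the points of the curve. For the bi-germ, whose
  two points differ by \<open>\<tau> (u, 1)\<close>, these are divided by powers of \<open>\<tau>\<close> before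
  passing to the limit. Letting \<open>y\<close> tend to 0, only the given jets survive and \<open>K\<close> becomes a
  rational function of \<open>\<alpha>\<close> and \<open>\<beta>\<close>. The cross-ratios of \<open>LP\<close>, \<open>Lg\<close>,
  \<open>LF\<close> with \<open>LS\<close> and \<open>LB\<close> depend on \<open>\<beta>\<close> alone and determine it; the one of
  \<open>LP\<close>, \<open>Lg\<close>, \<open>Ls01\<close>, \<open>LB\<close> then yields \<open>\<alpha>\<close>.\<close>

section \<open>Smooth functions of two variables\<close>

text \<open>The scalings come from the weights 2 for \<open>x\<close> and 1 for \<open>y\<close>.
  The curves are \<open>x ~ y^2\<close>; the first component \<open>u\<close> of the direction and
  the parameter \<open>\<tau>\<close> have weight 1. The leading parts
  \<open>x^2 + x y^2 + \<alpha> y^4\<close> and \<open>x y + \<beta> y^3\<close> are homogeneous of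
  weights 4 and 3, while phi has weight at least 4 and so disappears from \<open>f2\<close> in the
  limit. The weights tell by which power of \<open>y\<close> each quantity has to be divided. Only
  necessary conditions are derived: the curves used exist by general position, and each condition
  forces a slope. A one-sided Lipschitz estimate therefore replaces the full equivalence; it is
  evaluated at pairs of points that the normal form nearly identifies, \<open>(X, Y)\<close> and
  \<open>(X, -Y)\<close> on one sheet, or one point on either sheet of a bi-germ. On a stratum the
  direction moves smoothly, so \<open>u / y\<close> converges. The flecnodal directions and the
  second point of the bi-germ come without any regularity; convergence of \<open>u / y\<close> or
  \<open>\<tau> / y\<close> must there be extracted from the equations.\<close>

lemma Ck_on_cong:
  assumes "open S" "\<And>x. x \<in> S \<Longrightarrow> f x = g x" "Ck_on k f S"
  shows "Ck_on k g S"
  using assms(2,3)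
proof (induction k arbitrary: f g)
  case 0
  then show ?case
    using continuous_on_cong by force
next
  case (Suc k)
  have iff: "(f has_derivative D) (at x) \<longleftrightarrow> (g has_derivative D) (at x)" if "x \<in> S" for x D
    using has_derivative_transform_within_open[OF _ \<open>open S\<close> that] Suc.prems(1) by metis
  have deriv_eq: "frechet_derivative f (at x) = frechet_derivative g (at x)" if "x \<in> S" for x
    unfolding frechet_derivative_def using iff[OF that] by simp
  have "g differentiable_on S"
    using Suc.prems iff \<open>open S\<close>
    by (auto simp: differentiable_on_eq_differentiable_at differentiable_def)
  moreover have "Ck_on k (\<lambda>x. frechet_derivative g (at x) v) S" for v
    using Suc.IH[of "\<lambda>x. frechet_derivative f (at x) v" "\<lambda>x. frechet_derivative g (at x) v"]
      deriv_eq Suc.prems(2) by simp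
  ultimately show ?case by simp
qed

lemma smooth_on_cong:
  "open S \<Longrightarrow> (\<And>x. x \<in> S \<Longrightarrow> f x = g x) \<Longrightarrow> smooth_on S f \<Longrightarrow> smooth_on S g"
  unfolding smooth_on_def using Ck_on_cong by blast

lemma smooth_on_differentiable:
  assumes "smooth_on S f" "open S" "x \<in> S"
  shows "f differentiable (at x)"
  using assms unfolding smooth_on_def
  by (metis Ck_on.simps(2) differentiable_on_eq_differentiable_at)

lemma smooth_on_has_derivative:
  assumes "smooth_on S f" "open S" "x \<in> S"
  shows "(f has_derivative frechet_derivative f (at x)) (at x)"
  using smooth_on_differentiable[OF assms] frechet_derivative_works by blast

lemma smooth_on_frechet_derivative:
  "smooth_on S f \<Longrightarrow> smooth_on S (\<lambda>x. frechet_derivative f (at x) v)"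
  unfolding smooth_on_def by (metis Ck_on.simps(2))

lemma smooth_on_isCont:
  assumes "smooth_on S f" "open S" "x \<in> S"
  shows "isCont f x"
  using smooth_on_differentiable[OF assms] by (rule differentiable_imp_continuous_within)

lemma Ck_on_bounded_linear:
  assumes "open S" "bounded_linear L" "Ck_on k f S"
  shows "Ck_on k (\<lambda>x. L (f x)) S"
  using assms(3)
proof (induction k arbitrary: f)
  case 0
  then show ?case
    using bounded_linear.continuous_on[OF assms(2)] by simp
next
  case (Suc k)
  have hd: "((\<lambda>x. L (f x)) has_derivative (\<lambda>v. L (frechet_derivative f (at x) v))) (at x)"
    if "x \<in> S" for x
    using bounded_linear.has_derivative[OF assms(2)] Suc.prems that \<open>open S\<close>
    by (metis Ck_on.simps(2) differentiable_on_eq_differentiable_at frechet_derivative_works)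
  have "(\<lambda>x. L (f x)) differentiable_on S"
    using hd by (meson differentiableI differentiable_at_imp_differentiable_on)
  moreover have "Ck_on k (\<lambda>x. frechet_derivative (\<lambda>x. L (f x)) (at x) v) S" for v
  proof (rule Ck_on_cong[OF \<open>open S\<close>])
    show "Ck_on k (\<lambda>x. L (frechet_derivative f (at x) v)) S"
      using Suc by simp
    show "L (frechet_derivative f (at x) v) = frechet_derivative (\<lambda>x. L (f x)) (at x) v"
      if "x \<in> S" for x
      using frechet_derivative_at[OF hd[OF that]] by metis
  qed
  ultimately show ?case by simp
qed

lemma smooth_on_bounded_linear:
  "open S \<Longrightarrow> bounded_linear L \<Longrightarrow> smooth_on S f \<Longrightarrow> smooth_on S (\<lambda>x. L (f x))"
  unfolding smooth_on_def using Ck_on_bounded_linear by blast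

text \<open>Lets the first component \<open>x - u * y\<close> of the projection be handled by the
  same third-order lemma as \<open>f1\<close> and \<open>f2\<close>, with \<open>f = fst\<close> and
  \<open>c = u\<close>.\<close>

lemma smooth_on_fst: "smooth_on UNIV (fst :: R2 \<Rightarrow> real)"
proof -
  have k: "Ck_on n (\<lambda>z::R2. k) UNIV" for n and k :: real
    by (induction n arbitrary: k) (auto simp: frechet_derivative_const)
  have "Ck_on n (\<lambda>z::R2. fst z) UNIV" for n
  proof (cases n)
    case (Suc m)
    have "frechet_derivative (\<lambda>z::R2. fst z) (at x) = fst" for x
      using frechet_derivative_at[OF has_derivative_fst[OF has_derivative_ident]] by metis
    then show ?thesis
      using k by (auto simp: Suc intro!: bounded_linear_imp_differentiable_on bounded_linear_fst)
  qed (auto intro!: continuous_intros)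
  then show ?thesis by (simp add: smooth_on_def)
qed

text \<open>\<open>dx\<close> and \<open>dy\<close> are one-variable derivatives, which carry no
  joint differentiability; this links them to the Frechet derivative on which smoothness is
  built.\<close>

lemma partials_of_has_derivative:
  fixes f :: "R2 \<Rightarrow> real"
  assumes "(f has_derivative D) (at z)"
  shows "dx f z = D (1, 0)" "dy f z = D (0, 1)"
proof -
  obtain x y where z: "z = (x, y)" by (cases z)
  interpret D: bounded_linear D
    using assms has_derivative_bounded_linear by blast
  have "((\<lambda>s. f (s, y)) has_derivative (\<lambda>h. D (h, 0))) (at x)"
    by (rule has_derivative_compose[where f = "\<lambda>s. (s, y)" and g = f])
      (use assms z in \<open>auto intro!: derivative_eq_intros\<close>)
  moreover have "(\<lambda>h. D (h, 0)) = (*) (D (1, 0))"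
  proof
    show "D (h, 0) = D (1, 0) * h" for h
      using D.scaleR[of h "(1, 0)"] by simp
  qed
  ultimately have "((\<lambda>s. f (s, y)) has_field_derivative D (1, 0)) (at x)"
    by (simp add: has_field_derivative_def)
  then show "dx f z = D (1, 0)"
    using DERIV_imp_deriv z by (auto simp: dx_def)
  have "((\<lambda>s. f (x, s)) has_derivative (\<lambda>h. D (0, h))) (at y)"
    by (rule has_derivative_compose[where f = "\<lambda>s. (x, s)" and g = f])
      (use assms z in \<open>auto intro!: derivative_eq_intros\<close>)
  moreover have "(\<lambda>h. D (0, h)) = (*) (D (0, 1))"
  proof
    show "D (0, h) = D (0, 1) * h" for h
      using D.scaleR[of h "(0, 1)"] by simp
  qed
  ultimately have "((\<lambda>s. f (x, s)) has_field_derivative D (0, 1)) (at y)"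
    by (simp add: has_field_derivative_def)
  then show "dy f z = D (0, 1)"
    using DERIV_imp_deriv z by (auto simp: dy_def)
qed

lemma has_derivative_partials:
  fixes f :: "R2 \<Rightarrow> real"
  assumes "f differentiable (at z)"
  shows "(f has_derivative (\<lambda>h. dx f z * fst h + dy f z * snd h)) (at z)"
proof -
  obtain D where D: "(f has_derivative D) (at z)"
    using assms by (auto simp: differentiable_def)
  interpret D: bounded_linear D
    using D has_derivative_bounded_linear by blast
  have "D h = dx f z * fst h + dy f z * snd h" for h
    using D.add[of "fst h *\<^sub>R (1, 0)" "snd h *\<^sub>R (0, 1)"]
      D.scaleR[of "fst h" "(1, 0)"] D.scaleR[of "snd h" "(0, 1)"]
      partials_of_has_derivative[OF D] by (simp add: mult.commute)
  then have "D = (\<lambda>h. dx f z * fst h + dy f z * snd h)"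
    by (rule ext)
  then show ?thesis
    using D by simp
qed

lemma smooth_on_dx:
  fixes f :: "R2 \<Rightarrow> real"
  assumes "smooth_on S f" "open S"
  shows "smooth_on S (dx f)"
  using assms(2) _ smooth_on_frechet_derivative[OF assms(1), of "(1, 0)"]
  by (rule smooth_on_cong)
    (use partials_of_has_derivative(1)[OF smooth_on_has_derivative[OF assms]] in simp)

lemma smooth_on_dy:
  fixes f :: "R2 \<Rightarrow> real"
  assumes "smooth_on S f" "open S"
  shows "smooth_on S (dy f)"
  using assms(2) _ smooth_on_frechet_derivative[OF assms(1), of "(0, 1)"]
  by (rule smooth_on_cong)
    (use partials_of_has_derivative(2)[OF smooth_on_has_derivative[OF assms]] in simp)

lemma DERIV_compose_pair:
  fixes f :: "R2 \<Rightarrow> real"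
  assumes "f differentiable (at (p t, q t))"
    and "(p has_real_derivative p') (at t)" "(q has_real_derivative q') (at t)"
  shows "((\<lambda>t. f (p t, q t)) has_real_derivative dx f (p t, q t) * p' + dy f (p t, q t) * q') (at t)"
proof -
  have "((\<lambda>t. (p t, q t)) has_derivative (\<lambda>h. (p' * h, q' * h))) (at t)"
    using assms(2,3) unfolding has_field_derivative_def by (rule has_derivative_Pair)
  from has_derivative_compose[OF this has_derivative_partials[OF assms(1)]]
  show ?thesis
    unfolding has_field_derivative_def
    by (rule has_derivative_eq_rhs) (simp add: fun_eq_iff algebra_simps)
qed

section \<open>Symmetry of the mixed partial derivatives\<close>

lemma mixed_partials_mean_value:
  fixes f :: "R2 \<Rightarrow> real"
  assumes "h > 0"
    and f: "\<And>z. z \<in> cbox (a, b) (a + h, b + h) \<Longrightarrow> f differentiable (at z)"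
    and fx: "\<And>z. z \<in> cbox (a, b) (a + h, b + h) \<Longrightarrow> dx f differentiable (at z)"
  shows "\<exists>z \<in> cbox (a, b) (a + h, b + h).
    f (a + h, b + h) - f (a + h, b) - f (a, b + h) + f (a, b) = h ^ 2 * dy (dx f) z"
proof -
  have mem: "(s, t) \<in> cbox (a, b) (a + h, b + h)" if "a \<le> s" "s \<le> a + h" "b \<le> t" "t \<le> b + h" for s t
    using that by (auto simp: cbox_Pair_eq)
  have dx_f: "((\<lambda>s. f (s, t)) has_real_derivative dx f (s, t)) (at s)"
    if "a \<le> s" "s \<le> a + h" "b \<le> t" "t \<le> b + h" for s t
    using DERIV_compose_pair[of f "\<lambda>s. s" s "\<lambda>_. t" 1 0] f[OF mem[OF that]] by simp
  have "\<exists>\<xi>. a < \<xi> \<and> \<xi> < a + h \<and>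
      (f (a + h, b + h) - f (a + h, b)) - (f (a, b + h) - f (a, b))
        = (a + h - a) * (dx f (\<xi>, b + h) - dx f (\<xi>, b))"
    using \<open>h > 0\<close> by (intro MVT2) (auto intro!: DERIV_diff dx_f)
  then obtain \<xi> where \<xi>: "a < \<xi>" "\<xi> < a + h"
      "(f (a + h, b + h) - f (a + h, b)) - (f (a, b + h) - f (a, b))
        = h * (dx f (\<xi>, b + h) - dx f (\<xi>, b))"
    by auto
  have dy_f: "((\<lambda>t. dx f (\<xi>, t)) has_real_derivative dy (dx f) (\<xi>, t)) (at t)"
    if "b \<le> t" "t \<le> b + h" for t
    using DERIV_compose_pair[of "dx f" "\<lambda>_. \<xi>" t "\<lambda>t. t" 0 1] fx[OF mem, of \<xi> t] that \<xi> by simp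
  have "\<exists>\<eta>. b < \<eta> \<and> \<eta> < b + h \<and>
      dx f (\<xi>, b + h) - dx f (\<xi>, b) = (b + h - b) * dy (dx f) (\<xi>, \<eta>)"
    using \<open>h > 0\<close> by (intro MVT2) (auto intro!: dy_f)
  then obtain \<eta> where \<eta>: "b < \<eta>" "\<eta> < b + h"
      "dx f (\<xi>, b + h) - dx f (\<xi>, b) = h * dy (dx f) (\<xi>, \<eta>)"
    by auto
  show ?thesis
    using \<xi> \<eta> mem[of \<xi> \<eta>] by (intro bexI[of _ "(\<xi>, \<eta>)"]) (auto simp: power2_eq_square algebra_simps)
qed

lemma mixed_partials_mean_value':
  fixes f :: "R2 \<Rightarrow> real"
  assumes "h > 0"
    and f: "\<And>z. z \<in> cbox (a, b) (a + h, b + h) \<Longrightarrow> f differentiable (at z)"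
    and fy: "\<And>z. z \<in> cbox (a, b) (a + h, b + h) \<Longrightarrow> dy f differentiable (at z)"
  shows "\<exists>z \<in> cbox (a, b) (a + h, b + h).
    f (a + h, b + h) - f (a + h, b) - f (a, b + h) + f (a, b) = h ^ 2 * dx (dy f) z"
proof -
  have mem: "(s, t) \<in> cbox (a, b) (a + h, b + h)" if "a \<le> s" "s \<le> a + h" "b \<le> t" "t \<le> b + h" for s t
    using that by (auto simp: cbox_Pair_eq)
  have dy_f: "((\<lambda>t. f (s, t)) has_real_derivative dy f (s, t)) (at t)"
    if "a \<le> s" "s \<le> a + h" "b \<le> t" "t \<le> b + h" for s t
    using DERIV_compose_pair[of f "\<lambda>_. s" t "\<lambda>t. t" 0 1] f[OF mem[OF that]] by simp
  have "\<exists>\<eta>. b < \<eta> \<and> \<eta> < b + h \<and>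
      (f (a + h, b + h) - f (a, b + h)) - (f (a + h, b) - f (a, b))
        = (b + h - b) * (dy f (a + h, \<eta>) - dy f (a, \<eta>))"
    using \<open>h > 0\<close> by (intro MVT2) (auto intro!: DERIV_diff dy_f)
  then obtain \<eta> where \<eta>: "b < \<eta>" "\<eta> < b + h"
      "(f (a + h, b + h) - f (a, b + h)) - (f (a + h, b) - f (a, b))
        = h * (dy f (a + h, \<eta>) - dy f (a, \<eta>))"
    by auto
  have dx_f: "((\<lambda>s. dy f (s, \<eta>)) has_real_derivative dx (dy f) (s, \<eta>)) (at s)"
    if "a \<le> s" "s \<le> a + h" for s
    using DERIV_compose_pair[of "dy f" "\<lambda>s. s" s "\<lambda>_. \<eta>" 1 0] fy[OF mem, of s \<eta>] that \<eta> by simp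
  have "\<exists>\<xi>. a < \<xi> \<and> \<xi> < a + h \<and>
      dy f (a + h, \<eta>) - dy f (a, \<eta>) = (a + h - a) * dx (dy f) (\<xi>, \<eta>)"
    using \<open>h > 0\<close> by (intro MVT2) (auto intro!: dx_f)
  then obtain \<xi> where \<xi>: "a < \<xi>" "\<xi> < a + h"
      "dy f (a + h, \<eta>) - dy f (a, \<eta>) = h * dx (dy f) (\<xi>, \<eta>)"
    by auto
  show ?thesis
    using \<xi> \<eta> mem[of \<xi> \<eta>] by (intro bexI[of _ "(\<xi>, \<eta>)"]) (auto simp: power2_eq_square algebra_simps)
qed

lemma cbox_subset_ball_prod:
  fixes a b h d :: real
  assumes "0 < h" "2 * h < d" "z \<in> cbox (a, b) (a + h, b + h)"
  shows "dist z (a, b) < d"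
proof -
  obtain s t where z: "z = (s, t)" by (cases z)
  have "a \<le> s" "s \<le> a + h" "b \<le> t" "t \<le> b + h"
    using assms(3) by (auto simp: z cbox_Pair_eq)
  then have "dist s a \<le> h" "dist t b \<le> h" by (auto simp: dist_real_def)
  then show ?thesis
    using assms(2) sqrt_sum_squares_le_sum[of "dist s a" "dist t b"] by (simp add: z dist_Pair_Pair)
qed

text \<open>The second difference over a small square is \<open>h ^ 2\<close> times either mixed
  derivative at some point of the square; continuity of both does the rest.\<close>

lemma dx_dy_commute:
  fixes f :: "R2 \<Rightarrow> real"
  assumes "smooth_on S f" "open S" "z \<in> S"
  shows "dx (dy f) z = dy (dx f) z"
proof (rule ccontr)
  assume ne: "dx (dy f) z \<noteq> dy (dx f) z"
  define e where "e = \<bar>dx (dy f) z - dy (dx f) z\<bar> / 2"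
  have "e > 0" using ne by (simp add: e_def)
  note sm = smooth_on_dx smooth_on_dy assms(1,2)
  have c1: "isCont (dx (dy f)) z" and c2: "isCont (dy (dx f)) z"
    by (rule smooth_on_isCont[of S], (intro sm)+, rule assms(3))+
  obtain d1 where d1: "d1 > 0" "\<And>y. dist y z < d1 \<Longrightarrow> dist (dx (dy f) y) (dx (dy f) z) < e"
    using c1 \<open>e > 0\<close> unfolding continuous_at_eps_delta by blast
  obtain d2 where d2: "d2 > 0" "\<And>y. dist y z < d2 \<Longrightarrow> dist (dy (dx f) y) (dy (dx f) z) < e"
    using c2 \<open>e > 0\<close> unfolding continuous_at_eps_delta by blast
  obtain d3 where d3: "d3 > 0" "\<And>y. dist y z < d3 \<Longrightarrow> y \<in> S"
    using assms(2,3) open_dist by metis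
  \<comment> \<open>Distances within the square are bounded by \<open>2 * h\<close> only, hence a
    third of the smallest radius.\<close>
  define h where "h = min d1 (min d2 d3) / 3"
  have h: "h > 0" "2 * h < d1" "2 * h < d2" "2 * h < d3"
    using d1(1) d2(1) d3(1) by (auto simp: h_def min_def)
  obtain a b where z: "z = (a, b)" by (cases z)
  have S: "w \<in> S" if "w \<in> cbox (a, b) (a + h, b + h)" for w
    using cbox_subset_ball_prod[OF h(1,4) that] d3(2) z by auto
  obtain z1 where z1: "z1 \<in> cbox (a, b) (a + h, b + h)"
    "f (a + h, b + h) - f (a + h, b) - f (a, b + h) + f (a, b) = h ^ 2 * dy (dx f) z1"
    using mixed_partials_mean_value[OF h(1), of a b f] S
      smooth_on_differentiable[OF assms(1,2)]
      smooth_on_differentiable[OF smooth_on_dx[OF assms(1,2)] assms(2)] by blast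
  obtain z2 where z2: "z2 \<in> cbox (a, b) (a + h, b + h)"
    "f (a + h, b + h) - f (a + h, b) - f (a, b + h) + f (a, b) = h ^ 2 * dx (dy f) z2"
    using mixed_partials_mean_value'[OF h(1), of a b f] S
      smooth_on_differentiable[OF assms(1,2)]
      smooth_on_differentiable[OF smooth_on_dy[OF assms(1,2)] assms(2)] by blast
  have "dy (dx f) z1 = dx (dy f) z2"
    using z1(2) z2(2) h(1) by simp
  moreover have "dist (dy (dx f) z1) (dy (dx f) z) < e"
    using d2(2) cbox_subset_ball_prod[OF h(1,3) z1(1)] z by auto
  moreover have "dist (dx (dy f) z2) (dx (dy f) z) < e"
    using d1(2) cbox_subset_ball_prod[OF h(1,2) z2(1)] z by auto
  ultimately show False
    unfolding e_def dist_real_def by (auto simp: abs_if split: if_splits)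
qed

section \<open>Charts from \<open>\<A>\<close>-equivalences\<close>

text \<open>Continuity bounds the finitely many derivatives along basis vectors near
  \<open>x\<close>. Expanding a vector in the basis turns this into a bound of the operator norm,
  and the mean value inequality applies on the convex ball.\<close>

lemma smooth_on_locally_lipschitz:
  fixes f :: "'a::euclidean_space \<Rightarrow> 'b::real_normed_vector"
  assumes "smooth_on S f" "open S" "x \<in> S"
  shows "\<exists>L d. 0 < d \<and> (\<forall>y\<in>ball x d. \<forall>z\<in>ball x d. norm (f y - f z) \<le> L * norm (y - z))"
proof -
  let ?f' = "\<lambda>z. frechet_derivative f (at z)"
  have "((\<lambda>z. ?f' z i) \<longlongrightarrow> ?f' x i) (nhds x)" for i
    using smooth_on_isCont[OF smooth_on_frechet_derivative[OF assms(1)] assms(2,3), of i]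
    unfolding isCont_def tendsto_at_iff_tendsto_nhds[of "\<lambda>z. ?f' z i"] .
  then have "\<forall>\<^sub>F z in nhds x. norm (?f' z i) < norm (?f' x i) + 1" for i
    using order_tendstoD(2)[OF tendsto_norm, of "\<lambda>z. ?f' z i" "?f' x i" "nhds x"] by simp
  then have "\<forall>\<^sub>F z in nhds x. \<forall>i\<in>Basis. norm (?f' z i) < norm (?f' x i) + 1"
    by (simp add: eventually_ball_finite)
  moreover have "\<forall>\<^sub>F z in nhds x. z \<in> S"
    using assms(2,3) eventually_nhds by blast
  ultimately have "\<forall>\<^sub>F z in nhds x. z \<in> S \<and> (\<forall>i\<in>Basis. norm (?f' z i) < norm (?f' x i) + 1)"
    by eventually_elim simp
  then obtain d where d: "d > 0"
    "\<And>z. dist z x < d \<Longrightarrow> z \<in> S \<and> (\<forall>i\<in>Basis. norm (?f' z i) < norm (?f' x i) + 1)"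
    unfolding eventually_nhds_metric by blast
  define L where "L = (\<Sum>i\<in>Basis. norm (?f' x i) + 1)"
  have bound: "onorm (?f' z) \<le> L" if "z \<in> ball x d" for z
  proof (rule onorm_le)
    fix v
    have z: "z \<in> S" "\<And>i. i \<in> Basis \<Longrightarrow> norm (?f' z i) < norm (?f' x i) + 1"
      using d(2)[of z] that by (auto simp: dist_commute)
    interpret bounded_linear "?f' z"
      using smooth_on_has_derivative[OF assms(1,2) z(1)] has_derivative_bounded_linear by blast
    have "norm (?f' z v) = norm (\<Sum>i\<in>Basis. (v \<bullet> i) *\<^sub>R ?f' z i)"
      by (metis (no_types, lifting) euclidean_representation scale sum sum.cong)
    also have "\<dots> \<le> (\<Sum>i\<in>Basis. norm v * (norm (?f' x i) + 1))"
      using z(2) by (intro sum_norm_le) (auto intro!: mult_mono Basis_le_norm simp: less_imp_le)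
    finally show "norm (?f' z v) \<le> L * norm v"
      by (simp add: L_def sum_distrib_left[symmetric] mult.commute)
  qed
  have "norm (f y - f z) \<le> L * norm (y - z)" if "y \<in> ball x d" "z \<in> ball x d" for y z
  proof (rule differentiable_bound[OF convex_ball _ bound that])
    fix w assume "w \<in> ball x d"
    then have "w \<in> S" using d(2)[of w] by (auto simp: dist_commute)
    then show "(f has_derivative ?f' w) (at w within ball x d)"
      using smooth_on_has_derivative[OF assms(1,2)] has_derivative_at_withinI by blast
  qed
  then show ?thesis using d(1) by blast
qed

section \<open>Local inverses of diffeomorphism germs\<close>

lemma diffeo_germ_inverse:
  fixes k :: "'a::euclidean_space \<Rightarrow> 'b::euclidean_space"
  assumes "diffeo_germ k c d"
  obtains V k' where "open V" "d \<in> V" "smooth_on V k'" "k' d = c"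
    "\<forall>z\<in>V. k (k' z) = z"
    "\<forall>\<^sub>F y in nhds c. k y \<in> V \<and> k' (k y) = y"
    "k differentiable (at c)" "isCont k c"
proof -
  obtain U V k' where *: "open U" "c \<in> U" "open V" "homeomorphism U V k k'"
    "smooth_on U k" "smooth_on V k'" "k c = d"
    using assms unfolding diffeo_germ_def by blast
  have "d \<in> V" using * by (metis homeomorphism_image1 imageI)
  moreover have "k' d = c" using * by (metis homeomorphism_apply1)
  moreover have "\<forall>\<^sub>F y in nhds c. k y \<in> V \<and> k' (k y) = y"
    unfolding eventually_nhds using *(1,2,4)
    by (metis homeomorphism_apply1 homeomorphism_image1 imageI)
  moreover have "k (k' z) = z" if "z \<in> V" for z
    using *(4) that by (metis homeomorphism_apply2)
  ultimately show ?thesis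
    using that[of V k'] * smooth_on_differentiable[OF *(5,1,2)] smooth_on_isCont[OF *(5,1,2)] by blast
qed

text \<open>The inverse is smooth, hence locally Lipschitz. In this form the target diffeomorphism
  can be removed from an equivalence: distances of image points are bounded by distances in the
  normal form.\<close>

lemma diffeo_germ_expanding:
  fixes k :: "'a::euclidean_space \<Rightarrow> 'b::euclidean_space"
  assumes "diffeo_germ k c d"
  shows "\<exists>L U. open U \<and> c \<in> U \<and> (\<forall>y\<in>U. \<forall>z\<in>U. norm (y - z) \<le> L * norm (k y - k z))"
proof -
  obtain V k' where k': "open V" "d \<in> V" "smooth_on V k'" "k' d = c"
    "\<forall>z\<in>V. k (k' z) = z"
    "\<forall>\<^sub>F y in nhds c. k y \<in> V \<and> k' (k y) = y"
    "k differentiable (at c)" "isCont k c"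
    by (rule diffeo_germ_inverse[OF assms])
  obtain L e where L: "0 < e"
    "\<And>y z. y \<in> ball d e \<Longrightarrow> z \<in> ball d e \<Longrightarrow> norm (k' y - k' z) \<le> L * norm (y - z)"
    using smooth_on_locally_lipschitz[OF k'(3,1,2)] by blast
  have "k c = d" using k'(2,4,5) by auto
  then have "\<forall>\<^sub>F y in nhds c. k y \<in> ball d e"
    using k'(8) L(1) by (metis centre_in_ball isCont_def open_ball tendsto_at_iff_tendsto_nhds topological_tendstoD)
  with k'(6) have "\<forall>\<^sub>F y in nhds c. k y \<in> ball d e \<and> k' (k y) = y"
    by eventually_elim simp
  then obtain U where U: "open U" "c \<in> U" "\<And>y. y \<in> U \<Longrightarrow> k y \<in> ball d e \<and> k' (k y) = y"
    unfolding eventually_nhds by blast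
  have "norm (y - z) \<le> L * norm (k y - k z)" if "y \<in> U" "z \<in> U" for y z
    using L(2)[of "k y" "k z"] U(3)[OF that(1)] U(3)[OF that(2)] by simp
  then show ?thesis using U(1,2) by blast
qed

lemma diffeo_germ_inverse_derivative_inj:
  fixes h :: "R2 \<Rightarrow> R2"
  assumes "open V" "b \<in> V" "smooth_on V h'" "\<forall>z\<in>V. h (h' z) = z" "h differentiable (at (h' b))"
  shows "dx (\<lambda>z. fst (h' z)) b * dy (\<lambda>z. snd (h' z)) b
    - dy (\<lambda>z. fst (h' z)) b * dx (\<lambda>z. snd (h' z)) b \<noteq> 0"
proof
  let ?D = "frechet_derivative h' (at b)"
  have D: "(h' has_derivative ?D) (at b)"
    using smooth_on_has_derivative assms(1-3) by blast
  obtain E where E: "(h has_derivative E) (at (h' b))"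
    using assms(5) by (auto simp: differentiable_def)
  interpret E: bounded_linear E using E has_derivative_bounded_linear by blast
  have "((\<lambda>z. h (h' z)) has_derivative (\<lambda>v. E (?D v))) (at b)"
    using has_derivative_compose[OF D E] .
  then have "((\<lambda>z. z) has_derivative (\<lambda>v. E (?D v))) (at b)"
    by (rule has_derivative_transform_within_open[OF _ assms(1,2)]) (use assms(4) in blast)
  then have ED: "(\<lambda>v. E (?D v)) = (\<lambda>v. v)"
    using has_derivative_unique has_derivative_ident by blast
  have inj: "v = 0" if "?D v = 0" for v
    using fun_cong[OF ED, of v] that E.zero by simp
  let ?p = "\<lambda>z. fst (h' z)" and ?q = "\<lambda>z. snd (h' z)"
  have p: "(?p has_derivative (\<lambda>v. fst (?D v))) (at b)" and q: "(?q has_derivative (\<lambda>v. snd (?D v))) (at b)"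
    using D by (auto intro!: derivative_eq_intros)
  have "fst (?D v) = dx ?p b * fst v + dy ?p b * snd v" for v
    using fun_cong[OF has_derivative_unique[OF p has_derivative_partials[OF differentiableI[OF p]]], of v] .
  moreover have "snd (?D v) = dx ?q b * fst v + dy ?q b * snd v" for v
    using fun_cong[OF has_derivative_unique[OF q has_derivative_partials[OF differentiableI[OF q]]], of v] .
  ultimately have D0: "?D v = 0 \<longleftrightarrow>
      dx ?p b * fst v + dy ?p b * snd v = 0 \<and> dx ?q b * fst v + dy ?q b * snd v = 0" for v
    by (simp add: prod_eq_iff)
  assume det: "dx ?p b * dy ?q b - dy ?p b * dx ?q b = 0"
  \<comment> \<open>If the determinant vanishes, these vectors, one from each row of the Jacobian,
    lie in its kernel. Injectivity then makes all four entries zero.\<close>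
  have "?D (dy ?p b, - dx ?p b) = 0" "?D (dy ?q b, - dx ?q b) = 0"
    unfolding D0 using det by (simp_all add: algebra_simps)
  from this[THEN inj] have "dy ?p b = 0" "dx ?p b = 0" "dy ?q b = 0" "dx ?q b = 0"
    unfolding prod_eq_iff by simp_all
  then have "?D (1, 0) = 0" unfolding D0 by simp
  from inj[OF this] show False by (simp add: prod_eq_iff)
qed

text \<open>\<open>(p1, p2)\<close> is the inverse of the source diffeomorphism, from normal-form
  coordinates to points of \<open>M\<close>, split into components because everything later is
  computed with scalar partial derivatives. The last conjunct is its Jacobian at the origin.\<close>

definition chart :: "R2 set \<Rightarrow> (R2 \<Rightarrow> real) \<Rightarrow> (R2 \<Rightarrow> real) \<Rightarrow> R2 \<Rightarrow> bool" where
  "chart V p1 p2 q \<longleftrightarrow> open V \<and> (0, 0) \<in> V \<and> smooth_on V p1 \<and> smooth_on V p2 \<and>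
     (p1 (0, 0), p2 (0, 0)) = q \<and>
     dx p1 (0, 0) * dy p2 (0, 0) - dy p1 (0, 0) * dx p2 (0, 0) \<noteq> 0"

lemma chartD:
  assumes "chart V p1 p2 q"
  shows "open V" "(0, 0) \<in> V" "smooth_on V p1" "smooth_on V p2" "(p1 (0, 0), p2 (0, 0)) = q"
    "dx p1 (0, 0) * dy p2 (0, 0) - dy p1 (0, 0) * dx p2 (0, 0) \<noteq> 0"
  using assms unfolding chart_def by auto

lemma eventually_nhds_R2:
  assumes "\<forall>\<^sub>F z in nhds ((0, 0) :: R2). Q z"
  shows "\<exists>d>0. \<forall>X Y. \<bar>X\<bar> < d \<longrightarrow> \<bar>Y\<bar> < d \<longrightarrow> Q (X, Y)"
proof -
  obtain e where e: "e > 0" "\<And>z. dist z (0, 0) < e \<Longrightarrow> Q z"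
    using assms unfolding eventually_nhds_metric by blast
  have "Q (X, Y)" if "\<bar>X\<bar> < e / 2" "\<bar>Y\<bar> < e / 2" for X Y
    using that sqrt_sum_squares_le_sum[of "\<bar>X\<bar>" "\<bar>Y\<bar>"]
    by (intro e(2)) (simp add: dist_Pair_Pair)
  then show ?thesis using e(1) by (intro exI[of _ "e/2"]) auto
qed

text \<open>\<open>Q\<close> will be the equation of germs, and \<open>U\<close> the region on which
  the target diffeomorphism expands distances; both hold on a common square around the
  origin.\<close>

lemma chart_of_diffeo_germ:
  fixes h :: "R2 \<Rightarrow> R2" and P :: "R2 \<Rightarrow> 'b::topological_space"
  assumes "diffeo_germ h q (0, 0)" "\<forall>\<^sub>F m in nhds q. Q m" "isCont P q" "open U" "P q \<in> U"
  shows "\<exists>V p1 p2. chart V p1 p2 q \<and>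
    (\<exists>d>0. \<forall>X Y. \<bar>X\<bar> < d \<longrightarrow> \<bar>Y\<bar> < d \<longrightarrow> (X, Y) \<in> V \<and> h (p1 (X, Y), p2 (X, Y)) = (X, Y) \<and>
      Q (p1 (X, Y), p2 (X, Y)) \<and> P (p1 (X, Y), p2 (X, Y)) \<in> U)"
proof -
  obtain V h' where h': "open V" "(0, 0) \<in> V" "smooth_on V h'" "h' (0, 0) = q"
    "\<forall>z\<in>V. h (h' z) = z" "\<forall>\<^sub>F y in nhds q. h y \<in> V \<and> h' (h y) = y"
    "h differentiable (at q)" "isCont h q"
    by (rule diffeo_germ_inverse[OF assms(1)])
  let ?p = "\<lambda>z. fst (h' z)" and ?q = "\<lambda>z. snd (h' z)"
  have "chart V ?p ?q q"
    unfolding chart_def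
  proof (intro conjI)
    show "smooth_on V ?p" "smooth_on V ?q"
      by (rule smooth_on_bounded_linear[OF h'(1) _ h'(3)], rule bounded_linear_fst bounded_linear_snd)+
    show "dx ?p (0, 0) * dy ?q (0, 0) - dy ?p (0, 0) * dx ?q (0, 0) \<noteq> 0"
      using diffeo_germ_inverse_derivative_inj[OF h'(1,2,3), of h] h'(5,7) unfolding h'(4) by blast
    show "(?p (0, 0), ?q (0, 0)) = q" unfolding h'(4) by simp
  qed (rule h')+
  have "\<forall>\<^sub>F z in nhds (0, 0). Q (h' z) \<and> P (h' z) \<in> U"
  proof -
    have "\<forall>\<^sub>F m in nhds q. P m \<in> U"
      using assms(3,4,5) by (metis isCont_def tendsto_at_iff_tendsto_nhds topological_tendstoD)
    with assms(2) have "\<forall>\<^sub>F m in nhds q. Q m \<and> P m \<in> U"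
      by eventually_elim simp
    moreover have "filterlim h' (nhds q) (nhds (0, 0))"
      using smooth_on_isCont[OF h'(3,1,2)] h'(4) by (metis isCont_def tendsto_at_iff_tendsto_nhds)
    ultimately show ?thesis
      by (rule eventually_compose_filterlim)
  qed
  moreover have "\<forall>\<^sub>F z in nhds (0, 0). z \<in> V \<and> h (h' z) = z" using h'(1,2,5) eventually_nhds by blast
  ultimately have "\<forall>\<^sub>F z in nhds (0, 0). z \<in> V \<and> h (h' z) = z \<and> Q (h' z) \<and> P (h' z) \<in> U"
    by eventually_elim simp
  then have "\<exists>d>0. \<forall>X Y. \<bar>X\<bar> < d \<longrightarrow> \<bar>Y\<bar> < d \<longrightarrow> (X, Y) \<in> V \<and> h (?p (X, Y), ?q (X, Y)) = (X, Y) \<and>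
      Q (?p (X, Y), ?q (X, Y)) \<and> P (?p (X, Y), ?q (X, Y)) \<in> U"
    unfolding prod.collapse by (rule eventually_nhds_R2)
  with \<open>chart V ?p ?q q\<close> show ?thesis by blast
qed

text \<open>In the chart the target diffeomorphism applied to \<open>P\<close> is \<open>g\<close>,
  and \<open>diffeo_germ_expanding\<close> removes that diffeomorphism. Any two arguments may be
  compared, in particular those at which \<open>g\<close> nearly agrees.\<close>

lemma A_equivalent_single:
  assumes "A_equivalent [(P, q)] [(g, (0, 0))]" "isCont P q"
  shows "\<exists>V p1 p2 L d. chart V p1 p2 q \<and> 0 < d \<and>
    (\<forall>X Y X' Y'. \<bar>X\<bar> < d \<longrightarrow> \<bar>Y\<bar> < d \<longrightarrow> \<bar>X'\<bar> < d \<longrightarrow> \<bar>Y'\<bar> < d \<longrightarrow> (X, Y) \<in> V \<and>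
      norm (P (p1 (X, Y), p2 (X, Y)) - P (p1 (X', Y'), p2 (X', Y'))) \<le> L * norm (g (X, Y) - g (X', Y')))"
proof -
  obtain k c d h where k: "diffeo_germ k c d" "P q = c" "diffeo_germ h q (0, 0)"
    "\<forall>\<^sub>F m in nhds q. k (P m) = g (h m)"
    using assms(1) unfolding A_equivalent_def by auto
  obtain L U where U: "open U" "c \<in> U" "\<And>y z. y \<in> U \<Longrightarrow> z \<in> U \<Longrightarrow> norm (y - z) \<le> L * norm (k y - k z)"
    using diffeo_germ_expanding[OF k(1)] by blast
  obtain V p1 p2 e where p: "chart V p1 p2 q" "e > 0" "\<And>X Y. \<bar>X\<bar> < e \<Longrightarrow> \<bar>Y\<bar> < e \<Longrightarrow>
      (X, Y) \<in> V \<and> h (p1 (X, Y), p2 (X, Y)) = (X, Y) \<and>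
      k (P (p1 (X, Y), p2 (X, Y))) = g (h (p1 (X, Y), p2 (X, Y))) \<and> P (p1 (X, Y), p2 (X, Y)) \<in> U"
    using chart_of_diffeo_germ[OF k(3,4) assms(2) U(1)] U(2) k(2) by blast
  have "(X, Y) \<in> V \<and>
      norm (P (p1 (X, Y), p2 (X, Y)) - P (p1 (X', Y'), p2 (X', Y'))) \<le> L * norm (g (X, Y) - g (X', Y'))"
    if "\<bar>X\<bar> < e" "\<bar>Y\<bar> < e" "\<bar>X'\<bar> < e" "\<bar>Y'\<bar> < e" for X Y X' Y'
    using p(3)[OF that(1,2)] p(3)[OF that(3,4)] U(3) by metis
  then show ?thesis using p(1,2) by blast
qed

text \<open>One target diffeomorphism serves both branches, so the same constant also compares a
  point of one sheet with a point of the other. This retains the relative position of the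
  sheets.\<close>

lemma A_equivalent_pair:
  assumes "A_equivalent [(P, q'), (P, q)] [(g', (0, 0)), (g, (0, 0))]" "isCont P q" "isCont P q'"
  shows "P q' = P q \<and> (\<exists>V p1 p2 V' p1' p2' L d. chart V p1 p2 q \<and> chart V' p1' p2' q' \<and> 0 < d \<and>
    (\<forall>X Y X' Y'. \<bar>X\<bar> < d \<longrightarrow> \<bar>Y\<bar> < d \<longrightarrow> \<bar>X'\<bar> < d \<longrightarrow> \<bar>Y'\<bar> < d \<longrightarrow> (X, Y) \<in> V \<and> (X', Y') \<in> V' \<and>
      norm (P (p1 (X, Y), p2 (X, Y)) - P (p1' (X', Y'), p2' (X', Y'))) \<le> L * norm (g (X, Y) - g' (X', Y')) \<and>
      norm (P (p1 (X, Y), p2 (X, Y)) - P (p1 (X', Y'), p2 (X', Y'))) \<le> L * norm (g (X, Y) - g (X', Y'))))"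
proof -
  obtain k c d h h' where k: "diffeo_germ k c d" "P q = c" "P q' = c"
    "diffeo_germ h q (0, 0)" "\<forall>\<^sub>F m in nhds q. k (P m) = g (h m)"
    "diffeo_germ h' q' (0, 0)" "\<forall>\<^sub>F m in nhds q'. k (P m) = g' (h' m)"
    using assms(1) unfolding A_equivalent_def by auto
  obtain L U where U: "open U" "c \<in> U" "\<And>y z. y \<in> U \<Longrightarrow> z \<in> U \<Longrightarrow> norm (y - z) \<le> L * norm (k y - k z)"
    using diffeo_germ_expanding[OF k(1)] by blast
  obtain V p1 p2 e where p: "chart V p1 p2 q" "e > 0" "\<And>X Y. \<bar>X\<bar> < e \<Longrightarrow> \<bar>Y\<bar> < e \<Longrightarrow>
      (X, Y) \<in> V \<and> h (p1 (X, Y), p2 (X, Y)) = (X, Y) \<and>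
      k (P (p1 (X, Y), p2 (X, Y))) = g (h (p1 (X, Y), p2 (X, Y))) \<and> P (p1 (X, Y), p2 (X, Y)) \<in> U"
    using chart_of_diffeo_germ[OF k(4,5) assms(2) U(1)] U(2) k(2) by blast
  obtain V' p1' p2' e' where p': "chart V' p1' p2' q'" "e' > 0" "\<And>X Y. \<bar>X\<bar> < e' \<Longrightarrow> \<bar>Y\<bar> < e' \<Longrightarrow>
      (X, Y) \<in> V' \<and> h' (p1' (X, Y), p2' (X, Y)) = (X, Y) \<and>
      k (P (p1' (X, Y), p2' (X, Y))) = g' (h' (p1' (X, Y), p2' (X, Y))) \<and> P (p1' (X, Y), p2' (X, Y)) \<in> U"
    using chart_of_diffeo_germ[OF k(6,7) assms(3) U(1)] U(2) k(3) by blast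
  have "(X, Y) \<in> V \<and> (X', Y') \<in> V' \<and>
      norm (P (p1 (X, Y), p2 (X, Y)) - P (p1' (X', Y'), p2' (X', Y'))) \<le> L * norm (g (X, Y) - g' (X', Y')) \<and>
      norm (P (p1 (X, Y), p2 (X, Y)) - P (p1 (X', Y'), p2 (X', Y'))) \<le> L * norm (g (X, Y) - g (X', Y'))"
    if "\<bar>X\<bar> < min e e'" "\<bar>Y\<bar> < min e e'" "\<bar>X'\<bar> < min e e'" "\<bar>Y'\<bar> < min e e'" for X Y X' Y'
    using p(3)[of X Y] p(3)[of X' Y'] p'(3)[of X' Y'] that
      U(3)[of "P (p1 (X, Y), p2 (X, Y))" "P (p1' (X', Y'), p2' (X', Y'))"]
      U(3)[of "P (p1 (X, Y), p2 (X, Y))" "P (p1 (X', Y'), p2 (X', Y'))"] by simp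
  moreover have "0 < min e e'" using p(2) p'(2) by simp
  ultimately show ?thesis using p(1) p'(1) k(2,3) by blast
qed

section \<open>Vanishing orders\<close>

lemma eventually_abs_less: "d > 0 \<Longrightarrow> \<forall>\<^sub>F t::real in nhds 0. \<bar>t\<bar> < d"
  by (intro order_tendstoD(2)[of "\<lambda>t. \<bar>t\<bar>" 0]) (auto intro!: tendsto_eq_intros filterlim_ident)

lemma eventually_at_0_neq: "\<forall>\<^sub>F t::real in at 0. t \<noteq> 0"
  by (simp add: eventually_at_filter)

lemma DERIV_imp_quotient:
  assumes "(R has_real_derivative r) (at 0)" "R 0 = 0"
  shows "((\<lambda>t. R t / t) \<longlongrightarrow> r) (at 0)"
  using assms by (simp add: has_field_derivative_iff)

lemma taylor_quotient2:
  assumes "\<forall>\<^sub>F t in nhds 0. (R has_real_derivative R' t) (at t)" "(R' has_real_derivative r) (at 0)"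
    and "R 0 = 0" "R' 0 = 0"
  shows "((\<lambda>t. R t / t ^ 2) \<longlongrightarrow> r / 2) (at 0)"
proof (rule lhopital[where f' = R' and g' = "\<lambda>t. 2 * t"])
  have "isCont R 0"
    using eventually_nhds_x_imp_x[OF assms(1)] DERIV_isCont by blast
  then show "(R \<longlongrightarrow> 0) (at 0)" using assms(3) by (simp add: isCont_def)
  show "\<forall>\<^sub>F t in at 0. (R has_real_derivative R' t) (at t)"
    using assms(1) by (simp add: eventually_at_filter eventually_mono)
  show "((\<lambda>t. R' t / (2 * t)) \<longlongrightarrow> r / 2) (at 0)"
    using tendsto_divide[OF DERIV_imp_quotient[OF assms(2,4)] tendsto_const[of 2]]
    by (simp add: mult.commute)
qed (auto intro!: tendsto_eq_intros derivative_eq_intros always_eventually simp: eventually_at_0_neq)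

lemma taylor_quotient3:
  assumes "\<forall>\<^sub>F t in nhds 0. (R has_real_derivative R1 t) (at t)"
    "\<forall>\<^sub>F t in nhds 0. (R1 has_real_derivative R2 t) (at t)" "(R2 has_real_derivative r) (at 0)"
    and "R 0 = 0" "R1 0 = 0" "R2 0 = 0"
  shows "((\<lambda>t. R t / t ^ 3) \<longlongrightarrow> r / 6) (at 0)"
proof (rule lhopital[where f' = R1 and g' = "\<lambda>t. 3 * t ^ 2"])
  have "isCont R 0"
    using eventually_nhds_x_imp_x[OF assms(1)] DERIV_isCont by blast
  then show "(R \<longlongrightarrow> 0) (at 0)" using assms(4) by (simp add: isCont_def)
  show "\<forall>\<^sub>F t in at 0. (R has_real_derivative R1 t) (at t)"
    using assms(1) by (simp add: eventually_at_filter eventually_mono)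
  show "((\<lambda>t. R1 t / (3 * t ^ 2)) \<longlongrightarrow> r / 6) (at 0)"
    using tendsto_divide[OF taylor_quotient2[OF assms(2,3,5,6)] tendsto_const[of 3]]
    by (simp add: mult.commute)
qed (auto intro!: tendsto_eq_intros derivative_eq_intros always_eventually simp: eventually_at_0_neq)

text \<open>Turns a bound from the Lipschitz comparison into a statement on Taylor coefficients; the
  bound must be one order better than the divisor.\<close>

lemma quotient_bound_tendsto_0:
  fixes R :: "real \<Rightarrow> real"
  assumes "\<forall>\<^sub>F t in nhds 0. \<bar>R t\<bar> \<le> C * \<bar>t\<bar> ^ Suc n"
  shows "((\<lambda>t. R t / t ^ n) \<longlongrightarrow> 0) (at 0)"
proof (rule tendsto_0_le[where K = 1])
  show "((\<lambda>t. C * \<bar>t\<bar>) \<longlongrightarrow> 0) (at 0)"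
    by (auto intro!: tendsto_eq_intros)
  have "\<forall>\<^sub>F t in at 0. \<bar>R t\<bar> \<le> C * \<bar>t\<bar> ^ Suc n"
    using assms by (simp add: eventually_at_filter eventually_mono)
  then show "\<forall>\<^sub>F t in at 0. norm (R t / t ^ n) \<le> norm (C * \<bar>t\<bar>) * 1"
    using eventually_at_0_neq
  proof eventually_elim
    case (elim t)
    then have "\<bar>R t\<bar> \<le> (C * \<bar>t\<bar>) * \<bar>t ^ n\<bar>" by (simp add: power_abs mult.assoc)
    also have "\<dots> \<le> \<bar>C * \<bar>t\<bar>\<bar> * \<bar>t ^ n\<bar>" by (rule mult_right_mono) auto
    finally show ?case using elim by (simp add: field_simps)
  qed
qed

lemma vanishing_order2:
  assumes "(R has_real_derivative r) (at 0)" "\<forall>\<^sub>F t in nhds 0. \<bar>R t\<bar> \<le> C * \<bar>t\<bar> ^ 2"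
  shows "R 0 = 0" "r = 0"
proof -
  show "R 0 = 0" using eventually_nhds_x_imp_x[OF assms(2)] by simp
  then have "((\<lambda>t. R t / t) \<longlongrightarrow> r) (at 0)" by (rule DERIV_imp_quotient[OF assms(1)])
  moreover have "((\<lambda>t. R t / t) \<longlongrightarrow> 0) (at 0)"
    using quotient_bound_tendsto_0[of R C 1] assms(2) by (simp add: power2_eq_square)
  ultimately show "r = 0" using tendsto_unique trivial_limit_at by blast
qed

lemma eventually_power_bound_mono:
  fixes R :: "real \<Rightarrow> real"
  assumes "\<forall>\<^sub>F t in nhds 0. \<bar>R t\<bar> \<le> C * \<bar>t\<bar> ^ Suc n"
  shows "\<forall>\<^sub>F t in nhds 0. \<bar>R t\<bar> \<le> \<bar>C\<bar> * \<bar>t\<bar> ^ n"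
proof -
  have "\<forall>\<^sub>F t::real in nhds 0. \<bar>t\<bar> < 1"
    by (rule eventually_abs_less) simp
  with assms show ?thesis
  proof eventually_elim
    case (elim t)
    have "C * \<bar>t\<bar> ^ Suc n \<le> \<bar>C\<bar> * (1 * \<bar>t\<bar> ^ n)"
      unfolding power_Suc using elim(2) by (intro mult_mono) auto
    then show ?case using elim(1) by simp
  qed
qed

lemma vanishing_order3:
  assumes "\<forall>\<^sub>F t in nhds 0. (R has_real_derivative R1 t) (at t)" "(R1 has_real_derivative r) (at 0)"
    "\<forall>\<^sub>F t in nhds 0. \<bar>R t\<bar> \<le> C * \<bar>t\<bar> ^ 3"
  shows "R 0 = 0" "R1 0 = 0" "r = 0"
proof -
  have "\<forall>\<^sub>F t in nhds 0. \<bar>R t\<bar> \<le> \<bar>C\<bar> * \<bar>t\<bar> ^ 2"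
    using eventually_power_bound_mono[of R C 2] assms(3) by (simp add: eval_nat_numeral)
  note * = vanishing_order2[OF eventually_nhds_x_imp_x[OF assms(1)] this]
  show "R 0 = 0" "R1 0 = 0" by (fact *)+
  have "((\<lambda>t. R t / t ^ 2) \<longlongrightarrow> r / 2) (at 0)"
    by (rule taylor_quotient2[OF assms(1,2) *])
  moreover have "((\<lambda>t. R t / t ^ 2) \<longlongrightarrow> 0) (at 0)"
    using quotient_bound_tendsto_0[of R C 2] assms(3) by (simp add: eval_nat_numeral)
  ultimately have "r / 2 = 0" using tendsto_unique trivial_limit_at by blast
  then show "r = 0" by simp
qed

lemma vanishing_order4:
  assumes "\<forall>\<^sub>F t in nhds 0. (R has_real_derivative R1 t) (at t)"
    "\<forall>\<^sub>F t in nhds 0. (R1 has_real_derivative R2 t) (at t)" "(R2 has_real_derivative r) (at 0)"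
    "\<forall>\<^sub>F t in nhds 0. \<bar>R t\<bar> \<le> C * \<bar>t\<bar> ^ 4"
  shows "r = 0"
proof -
  have "\<forall>\<^sub>F t in nhds 0. \<bar>R t\<bar> \<le> \<bar>C\<bar> * \<bar>t\<bar> ^ 3"
    using eventually_power_bound_mono[of R C 3] assms(4) by (simp add: eval_nat_numeral)
  note * = vanishing_order3[OF assms(1) eventually_nhds_x_imp_x[OF assms(2)] this]
  have "((\<lambda>t. R t / t ^ 3) \<longlongrightarrow> r / 6) (at 0)"
    by (rule taylor_quotient3[OF assms(1,2,3) *])
  moreover have "((\<lambda>t. R t / t ^ 3) \<longlongrightarrow> 0) (at 0)"
    using quotient_bound_tendsto_0[of R C 3] assms(4) by (simp add: eval_nat_numeral)
  ultimately have "r / 6 = 0" using tendsto_unique trivial_limit_at by blast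
  then show "r = 0" by simp
qed

lemma eventually_nhds_uminus:
  "\<forall>\<^sub>F t in nhds (0::real). Q t \<Longrightarrow> \<forall>\<^sub>F t in nhds 0. Q (- t)"
  by (rule eventually_compose_filterlim) (auto intro!: tendsto_eq_intros filterlim_ident)

lemma DERIV_reflect:
  assumes "(R has_real_derivative r) (at (- t))"
  shows "((\<lambda>t. R (- t)) has_real_derivative - r) (at t)"
  using assms by (simp add: DERIV_mirror)

text \<open>Passing to \<open>R t - R (- t)\<close> cancels the even Taylor coefficients, which the
  comparison of mirror points leaves free, and doubles the third derivative.\<close>

lemma odd_part_third_derivative:
  assumes 1: "\<forall>\<^sub>F t in nhds 0. (R has_real_derivative R1 t) (at t)"
    and 2: "\<forall>\<^sub>F t in nhds 0. (R1 has_real_derivative R2 t) (at t)"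
    and 3: "(R2 has_real_derivative r) (at 0)"
    and bound: "\<forall>\<^sub>F t in nhds 0. \<bar>R t - R (- t)\<bar> \<le> C * \<bar>t\<bar> ^ 4"
  shows "r = 0"
proof -
  have "2 * r = 0"
  proof (rule vanishing_order4[OF _ _ _ bound])
    show "\<forall>\<^sub>F t in nhds 0. ((\<lambda>t. R t - R (- t)) has_real_derivative R1 t + R1 (- t)) (at t)"
      using 1 eventually_nhds_uminus[OF 1]
      by eventually_elim (auto intro!: derivative_eq_intros DERIV_reflect)
    show "\<forall>\<^sub>F t in nhds 0. ((\<lambda>t. R1 t + R1 (- t)) has_real_derivative R2 t - R2 (- t)) (at t)"
      using 2 eventually_nhds_uminus[OF 2]
      by eventually_elim (auto intro!: derivative_eq_intros DERIV_reflect)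
    have "(R2 has_real_derivative r) (at (- 0))" using 3 by simp
    then show "((\<lambda>t. R2 t - R2 (- t)) has_real_derivative 2 * r) (at 0)"
      using 3 by (auto intro!: derivative_eq_intros DERIV_reflect)
  qed
  then show ?thesis by simp
qed

text \<open>After division by \<open>t\<close> the cubic term tends to 0, so the derivative is
  bounded by the linear coefficient \<open>c\<close> alone. In the application \<open>c\<close> is
  \<open>\<omega> X\<close> at a point of the X-axis.\<close>

lemma odd_part_first_derivative:
  fixes N :: "real \<Rightarrow> real"
  assumes "(N has_real_derivative n) (at 0)" "d > 0"
    and "\<And>t. \<bar>t\<bar> < d \<Longrightarrow> \<bar>N t - N (- t)\<bar> \<le> K * (c * \<bar>t\<bar> + \<bar>t\<bar> ^ 3)"
  shows "2 * \<bar>n\<bar> \<le> K * c"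
proof (rule tendsto_le)
  show "((\<lambda>t. K * (c + t ^ 2)) \<longlongrightarrow> K * c) (at 0)"
    by (auto intro!: tendsto_eq_intros)
  have "(N has_real_derivative n) (at (- 0))" using assms(1) by simp
  then have "((\<lambda>t. N t - N (- t)) has_real_derivative 2 * n) (at 0)"
    using assms(1) by (auto intro!: derivative_eq_intros DERIV_reflect)
  from DERIV_imp_quotient[OF this]
  have "((\<lambda>t. (N t - N (- t)) / t) \<longlongrightarrow> 2 * n) (at 0)" by simp
  from tendsto_rabs[OF this]
  show "((\<lambda>t. \<bar>(N t - N (- t)) / t\<bar>) \<longlongrightarrow> 2 * \<bar>n\<bar>) (at 0)" by (simp add: abs_mult)
  have "\<forall>\<^sub>F t in at 0. \<bar>t\<bar> < d"
    using assms(2) by (intro order_tendstoD(2)[of "\<lambda>t. \<bar>t\<bar>" 0]) (auto intro!: tendsto_eq_intros)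
  with eventually_at_0_neq show "\<forall>\<^sub>F t in at 0. \<bar>(N t - N (- t)) / t\<bar> \<le> K * (c + t ^ 2)"
  proof eventually_elim
    case (elim t)
    have "\<bar>t\<bar> ^ 3 = t ^ 2 * \<bar>t\<bar>" by (simp add: power3_eq_cube power2_eq_square abs_mult_self_eq)
    then have "\<bar>N t - N (- t)\<bar> \<le> (K * (c + t ^ 2)) * \<bar>t\<bar>"
      using assms(3)[OF elim(2)] by (simp add: algebra_simps)
    then show ?case using elim(1) by (simp add: field_simps)
  qed
qed simp

section \<open>Necessary conditions for the singularities of the projections\<close>

text \<open>Derivative in the direction \<open>(u, 1)\<close>, the kernel of the first component
  \<open>x - u * y\<close> of the projection: a point \<open>q\<close> is singular for the projection along
  \<open>(u, v, w)\<close> iff \<open>Da u f1 q = v\<close> and \<open>Da u f2 q = w\<close>.\<close>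

definition Da :: "real \<Rightarrow> (R2 \<Rightarrow> real) \<Rightarrow> R2 \<Rightarrow> real" where
  "Da u f = (\<lambda>z. u * dx f z + dy f z)"

lemma has_derivative_Da:
  assumes "smooth_on W f" "open W" "z \<in> W"
  shows "(Da u f has_derivative (\<lambda>h. (u * dx (dx f) z + dx (dy f) z) * fst h +
    (u * dx (dy f) z + dy (dy f) z) * snd h)) (at z)"
proof -
  have "(dx f has_derivative (\<lambda>h. dx (dx f) z * fst h + dy (dx f) z * snd h)) (at z)"
    "(dy f has_derivative (\<lambda>h. dx (dy f) z * fst h + dy (dy f) z * snd h)) (at z)"
    using smooth_on_differentiable[OF smooth_on_dx assms(2,3)] smooth_on_differentiable[OF smooth_on_dy assms(2,3)]
      assms has_derivative_partials by blast+
  then show ?thesis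
    unfolding Da_def dx_dy_commute[OF assms, symmetric]
    by (auto intro!: derivative_eq_intros simp: algebra_simps)
qed

lemma partials_Da:
  assumes "smooth_on W f" "open W" "z \<in> W"
  shows "dx (Da u f) z = u * dx (dx f) z + dx (dy f) z" "dy (Da u f) z = u * dx (dy f) z + dy (dy f) z"
  using partials_of_has_derivative[OF has_derivative_Da[OF assms]] by simp_all

text \<open>Stated for \<open>c * f + g\<close> because this is the shape of
  \<open>Da u f\<close>.\<close>

lemma Ck_on_add_scaled:
  fixes f g :: "'a::real_normed_vector \<Rightarrow> real"
  assumes "open S"
  shows "Ck_on k f S \<Longrightarrow> Ck_on k g S \<Longrightarrow> Ck_on k (\<lambda>z. c * f z + g z) S"
proof (induction k arbitrary: f g)
  case 0
  then show ?case by (auto intro!: continuous_intros)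
next
  case (Suc k)
  have D: "((\<lambda>z. c * f z + g z) has_derivative
      (\<lambda>v. c * frechet_derivative f (at z) v + frechet_derivative g (at z) v)) (at z)" if "z \<in> S" for z
    using Suc.prems that assms
    by (auto intro!: derivative_eq_intros simp: differentiable_on_eq_differentiable_at frechet_derivative_works[symmetric])
  have "(\<lambda>z. c * f z + g z) differentiable_on S"
    using D by (meson differentiableI differentiable_at_imp_differentiable_on)
  moreover have "Ck_on k (\<lambda>z. frechet_derivative (\<lambda>z. c * f z + g z) (at z) v) S" for v
  proof (rule Ck_on_cong[OF assms])
    show "Ck_on k (\<lambda>z. c * frechet_derivative f (at z) v + frechet_derivative g (at z) v) S"
      using Suc by simp
    show "c * frechet_derivative f (at z) v + frechet_derivative g (at z) v
        = frechet_derivative (\<lambda>z. c * f z + g z) (at z) v" if "z \<in> S" for z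
      by (rule fun_cong[OF frechet_derivative_at[OF D[OF that]]])
  qed
  ultimately show ?case by simp
qed

lemma smooth_on_Da:
  "smooth_on W f \<Longrightarrow> open W \<Longrightarrow> smooth_on W (Da u f)"
  unfolding Da_def using Ck_on_add_scaled smooth_on_dx smooth_on_dy unfolding smooth_on_def by blast

lemma chart_DERIV:
  assumes "smooth_on V p" "open V" "(X, Y) \<in> V"
  shows "((\<lambda>X. p (X, Y)) has_real_derivative dx p (X, Y)) (at X)"
    and "((\<lambda>Y. p (X, Y)) has_real_derivative dy p (X, Y)) (at Y)"
  using DERIV_compose_pair[of p "\<lambda>X. X" X "\<lambda>_. Y" 1 0] DERIV_compose_pair[of p "\<lambda>_. X" Y "\<lambda>Y. Y" 0 1]
    smooth_on_differentiable[OF assms] by simp_all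

lemma eventually_along_axes:
  assumes "open V" "((0::real), (0::real)) \<in> V"
  shows "\<forall>\<^sub>F X in nhds 0. (X, 0) \<in> V" "\<forall>\<^sub>F X in nhds 0. (0, X) \<in> V"
proof -
  have "((\<lambda>X::real. (X, 0::real)) \<longlongrightarrow> (0, 0)) (nhds 0)" "((\<lambda>X::real. (0::real, X)) \<longlongrightarrow> (0, 0)) (nhds 0)"
    by (auto intro!: tendsto_Pair filterlim_ident)
  then show "\<forall>\<^sub>F X in nhds 0. (X, 0) \<in> V" "\<forall>\<^sub>F X in nhds 0. (0, X) \<in> V"
    using assms topological_tendstoD by blast+
qed

lemma chart_tendsto:
  assumes "chart V p1 p2 q"
  shows "((\<lambda>X. (p1 (X, 0), p2 (X, 0))) \<longlongrightarrow> q) (nhds 0)"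
    "((\<lambda>Y. (p1 (0, Y), p2 (0, Y))) \<longlongrightarrow> q) (nhds 0)"
proof -
  have V: "open V" "(0, 0) \<in> V" "smooth_on V p1" "smooth_on V p2" "q = (p1 (0, 0), p2 (0, 0))"
    using assms unfolding chart_def by auto
  have "isCont (\<lambda>X. p (X, 0)) 0" "isCont (\<lambda>Y. p (0, Y)) 0" if "smooth_on V p" for p :: "R2 \<Rightarrow> real"
    using chart_DERIV[OF that V(1,2)] DERIV_isCont by blast+
  from this[OF V(3)] this[OF V(4)]
  show "((\<lambda>X. (p1 (X, 0), p2 (X, 0))) \<longlongrightarrow> q) (nhds 0)"
    "((\<lambda>Y. (p1 (0, Y), p2 (0, Y))) \<longlongrightarrow> q) (nhds 0)"
    unfolding V(5) isCont_def tendsto_at_iff_tendsto_nhds[of "\<lambda>X. p1 (X, 0)"]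
      tendsto_at_iff_tendsto_nhds[of "\<lambda>X. p2 (X, 0)"] tendsto_at_iff_tendsto_nhds[of "\<lambda>Y. p1 (0, Y)"]
      tendsto_at_iff_tendsto_nhds[of "\<lambda>Y. p2 (0, Y)"]
    by - (rule tendsto_Pair; assumption)+
qed

text \<open>The normal forms of type \<open>B\<^sub>2\<close> and \<open>S\<^sub>2\<close> are even in
  \<open>Y\<close> up to terms \<open>\<omega> X * Y\<close>, \<open>Y ^ 3\<close>. In a chart
  \<open>(p1, p2)\<close> the \<open>Y\<close>-derivative of the projection along the
  \<open>X\<close>-axis has therefore order \<open>\<omega>\<close>.\<close>

lemma contact_along_axis:
  assumes p: "chart V p1 p2 q" and f: "smooth_on W f" "open W" "q \<in> W"
    and d: "d > 0" and \<omega>: "\<omega> 0 = 0"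
    and l: "\<And>X Y. \<bar>X\<bar> < d \<Longrightarrow> \<bar>Y\<bar> < d \<Longrightarrow>
      \<bar>(p1 (X, Y) - u * p2 (X, Y)) - (p1 (X, - Y) - u * p2 (X, - Y))\<bar> \<le> K * (\<omega> X * \<bar>Y\<bar> + \<bar>Y\<bar> ^ 3)"
    and m: "\<And>X Y. \<bar>X\<bar> < d \<Longrightarrow> \<bar>Y\<bar> < d \<Longrightarrow>
      \<bar>(f (p1 (X, Y), p2 (X, Y)) - c * p2 (X, Y)) - (f (p1 (X, - Y), p2 (X, - Y)) - c * p2 (X, - Y))\<bar>
        \<le> K * (\<omega> X * \<bar>Y\<bar> + \<bar>Y\<bar> ^ 3)"
  shows "dy p1 (0, 0) = u * dy p2 (0, 0)" "dy p2 (0, 0) \<noteq> 0"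
    "\<exists>C. \<forall>\<^sub>F X in nhds 0. \<bar>Da u f (p1 (X, 0), p2 (X, 0)) - c\<bar> \<le> C * \<omega> X"
proof -
  note V = chartD[OF p]
  let ?q = "\<lambda>X. (p1 (X, 0), p2 (X, 0))"
  have contact: "2 * \<bar>dy p1 (X, 0) - u * dy p2 (X, 0)\<bar> \<le> K * \<omega> X"
     "2 * \<bar>dx f (?q X) * dy p1 (X, 0) + dy f (?q X) * dy p2 (X, 0) - c * dy p2 (X, 0)\<bar> \<le> K * \<omega> X"
    if "\<bar>X\<bar> < d" "(X, 0) \<in> V" "?q X \<in> W" for X
  proof -
    note D = chart_DERIV(2)[OF V(3,1) that(2)] chart_DERIV(2)[OF V(4,1) that(2)]
    have "((\<lambda>Y. p1 (X, Y) - u * p2 (X, Y)) has_real_derivative dy p1 (X, 0) - u * dy p2 (X, 0)) (at 0)"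
      by (intro DERIV_diff DERIV_cmult D)
    from odd_part_first_derivative[OF this d l[OF that(1)]]
    show "2 * \<bar>dy p1 (X, 0) - u * dy p2 (X, 0)\<bar> \<le> K * \<omega> X" by simp
    have "((\<lambda>Y. f (p1 (X, Y), p2 (X, Y)) - c * p2 (X, Y)) has_real_derivative
        dx f (?q X) * dy p1 (X, 0) + dy f (?q X) * dy p2 (X, 0) - c * dy p2 (X, 0)) (at 0)"
      by (intro DERIV_diff DERIV_cmult D DERIV_compose_pair smooth_on_differentiable[OF f(1,2)] that)
    from odd_part_first_derivative[OF this d m[OF that(1)]]
    show "2 * \<bar>dx f (?q X) * dy p1 (X, 0) + dy f (?q X) * dy p2 (X, 0) - c * dy p2 (X, 0)\<bar> \<le> K * \<omega> X"
      by simp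
  qed
  have "2 * \<bar>dy p1 (0, 0) - u * dy p2 (0, 0)\<bar> \<le> 0"
    using contact(1)[of 0] d V(2,5) f(3) \<omega> by simp
  then show *: "dy p1 (0, 0) = u * dy p2 (0, 0)" by simp
  \<comment> \<open>Otherwise \<open>dy p1 (0, 0)\<close> vanishes as well, and with it the
    Jacobian.\<close>
  show nz: "dy p2 (0, 0) \<noteq> 0"
    using V(6) * by auto
  note q0 = chart_tendsto(1)[OF p]
  have "isCont (\<lambda>X. dy p2 (X, 0)) 0"
    using DERIV_isCont[OF chart_DERIV(1)[OF smooth_on_dy[OF V(4,1)] V(1,2)]] .
  then have "((\<lambda>X. \<bar>dy p2 (X, 0)\<bar>) \<longlongrightarrow> \<bar>dy p2 (0, 0)\<bar>) (nhds 0)"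
    unfolding isCont_def tendsto_at_iff_tendsto_nhds[of "\<lambda>X. dy p2 (X, 0)"] by (rule tendsto_rabs)
  \<comment> \<open>Keeps the divisor \<open>dy p2 (X, 0)\<close> of the final estimate away from
    0.\<close>
  then have ev1: "\<forall>\<^sub>F X in nhds 0. \<bar>dy p2 (0, 0)\<bar> / 2 < \<bar>dy p2 (X, 0)\<bar>"
    by (rule order_tendstoD) (use nz in simp)
  have "(dx f \<longlongrightarrow> dx f q) (nhds q)"
    using smooth_on_isCont[OF smooth_on_dx[OF f(1,2)] f(2,3)]
    unfolding isCont_def tendsto_at_iff_tendsto_nhds[of "dx f"] .
  from tendsto_rabs[OF filterlim_compose[OF this q0]]
  have ev2: "\<forall>\<^sub>F X in nhds 0. \<bar>dx f (?q X)\<bar> < \<bar>dx f q\<bar> + 1"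
    by (rule order_tendstoD) simp
  have ev3: "\<forall>\<^sub>F X in nhds 0. ?q X \<in> W"
    using topological_tendstoD[OF q0 f(2,3)] .
  have ev4: "\<forall>\<^sub>F X::real in nhds 0. \<bar>X\<bar> < d"
    using d eventually_abs_less by blast
  define C where "C = (K * (\<bar>dx f q\<bar> + 2)) / \<bar>dy p2 (0, 0)\<bar>"
  from ev1 ev2 ev3 ev4 eventually_along_axes(1)[OF V(1,2)]
  have "\<forall>\<^sub>F X in nhds 0. \<bar>Da u f (?q X) - c\<bar> \<le> C * \<omega> X"
  proof eventually_elim
    case (elim X)
    let ?a = "dy p1 (X, 0)" and ?b = "dy p2 (X, 0)"
    have 1: "2 * \<bar>?a - u * ?b\<bar> \<le> K * \<omega> X"
      "2 * \<bar>dx f (?q X) * ?a + dy f (?q X) * ?b - c * ?b\<bar> \<le> K * \<omega> X"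
      using contact elim by auto
    \<comment> \<open>The Y-derivative of the \<open>f\<close> component minus \<open>dx f\<close>
      times that of \<open>x - u * y\<close> isolates \<open>Da u f - c\<close>, so the two bounds
      in \<open>contact\<close> combine.\<close>
    have "(Da u f (?q X) - c) * ?b
        = (dx f (?q X) * ?a + dy f (?q X) * ?b - c * ?b) - dx f (?q X) * (?a - u * ?b)"
      by (simp add: Da_def algebra_simps)
    then have "\<bar>(Da u f (?q X) - c) * ?b\<bar>
        \<le> \<bar>dx f (?q X) * ?a + dy f (?q X) * ?b - c * ?b\<bar> + \<bar>dx f (?q X) * (?a - u * ?b)\<bar>"
      by (simp only: abs_triangle_ineq4)
    then have "\<bar>Da u f (?q X) - c\<bar> * \<bar>?b\<bar>
        \<le> \<bar>dx f (?q X) * ?a + dy f (?q X) * ?b - c * ?b\<bar> + \<bar>dx f (?q X)\<bar> * \<bar>?a - u * ?b\<bar>"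
      unfolding abs_mult .
    also have "\<dots> \<le> K * \<omega> X / 2 + (\<bar>dx f q\<bar> + 1) * (K * \<omega> X / 2)"
      using 1 elim(2) by (intro add_mono mult_mono) auto
    also have "\<dots> = (K * (\<bar>dx f q\<bar> + 2)) * \<omega> X / 2" by (simp add: algebra_simps)
    finally have 2: "\<bar>Da u f (?q X) - c\<bar> * \<bar>?b\<bar> \<le> (K * (\<bar>dx f q\<bar> + 2)) * \<omega> X / 2" .
    have "\<bar>Da u f (?q X) - c\<bar> * (\<bar>dy p2 (0, 0)\<bar> / 2) \<le> \<bar>Da u f (?q X) - c\<bar> * \<bar>?b\<bar>"
      using elim(1) by (intro mult_left_mono) auto
    with 2 have "\<bar>Da u f (?q X) - c\<bar> * \<bar>dy p2 (0, 0)\<bar> \<le> (K * (\<bar>dx f q\<bar> + 2)) * \<omega> X"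
      by simp
    then have "\<bar>Da u f (?q X) - c\<bar> \<le> (K * (\<bar>dx f q\<bar> + 2)) * \<omega> X / \<bar>dy p2 (0, 0)\<bar>"
      using nz by (intro mult_imp_le_div_pos) simp_all
    then show ?case by (simp add: C_def)
  qed
  then show "\<exists>C. \<forall>\<^sub>F X in nhds 0. \<bar>Da u f (p1 (X, 0), p2 (X, 0)) - c\<bar> \<le> C * \<omega> X" by blast
qed

lemma DERIV_along_X_axis:
  assumes p: "chart V p1 p2 q" and f: "smooth_on W f" "open W" "q \<in> W"
  shows "\<forall>\<^sub>F X in nhds 0. ((\<lambda>X. f (p1 (X, 0), p2 (X, 0))) has_real_derivative
      dx f (p1 (X, 0), p2 (X, 0)) * dx p1 (X, 0) + dy f (p1 (X, 0), p2 (X, 0)) * dx p2 (X, 0)) (at X)"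
  and "((\<lambda>X. dx f (p1 (X, 0), p2 (X, 0)) * dx p1 (X, 0) + dy f (p1 (X, 0), p2 (X, 0)) * dx p2 (X, 0))
      has_real_derivative
      dx (dx f) q * dx p1 (0, 0) ^ 2 + 2 * dx (dy f) q * dx p1 (0, 0) * dx p2 (0, 0)
      + dy (dy f) q * dx p2 (0, 0) ^ 2 + dx f q * dx (dx p1) (0, 0) + dy f q * dx (dx p2) (0, 0)) (at 0)"
proof -
  note V = chartD[OF p]
  have D: "((\<lambda>X. g (p1 (X, 0), p2 (X, 0))) has_real_derivative
      dx g (p1 (X, 0), p2 (X, 0)) * dx p1 (X, 0) + dy g (p1 (X, 0), p2 (X, 0)) * dx p2 (X, 0)) (at X)"
    if "smooth_on W g" "(X, 0) \<in> V" "(p1 (X, 0), p2 (X, 0)) \<in> W" for g X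
    by (rule DERIV_compose_pair[OF smooth_on_differentiable[OF that(1) f(2) that(3)]
        chart_DERIV(1)[OF V(3,1) that(2)] chart_DERIV(1)[OF V(4,1) that(2)]])
  note q0 = chart_tendsto(1)[OF p]
  show "\<forall>\<^sub>F X in nhds 0. ((\<lambda>X. f (p1 (X, 0), p2 (X, 0))) has_real_derivative
      dx f (p1 (X, 0), p2 (X, 0)) * dx p1 (X, 0) + dy f (p1 (X, 0), p2 (X, 0)) * dx p2 (X, 0)) (at X)"
    using eventually_along_axes(1)[OF V(1,2)] topological_tendstoD[OF q0 f(2,3)]
    by eventually_elim (rule D[OF f(1)])
  have q: "(p1 (0, 0), p2 (0, 0)) \<in> W" using V(5) f(3) by simp
  note D1 = D[OF smooth_on_dx[OF f(1,2)] V(2) q] D[OF smooth_on_dy[OF f(1,2)] V(2) q]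
    chart_DERIV(1)[OF smooth_on_dx[OF V(3,1)] V(1,2)] chart_DERIV(1)[OF smooth_on_dx[OF V(4,1)] V(1,2)]
  show "((\<lambda>X. dx f (p1 (X, 0), p2 (X, 0)) * dx p1 (X, 0) + dy f (p1 (X, 0), p2 (X, 0)) * dx p2 (X, 0))
      has_real_derivative
      dx (dx f) q * dx p1 (0, 0) ^ 2 + 2 * dx (dy f) q * dx p1 (0, 0) * dx p2 (0, 0)
      + dy (dy f) q * dx p2 (0, 0) ^ 2 + dx f q * dx (dx p1) (0, 0) + dy f q * dx (dx p2) (0, 0)) (at 0)"
    by (rule DERIV_cong[OF DERIV_add[OF DERIV_mult[OF D1(1,3)] DERIV_mult[OF D1(2,4)]]])
      (simp add: V(5) dx_dy_commute[OF f] power2_eq_square algebra_simps)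
qed

section \<open>Iterated partial derivatives and powers of the direction derivative\<close>

lemma partials_cong:
  assumes "\<And>z. z \<in> W \<Longrightarrow> f z = g z" "open W" "z \<in> W" "smooth_on W g"
  shows "dx f z = dx g z" "dy f z = dy g z"
proof -
  have "(f has_derivative (\<lambda>h. dx g z * fst h + dy g z * snd h)) (at z)"
    using has_derivative_transform_within_open[OF has_derivative_partials[OF
      smooth_on_differentiable[OF assms(4,2,3)]] assms(2,3)] assms(1) by metis
  from partials_of_has_derivative[OF this]
  show "dx f z = dx g z" "dy f z = dy g z" by simp_all
qed

text \<open>Mixed partials agree only on \<open>W\<close>; since \<open>W\<close> is open,
  \<open>partials_cong\<close> carries the equality through one more derivative.\<close>

lemma dy_dx_dx:
  assumes "smooth_on W f" "open W" "z \<in> W"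
  shows "dy (dx (dx f)) z = dx (dx (dy f)) z"
proof -
  have "dy (dx (dx f)) z = dx (dy (dx f)) z"
    by (rule dx_dy_commute[OF smooth_on_dx[OF assms(1,2)] assms(2,3), symmetric])
  also have "\<dots> = dx (dx (dy f)) z"
    by (rule partials_cong[OF dx_dy_commute[symmetric, OF assms(1,2)] assms(2,3)])
      (assumption | intro smooth_on_dx smooth_on_dy assms)+
  finally show ?thesis .
qed

lemma dy_dx_dx_dx:
  assumes "smooth_on W f" "open W" "z \<in> W"
  shows "dy (dx (dx (dx f))) z = dx (dx (dx (dy f))) z"
proof -
  have "dy (dx (dx (dx f))) z = dx (dy (dx (dx f))) z"
    by (rule dx_dy_commute[OF _ assms(2,3), symmetric]) (intro smooth_on_dx assms)
  also have "\<dots> = dx (dx (dx (dy f))) z"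
    by (rule partials_cong[OF dy_dx_dx[OF assms(1,2)] assms(2,3)])
      (assumption | intro smooth_on_dx smooth_on_dy assms)+
  finally show ?thesis .
qed

lemma partials_Da_commute:
  assumes "smooth_on W f" "open W" "z \<in> W"
  shows "dx (Da u f) z = Da u (dx f) z" "dy (Da u f) z = Da u (dy f) z"
  using partials_Da[OF assms] dx_dy_commute[OF assms] by (simp_all add: Da_def)

lemma partials2_Da_commute:
  assumes "smooth_on W f" "open W" "z \<in> W"
  shows "dx (dx (Da u f)) z = Da u (dx (dx f)) z" "dx (dy (Da u f)) z = Da u (dx (dy f)) z"
    "dy (dy (Da u f)) z = Da u (dy (dy f)) z"
proof -
  note sm = smooth_on_dx[OF assms(1,2)] smooth_on_dy[OF assms(1,2)]
  have "dx (dx (Da u f)) z = dx (Da u (dx f)) z"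
    by (rule partials_cong[OF partials_Da_commute(1)[OF assms(1,2)] assms(2,3)])
      (assumption | intro smooth_on_Da sm assms)+
  then show "dx (dx (Da u f)) z = Da u (dx (dx f)) z"
    by (simp add: partials_Da_commute[OF sm(1) assms(2,3)])
  have "dx (dy (Da u f)) z = dx (Da u (dy f)) z" "dy (dy (Da u f)) z = dy (Da u (dy f)) z"
    by (rule partials_cong[OF partials_Da_commute(2)[OF assms(1,2)] assms(2,3)],
        (assumption | intro smooth_on_Da sm assms)+)+
  then show "dx (dy (Da u f)) z = Da u (dx (dy f)) z" "dy (dy (Da u f)) z = Da u (dy (dy f)) z"
    by (simp_all add: partials_Da_commute[OF sm(2) assms(2,3)])
qed

lemma partials3_Da_commute:
  assumes "smooth_on W f" "open W" "z \<in> W"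
  shows "dx (dx (dx (Da u f))) z = Da u (dx (dx (dx f))) z"
    "dx (dx (dy (Da u f))) z = Da u (dx (dx (dy f))) z"
    "dx (dy (dy (Da u f))) z = Da u (dx (dy (dy f))) z"
    "dy (dy (dy (Da u f))) z = Da u (dy (dy (dy f))) z"
proof -
  have sm: "smooth_on W (dx (dx f))" "smooth_on W (dx (dy f))" "smooth_on W (dy (dy f))"
    by (assumption | intro smooth_on_dx smooth_on_dy assms)+
  have "dx (dx (dx (Da u f))) z = dx (Da u (dx (dx f))) z"
    by (rule partials_cong[OF partials2_Da_commute(1)[OF assms(1,2)] assms(2,3)])
      (assumption | intro smooth_on_Da sm assms)+
  then show "dx (dx (dx (Da u f))) z = Da u (dx (dx (dx f))) z"
    by (simp add: partials_Da_commute[OF sm(1) assms(2,3)])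
  have "dx (dx (dy (Da u f))) z = dx (Da u (dx (dy f))) z"
    by (rule partials_cong[OF partials2_Da_commute(2)[OF assms(1,2)] assms(2,3)])
      (assumption | intro smooth_on_Da sm assms)+
  then show "dx (dx (dy (Da u f))) z = Da u (dx (dx (dy f))) z"
    by (simp add: partials_Da_commute[OF sm(2) assms(2,3)])
  have "dx (dy (dy (Da u f))) z = dx (Da u (dy (dy f))) z" "dy (dy (dy (Da u f))) z = dy (Da u (dy (dy f))) z"
    by (rule partials_cong[OF partials2_Da_commute(3)[OF assms(1,2)] assms(2,3)],
        (assumption | intro smooth_on_Da sm assms)+)+
  then show "dx (dy (dy (Da u f))) z = Da u (dx (dy (dy f))) z" "dy (dy (dy (Da u f))) z = Da u (dy (dy (dy f))) z"
    by (simp_all add: partials_Da_commute[OF sm(3) assms(2,3)])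
qed

text \<open>\<open>u\<close> is constant here, so powers of \<open>Da u\<close> expand binomially
  once the partial derivatives commute.\<close>

lemma Da2:
  assumes "smooth_on W f" "open W" "z \<in> W"
  shows "Da u (Da u f) z = u ^ 2 * dx (dx f) z + 2 * u * dx (dy f) z + dy (dy f) z"
  using dx_dy_commute[OF assms]
  by (simp add: Da_def[of u "Da u f"] partials_Da[OF assms] power2_eq_square algebra_simps)

lemma Da3:
  assumes "smooth_on W f" "open W" "z \<in> W"
  shows "Da u (Da u (Da u f)) z = u ^ 3 * dx (dx (dx f)) z + 3 * u ^ 2 * dx (dx (dy f)) z
    + 3 * u * dx (dy (dy f)) z + dy (dy (dy f)) z"
  unfolding Da2[OF smooth_on_Da[OF assms(1,2)] assms(2,3)] partials2_Da_commute[OF assms]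
  using dy_dx_dx[OF assms] dx_dy_commute[OF smooth_on_dy[OF assms(1,2)] assms(2,3)]
  by (simp add: Da_def power2_eq_square power3_eq_cube algebra_simps)

lemma Da4:
  assumes "smooth_on W f" "open W" "z \<in> W"
  shows "Da u (Da u (Da u (Da u f))) z = u ^ 4 * dx (dx (dx (dx f))) z + 4 * u ^ 3 * dx (dx (dx (dy f))) z
    + 6 * u ^ 2 * dx (dx (dy (dy f))) z + 4 * u * dx (dy (dy (dy f))) z + dy (dy (dy (dy f))) z"
  unfolding Da3[OF smooth_on_Da[OF assms(1,2)] assms(2,3)] partials3_Da_commute[OF assms]
  using dy_dx_dx_dx[OF assms] dy_dx_dx[OF smooth_on_dy[OF assms(1,2)] assms(2,3)]
    dx_dy_commute[OF smooth_on_dy[OF smooth_on_dy[OF assms(1,2)] assms(2)] assms(2,3)]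
  by (simp add: Da_def power2_eq_square power3_eq_cube power4_eq_xxxx algebra_simps)

text \<open>By the chain rule the expression is the third derivative of
  \<open>f (p1, p2) - c * p2\<close> along the Y-axis; the fourth-order bound on the odd part makes
  it vanish. The indices 2 and 3 count Y-derivatives of the chart.\<close>

lemma third_derivative_along_Y_axis:
  assumes p: "chart V p1 p2 q" and f: "smooth_on W f" "open W" "q \<in> W"
    and bound: "\<forall>\<^sub>F t in nhds 0. \<bar>(f (p1 (0, t), p2 (0, t)) - c * p2 (0, t))
      - (f (p1 (0, - t), p2 (0, - t)) - c * p2 (0, - t))\<bar> \<le> C * \<bar>t\<bar> ^ 4"
  defines "a \<equiv> dy p1 (0, 0)" and "b \<equiv> dy p2 (0, 0)"
    and "a2 \<equiv> dy (dy p1) (0, 0)" and "b2 \<equiv> dy (dy p2) (0, 0)"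
    and "a3 \<equiv> dy (dy (dy p1)) (0, 0)" and "b3 \<equiv> dy (dy (dy p2)) (0, 0)"
  shows "a ^ 3 * dx (dx (dx f)) q + 3 * a ^ 2 * b * dx (dx (dy f)) q + 3 * a * b ^ 2 * dx (dy (dy f)) q
      + b ^ 3 * dy (dy (dy f)) q + 3 * (dx (dx f) q * a * a2 + dx (dy f) q * (a * b2 + b * a2)
      + dy (dy f) q * b * b2) + dx f q * a3 + dy f q * b3 - c * b3 = 0"
proof -
  note V = chartD[OF p]
  have D: "((\<lambda>t. g (p1 (0, t), p2 (0, t))) has_real_derivative
      dx g (p1 (0, t), p2 (0, t)) * dy p1 (0, t) + dy g (p1 (0, t), p2 (0, t)) * dy p2 (0, t)) (at t)"
    if "smooth_on W g" "(0, t) \<in> V" "(p1 (0, t), p2 (0, t)) \<in> W" for g t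
    by (rule DERIV_compose_pair[OF smooth_on_differentiable[OF that(1) f(2) that(3)]
        chart_DERIV(2)[OF V(3,1) that(2)] chart_DERIV(2)[OF V(4,1) that(2)]])
  note q0 = chart_tendsto(2)[OF p]
  have ev: "\<forall>\<^sub>F t in nhds 0. (0, t) \<in> V \<and> (p1 (0, t), p2 (0, t)) \<in> W"
    using eventually_along_axes(2)[OF V(1,2)] topological_tendstoD[OF q0 f(2,3)]
    by eventually_elim simp
  let ?q = "\<lambda>t. (p1 (0, t), p2 (0, t))"
  let ?A = "\<lambda>t. dy p1 (0, t)" and ?B = "\<lambda>t. dy p2 (0, t)"
  let ?A2 = "\<lambda>t. dy (dy p1) (0, t)" and ?B2 = "\<lambda>t. dy (dy p2) (0, t)"
  note sp = smooth_on_dy[OF V(3,1)] smooth_on_dy[OF V(4,1)]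
  note sp2 = smooth_on_dy[OF sp(1) V(1)] smooth_on_dy[OF sp(2) V(1)]
  note sf = smooth_on_dx[OF f(1,2)] smooth_on_dy[OF f(1,2)]
  have sf2: "smooth_on W (dx (dx f))" "smooth_on W (dx (dy f))" "smooth_on W (dy (dy f))"
    by (assumption | intro smooth_on_dx smooth_on_dy f)+
  let ?N1 = "\<lambda>t. dx f (?q t) * ?A t + dy f (?q t) * ?B t - c * ?B t"
  let ?N2 = "\<lambda>t. dx (dx f) (?q t) * (?A t * ?A t) + 2 * (dx (dy f) (?q t) * (?A t * ?B t))
    + dy (dy f) (?q t) * (?B t * ?B t) + dx f (?q t) * ?A2 t + dy f (?q t) * ?B2 t - c * ?B2 t"
  have 1: "\<forall>\<^sub>F t in nhds 0. ((\<lambda>t. f (?q t) - c * p2 (0, t)) has_real_derivative ?N1 t) (at t)"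
    using ev by eventually_elim (intro DERIV_diff DERIV_cmult D f chart_DERIV(2)[OF V(4,1)]; simp)
  have 2: "\<forall>\<^sub>F t in nhds 0. (?N1 has_real_derivative ?N2 t) (at t)"
    using ev
  proof eventually_elim
    case (elim t)
    note dA = chart_DERIV(2)[OF sp(1) V(1) conjunct1[OF elim]]
    note dB = chart_DERIV(2)[OF sp(2) V(1) conjunct1[OF elim]]
    note dfx = D[OF sf(1) conjunct1[OF elim] conjunct2[OF elim]]
    note dfy = D[OF sf(2) conjunct1[OF elim] conjunct2[OF elim]]
    show ?case
      by (rule DERIV_cong[OF DERIV_diff[OF DERIV_add[OF DERIV_mult[OF dfx dA] DERIV_mult[OF dfy dB]] DERIV_cmult[OF dB]]])
        (use dx_dy_commute[OF f(1,2) conjunct2[OF elim]] in \<open>simp add: algebra_simps\<close>)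
  qed
  have q: "?q 0 \<in> W" using V(5) f(3) by simp
  note dA = chart_DERIV(2)[OF sp(1) V(1,2)] and dB = chart_DERIV(2)[OF sp(2) V(1,2)]
  note dA2 = chart_DERIV(2)[OF sp2(1) V(1,2)] and dB2 = chart_DERIV(2)[OF sp2(2) V(1,2)]
  note dfx = D[OF sf(1) V(2) q] and dfy = D[OF sf(2) V(2) q]
  note dfxx = D[OF sf2(1) V(2) q] and dfxy = D[OF sf2(2) V(2) q] and dfyy = D[OF sf2(3) V(2) q]
  let ?r = "a ^ 3 * dx (dx (dx f)) q + 3 * a ^ 2 * b * dx (dx (dy f)) q + 3 * a * b ^ 2 * dx (dy (dy f)) q
      + b ^ 3 * dy (dy (dy f)) q + 3 * (dx (dx f) q * a * a2 + dx (dy f) q * (a * b2 + b * a2)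
      + dy (dy f) q * b * b2) + dx f q * a3 + dy f q * b3 - c * b3"
  have 3: "(?N2 has_real_derivative ?r) (at 0)"
    by (rule DERIV_cong[OF DERIV_diff[OF DERIV_add[OF DERIV_add[OF DERIV_add[OF DERIV_add[OF
        DERIV_mult[OF dfxx DERIV_mult[OF dA dA]] DERIV_cmult[OF DERIV_mult[OF dfxy DERIV_mult[OF dA dB]]]]
        DERIV_mult[OF dfyy DERIV_mult[OF dB dB]]] DERIV_mult[OF dfx dA2]] DERIV_mult[OF dfy dB2]] DERIV_cmult[OF dB2]]])
      (use dx_dy_commute[OF f] dx_dy_commute[OF sf(2) f(2,3)] dy_dx_dx[OF f] in
        \<open>simp add: V(5) a_def b_def a2_def b2_def a3_def b3_def power2_eq_square power3_eq_cube algebra_simps\<close>)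
  show ?thesis
    by (rule odd_part_third_derivative[OF 1 2 3 bound])
qed

section \<open>Conditions forced by the normal forms B_2, S_2 and A_0S_0|A_1\<close>

lemma norm_triple_components:
  fixes a b c :: real
  shows "\<bar>a\<bar> \<le> norm (a, b, c)" "\<bar>b\<bar> \<le> norm (a, b, c)" "\<bar>c\<bar> \<le> norm (a, b, c)"
  using norm_fst_le[of a "(b, c)"] norm_snd_le[of "(b, c)" a] norm_fst_le[of b c] norm_snd_le[of c b]
  by auto

lemma isCont_proj:
  assumes "smooth_on W f1" "smooth_on W f2" "open W" "q \<in> W"
  shows "isCont (proj f1 f2 d) q"
proof -
  obtain u v w where d: "d = (u, v, w)" by (cases d)
  have "proj f1 f2 d = (\<lambda>z. (fst z - u * snd z, f1 z - v * snd z, f2 z - w * snd z))"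
    by (auto simp: d proj_def)
  then show ?thesis
    using smooth_on_isCont[OF assms(1,3,4)] smooth_on_isCont[OF assms(2,3,4)]
    by (auto intro!: continuous_intros)
qed

text \<open>The comparison is specialised to the mirror points \<open>(X, Y)\<close> and
  \<open>(X, - Y)\<close>, where the even parts of the normal forms cancel. \<open>d \<le> 1\<close>
  lets higher powers of \<open>Y\<close> be absorbed into lower ones.\<close>

lemma projection_chart:
  assumes "smooth_on W f1" "smooth_on W f2" "open W" "q \<in> W"
    and "A_equivalent [(proj f1 f2 (u, v, w), q)] [(g, (0, 0))]"
  shows "\<exists>V p1 p2 L d. chart V p1 p2 q \<and> 0 < d \<and> d \<le> 1 \<and> 0 \<le> L \<and> (\<forall>X Y. \<bar>X\<bar> < d \<longrightarrow> \<bar>Y\<bar> < d \<longrightarrow>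
     \<bar>(p1 (X, Y) - u * p2 (X, Y)) - (p1 (X, - Y) - u * p2 (X, - Y))\<bar> \<le> L * norm (g (X, Y) - g (X, - Y)) \<and>
     (\<forall>(f, c)\<in>{(f1, v), (f2, w)}. \<bar>(f (p1 (X, Y), p2 (X, Y)) - c * p2 (X, Y))
       - (f (p1 (X, - Y), p2 (X, - Y)) - c * p2 (X, - Y))\<bar> \<le> L * norm (g (X, Y) - g (X, - Y))))"
proof -
  obtain V p1 p2 L d where p: "chart V p1 p2 q" "0 < d"
    and b: "\<And>X Y X' Y'. \<bar>X\<bar> < d \<Longrightarrow> \<bar>Y\<bar> < d \<Longrightarrow> \<bar>X'\<bar> < d \<Longrightarrow> \<bar>Y'\<bar> < d \<Longrightarrow>
      norm (proj f1 f2 (u, v, w) (p1 (X, Y), p2 (X, Y)) - proj f1 f2 (u, v, w) (p1 (X', Y'), p2 (X', Y')))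
        \<le> L * norm (g (X, Y) - g (X', Y'))"
    using A_equivalent_single[OF assms(5) isCont_proj[OF assms(1-4)]] by blast
  have "\<bar>(p1 (X, Y) - u * p2 (X, Y)) - (p1 (X, - Y) - u * p2 (X, - Y))\<bar> \<le> \<bar>L\<bar> * norm (g (X, Y) - g (X, - Y)) \<and>
     (\<forall>(f, c)\<in>{(f1, v), (f2, w)}. \<bar>(f (p1 (X, Y), p2 (X, Y)) - c * p2 (X, Y))
       - (f (p1 (X, - Y), p2 (X, - Y)) - c * p2 (X, - Y))\<bar> \<le> \<bar>L\<bar> * norm (g (X, Y) - g (X, - Y)))"
    if "\<bar>X\<bar> < min d 1" "\<bar>Y\<bar> < min d 1" for X Y
  proof -
    let ?n = "norm (proj f1 f2 (u, v, w) (p1 (X, Y), p2 (X, Y)) - proj f1 f2 (u, v, w) (p1 (X, - Y), p2 (X, - Y)))"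
    have "?n \<le> L * norm (g (X, Y) - g (X, - Y))"
      using b[of X Y X "- Y"] that by simp
    also have "\<dots> \<le> \<bar>L\<bar> * norm (g (X, Y) - g (X, - Y))"
      by (intro mult_right_mono) auto
    finally have n: "?n \<le> \<bar>L\<bar> * norm (g (X, Y) - g (X, - Y))" .
    have "?n = norm ((p1 (X, Y) - u * p2 (X, Y)) - (p1 (X, - Y) - u * p2 (X, - Y)),
        (f1 (p1 (X, Y), p2 (X, Y)) - v * p2 (X, Y)) - (f1 (p1 (X, - Y), p2 (X, - Y)) - v * p2 (X, - Y)),
        (f2 (p1 (X, Y), p2 (X, Y)) - w * p2 (X, Y)) - (f2 (p1 (X, - Y), p2 (X, - Y)) - w * p2 (X, - Y)))"
      by (simp add: proj_def)
    from norm_triple_components[THEN order_trans, OF eq_refl[OF this[symmetric], THEN order_trans, OF n]]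
    show ?thesis by blast
  qed
  then show ?thesis
    using p by (intro exI[of _ V] exI[of _ p1] exI[of _ p2] exI[of _ "\<bar>L\<bar>"] exI[of _ "min d 1"]) auto
qed

lemma contact_order2:
  assumes p: "chart V p1 p2 q" and f: "smooth_on W f" "open W" "q \<in> W"
    and C: "\<exists>C. \<forall>\<^sub>F X in nhds 0. \<bar>Da u f (p1 (X, 0), p2 (X, 0)) - c\<bar> \<le> C * X ^ 2"
  shows "Da u f q = c" "dx (Da u f) q * dx p1 (0, 0) + dy (Da u f) q * dx p2 (0, 0) = 0"
proof -
  have q: "(p1 (0, 0), p2 (0, 0)) = q" using p unfolding chart_def by auto
  obtain C where C: "\<forall>\<^sub>F X in nhds 0. \<bar>Da u f (p1 (X, 0), p2 (X, 0)) - c\<bar> \<le> C * \<bar>X\<bar> ^ 2"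
    using C by auto
  have "((\<lambda>X. Da u f (p1 (X, 0), p2 (X, 0)) - c) has_real_derivative
      dx (Da u f) q * dx p1 (0, 0) + dy (Da u f) q * dx p2 (0, 0)) (at 0)"
    using DERIV_diff[OF eventually_nhds_x_imp_x[OF DERIV_along_X_axis(1)[OF p smooth_on_Da[OF f(1,2)] f(2,3)]]
      DERIV_const[of c]] q by simp
  from vanishing_order2[OF this C] q
  show "Da u f q = c" "dx (Da u f) q * dx p1 (0, 0) + dy (Da u f) q * dx p2 (0, 0) = 0" by simp_all
qed

lemma contact_order3:
  assumes p: "chart V p1 p2 q" and f: "smooth_on W f" "open W" "q \<in> W"
    and C: "\<exists>C. \<forall>\<^sub>F X in nhds 0. \<bar>Da u f (p1 (X, 0), p2 (X, 0)) - c\<bar> \<le> C * \<bar>X\<bar> ^ 3"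
  shows "dx (Da u f) q * dx p1 (0, 0) + dy (Da u f) q * dx p2 (0, 0) = 0"
    "dx (dx (Da u f)) q * dx p1 (0, 0) ^ 2 + 2 * dx (dy (Da u f)) q * dx p1 (0, 0) * dx p2 (0, 0)
      + dy (dy (Da u f)) q * dx p2 (0, 0) ^ 2
      + dx (Da u f) q * dx (dx p1) (0, 0) + dy (Da u f) q * dx (dx p2) (0, 0) = 0"
proof -
  have q: "(p1 (0, 0), p2 (0, 0)) = q" using p unfolding chart_def by auto
  obtain C where C: "\<forall>\<^sub>F X in nhds 0. \<bar>Da u f (p1 (X, 0), p2 (X, 0)) - c\<bar> \<le> C * \<bar>X\<bar> ^ 3"
    using C by auto
  note D = DERIV_along_X_axis[OF p smooth_on_Da[OF f(1,2)] f(2,3)]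
  have "\<forall>\<^sub>F X in nhds 0. ((\<lambda>X. Da u f (p1 (X, 0), p2 (X, 0)) - c) has_real_derivative
      dx (Da u f) (p1 (X, 0), p2 (X, 0)) * dx p1 (X, 0) + dy (Da u f) (p1 (X, 0), p2 (X, 0)) * dx p2 (X, 0)) (at X)"
    using D(1)[of u] by eventually_elim (auto intro!: derivative_eq_intros)
  from vanishing_order3[OF this D(2) C] q
  show "dx (Da u f) q * dx p1 (0, 0) + dy (Da u f) q * dx p2 (0, 0) = 0"
    "dx (dx (Da u f)) q * dx p1 (0, 0) ^ 2 + 2 * dx (dy (Da u f)) q * dx p1 (0, 0) * dx p2 (0, 0)
      + dy (dy (Da u f)) q * dx p2 (0, 0) ^ 2
      + dx (Da u f) q * dx (dx p1) (0, 0) + dy (Da u f) q * dx (dx p2) (0, 0) = 0"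
    by simp_all
qed

text \<open>The odd part of the normal form is \<open>Y * (X^2 + s * Y^4)\<close>. Its factor
  \<open>X^2\<close> gives second-order contact along the X-axis, whose velocity
  \<open>(b1, b2)\<close> in the chart is therefore annihilated by the gradients of both
  \<open>Da u f\<close>. On the Y-axis the odd part has order 5, which yields the third-order
  condition.\<close>

lemma B2_conditions:
  assumes f: "smooth_on W f1" "smooth_on W f2" "open W" "q \<in> W"
    and equiv: "A_equivalent [(proj f1 f2 (u, v, w), q)] [(g, (0, 0))]" and g: "g \<in> nf_B2"
  shows "\<exists>b1 b2 e1 e2. (b1, b2) \<noteq> (0, 0) \<and> (\<forall>f\<in>{f1, f2}.
    dx (Da u f) q * b1 + dy (Da u f) q * b2 = 0 \<and>
    Da u (Da u (Da u f)) q + dx (Da u f) q * e1 + dy (Da u f) q * e2 = 0)"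
proof -
  obtain s where s: "g = (\<lambda>(x, y). (x, y ^ 2, x ^ 2 * y + s * y ^ 5))" "s \<in> {1, -1}"
    using g unfolding nf_B2_def by auto
  have g5: "norm (g (X, Y) - g (X, - Y)) \<le> 2 * (X ^ 2 * \<bar>Y\<bar> + \<bar>Y\<bar> ^ 5)" for X Y :: real
  proof -
    have "g (X, Y) - g (X, - Y) = (0, 0, 2 * (X ^ 2 * Y + s * Y ^ 5))"
      by (simp add: s(1) algebra_simps)
    moreover have "\<bar>X ^ 2 * Y + s * Y ^ 5\<bar> \<le> X ^ 2 * \<bar>Y\<bar> + \<bar>Y\<bar> ^ 5"
      using abs_triangle_ineq[of "X ^ 2 * Y" "s * Y ^ 5"] s(2) by (auto simp: abs_mult power_abs)
    ultimately show ?thesis by (simp add: norm_Pair abs_mult)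
  qed
  obtain V p1 p2 L d where p: "chart V p1 p2 q" "0 < d" "d \<le> 1" "0 \<le> L"
    and l: "\<And>X Y. \<bar>X\<bar> < d \<Longrightarrow> \<bar>Y\<bar> < d \<Longrightarrow>
      \<bar>(p1 (X, Y) - u * p2 (X, Y)) - (p1 (X, - Y) - u * p2 (X, - Y))\<bar> \<le> L * norm (g (X, Y) - g (X, - Y))"
    and m: "\<And>X Y f c. \<bar>X\<bar> < d \<Longrightarrow> \<bar>Y\<bar> < d \<Longrightarrow> (f, c) \<in> {(f1, v), (f2, w)} \<Longrightarrow>
      \<bar>(f (p1 (X, Y), p2 (X, Y)) - c * p2 (X, Y)) - (f (p1 (X, - Y), p2 (X, - Y)) - c * p2 (X, - Y))\<bar>
        \<le> L * norm (g (X, Y) - g (X, - Y))"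
    using projection_chart[OF f equiv] by blast
  have q: "(p1 (0, 0), p2 (0, 0)) = q" "dx p1 (0, 0) * dy p2 (0, 0) - dy p1 (0, 0) * dx p2 (0, 0) \<noteq> 0"
    using p(1) unfolding chart_def by auto
  have K: "L * norm (g (X, Y) - g (X, - Y)) \<le> (2 * L) * (X ^ 2 * \<bar>Y\<bar> + \<bar>Y\<bar> ^ 3)" if "\<bar>Y\<bar> < d" for X Y
  proof -
    have "\<bar>Y\<bar> ^ 5 \<le> \<bar>Y\<bar> ^ 3" using that p(3) by (intro power_decreasing) auto
    then have "norm (g (X, Y) - g (X, - Y)) \<le> 2 * (X ^ 2 * \<bar>Y\<bar> + \<bar>Y\<bar> ^ 3)"
      using g5[of X Y] by simp
    from mult_left_mono[OF this p(4)] show ?thesis by (simp add: mult.assoc mult.left_commute)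
  qed
  have K4: "L * norm (g (0, t) - g (0, - t)) \<le> (2 * L) * \<bar>t\<bar> ^ 4" if "\<bar>t\<bar> < d" for t
  proof -
    have "\<bar>t\<bar> ^ 5 \<le> \<bar>t\<bar> ^ 4" using that p(3) by (intro power_decreasing) auto
    then have "norm (g (0, t) - g (0, - t)) \<le> 2 * \<bar>t\<bar> ^ 4"
      using g5[of 0 t] by simp
    from mult_left_mono[OF this p(4)] show ?thesis by (simp add: mult.assoc mult.left_commute)
  qed
  have sm: "smooth_on W h" if "(h, c) \<in> {(f1, v), (f2, w)}" for h c using that f by auto
  have contact: "dy p1 (0, 0) = u * dy p2 (0, 0)" "dy p2 (0, 0) \<noteq> 0"
      "\<exists>C. \<forall>\<^sub>F X in nhds 0. \<bar>Da u h (p1 (X, 0), p2 (X, 0)) - c\<bar> \<le> C * X ^ 2"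
    if hc: "(h, c) \<in> {(f1, v), (f2, w)}" for h c
    using contact_along_axis[OF p(1) sm[OF hc] f(3,4) p(2), of "\<lambda>X. X ^ 2" u "2 * L" c,
        OF _ order_trans[OF l K] order_trans[OF m[OF _ _ hc] K]] by simp_all
  have ev: "\<forall>\<^sub>F t::real in nhds 0. \<bar>t\<bar> < d"
    using p(2) eventually_abs_less by blast
  define a2 b2 b3 where "a2 = dy (dy p1) (0, 0)" and "b2 = dy (dy p2) (0, 0)"
    and "b3 = dy (dy (dy p2)) (0, 0)"
  define b where "b = dy p2 (0, 0)"
  have b: "b \<noteq> 0" "dy p1 (0, 0) = u * b" using contact(1,2)[of f1 v] by (simp_all add: b_def)
  \<comment> \<open>The third-order condition for the component \<open>x - u * y\<close>, that is
    \<open>f = fst\<close> and \<open>c = u\<close>; all second and third partial derivatives of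
    \<open>fst\<close> vanish.\<close>
  have a3: "dy (dy (dy p1)) (0, 0) = u * b3"
  proof -
    have fst_deriv: "(fst has_derivative (\<lambda>h. 1 * fst h + 0 * snd h)) (at z)" for z :: R2
      by (auto intro!: derivative_eq_intros)
    have "dx fst = (\<lambda>z. 1)" "dy fst = (\<lambda>z. 0)"
      by (rule ext, use partials_of_has_derivative[OF fst_deriv] in simp)+
    note fst_partials = this
    have const: "dx (\<lambda>z. k) = (\<lambda>z. 0)" "dy (\<lambda>z. k) = (\<lambda>z. 0)" for k
      by (auto simp: dx_def dy_def)
    note * = third_derivative_along_Y_axis[OF p(1) smooth_on_fst open_UNIV UNIV_I, where c = u and C = "2 * L"]
    have "\<forall>\<^sub>F t in nhds 0. \<bar>(fst (p1 (0, t), p2 (0, t)) - u * p2 (0, t))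
      - (fst (p1 (0, - t), p2 (0, - t)) - u * p2 (0, - t))\<bar> \<le> 2 * L * \<bar>t\<bar> ^ 4"
      using ev by eventually_elim (use l[of 0] K4 p(2) order_trans in fastforce)
    from *[OF this] show ?thesis
      by (simp add: fst_partials const b3_def)
  qed
  have third: "Da u (Da u (Da u h)) q + dx (Da u h) q * (3 * a2 / b ^ 2) + dy (Da u h) q * (3 * b2 / b ^ 2) = 0"
    if hc: "(h, c) \<in> {(f1, v), (f2, w)}" for h c
  proof -
    note h = sm[OF hc] f(3,4)
    have "\<forall>\<^sub>F t in nhds 0. \<bar>(h (p1 (0, t), p2 (0, t)) - c * p2 (0, t))
      - (h (p1 (0, - t), p2 (0, - t)) - c * p2 (0, - t))\<bar> \<le> (2 * L) * \<bar>t\<bar> ^ 4"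
      using ev by eventually_elim (use m[OF _ _ hc, of 0] K4 p(2) order_trans in fastforce)
    note third_derivative_along_Y_axis[OF p(1) h this]
    \<comment> \<open>With \<open>a3\<close> this cancels the terms with third derivatives of the
      chart: \<open>dx h q * (u * b3) + dy h q * b3 = c * b3\<close>.\<close>
    moreover have "dy h q = c - u * dx h q"
      using contact_order2(1)[OF p(1) h contact(3)[OF hc]] by (simp add: Da_def)
    \<comment> \<open>Since \<open>dy p1 = u * b\<close>, the cubic terms assemble to
      \<open>b ^ 3\<close> times the third power of \<open>Da u\<close>. Division by
      \<open>b ^ 3\<close> leaves the coefficients \<open>3 * a2 / b ^ 2\<close> and
      \<open>3 * b2 / b ^ 2\<close>.\<close>
    ultimately have "b ^ 3 * Da u (Da u (Da u h)) q + 3 * b * (dx (Da u h) q * a2 + dy (Da u h) q * b2) = 0"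
      unfolding Da3[OF h] partials_Da[OF h] a3 b(2) a2_def[symmetric] b2_def[symmetric] b_def[symmetric] b3_def[symmetric]
      by (simp add: algebra_simps power2_eq_square power3_eq_cube)
    then have "b ^ 3 * (Da u (Da u (Da u h)) q + dx (Da u h) q * (3 * a2 / b ^ 2)
        + dy (Da u h) q * (3 * b2 / b ^ 2)) = 0"
      using b(1) by (simp add: distrib_left power2_eq_square power3_eq_cube mult.assoc mult.left_commute)
    then show ?thesis using b(1) by simp
  qed
  have first: "dx (Da u h) q * dx p1 (0, 0) + dy (Da u h) q * dx p2 (0, 0) = 0"
    if hc: "(h, c) \<in> {(f1, v), (f2, w)}" for h c
    by (rule contact_order2(2)[OF p(1) sm[OF hc] f(3,4) contact(3)[OF hc]])
  have "(dx p1 (0, 0), dx p2 (0, 0)) \<noteq> (0, 0)" using q(2) by auto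
  with first[of f1 v] first[of f2 w] third[of f1 v] third[of f2 w] show ?thesis
    by (intro exI[of _ "dx p1 (0, 0)"] exI[of _ "dx p2 (0, 0)"] exI[of _ "3 * a2 / b ^ 2"]
        exI[of _ "3 * b2 / b ^ 2"]) simp
qed

text \<open>The odd part \<open>Y^3 + s * X^3 * Y\<close> gives contact of order three: the image of
  the X-axis is a curve along which both \<open>Da u f\<close> are constant to second order. Its
  velocity is \<open>(b1, b2)\<close> and its acceleration \<open>(e1, e2)\<close>.\<close>

lemma S2_conditions:
  assumes f: "smooth_on W f1" "smooth_on W f2" "open W" "q \<in> W"
    and equiv: "A_equivalent [(proj f1 f2 (u, v, w), q)] [(g, (0, 0))]" and g: "g \<in> nf_S2"
  shows "\<exists>b1 b2 e1 e2. (b1, b2) \<noteq> (0, 0) \<and> (\<forall>f\<in>{f1, f2}.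
    dx (Da u f) q * b1 + dy (Da u f) q * b2 = 0 \<and>
    dx (dx (Da u f)) q * b1 ^ 2 + 2 * dx (dy (Da u f)) q * b1 * b2 + dy (dy (Da u f)) q * b2 ^ 2
      + dx (Da u f) q * e1 + dy (Da u f) q * e2 = 0)"
proof -
  obtain s where s: "g = (\<lambda>(x, y). (x, y ^ 2, y ^ 3 + s * (x ^ 3 * y)))" "s \<in> {1, -1}"
    using g unfolding nf_S2_def by auto
  have g3: "norm (g (X, Y) - g (X, - Y)) \<le> 2 * (\<bar>X\<bar> ^ 3 * \<bar>Y\<bar> + \<bar>Y\<bar> ^ 3)" for X Y :: real
  proof -
    have "g (X, Y) - g (X, - Y) = (0, 0, 2 * (Y ^ 3 + s * (X ^ 3 * Y)))"
      by (simp add: s(1) algebra_simps)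
    moreover have "\<bar>Y ^ 3 + s * (X ^ 3 * Y)\<bar> \<le> \<bar>X\<bar> ^ 3 * \<bar>Y\<bar> + \<bar>Y\<bar> ^ 3"
      using abs_triangle_ineq[of "Y ^ 3" "s * (X ^ 3 * Y)"] s(2) by (auto simp: abs_mult power_abs)
    ultimately show ?thesis by (simp add: norm_Pair abs_mult)
  qed
  obtain V p1 p2 L d where p: "chart V p1 p2 q" "0 < d" "d \<le> 1" "0 \<le> L"
    and l: "\<And>X Y. \<bar>X\<bar> < d \<Longrightarrow> \<bar>Y\<bar> < d \<Longrightarrow>
      \<bar>(p1 (X, Y) - u * p2 (X, Y)) - (p1 (X, - Y) - u * p2 (X, - Y))\<bar> \<le> L * norm (g (X, Y) - g (X, - Y))"
    and m: "\<And>X Y f c. \<bar>X\<bar> < d \<Longrightarrow> \<bar>Y\<bar> < d \<Longrightarrow> (f, c) \<in> {(f1, v), (f2, w)} \<Longrightarrow>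
      \<bar>(f (p1 (X, Y), p2 (X, Y)) - c * p2 (X, Y)) - (f (p1 (X, - Y), p2 (X, - Y)) - c * p2 (X, - Y))\<bar>
        \<le> L * norm (g (X, Y) - g (X, - Y))"
    using projection_chart[OF f equiv] by blast
  have q: "dx p1 (0, 0) * dy p2 (0, 0) - dy p1 (0, 0) * dx p2 (0, 0) \<noteq> 0"
    using p(1) unfolding chart_def by auto
  have K: "L * norm (g (X, Y) - g (X, - Y)) \<le> (2 * L) * (\<bar>X\<bar> ^ 3 * \<bar>Y\<bar> + \<bar>Y\<bar> ^ 3)" for X Y
    using mult_left_mono[OF g3 p(4)] by (simp add: mult.assoc mult.left_commute)
  have sm: "smooth_on W h" if "(h, c) \<in> {(f1, v), (f2, w)}" for h c using that f by auto
  have contact: "\<exists>C. \<forall>\<^sub>F X in nhds 0. \<bar>Da u h (p1 (X, 0), p2 (X, 0)) - c\<bar> \<le> C * \<bar>X\<bar> ^ 3"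
    if hc: "(h, c) \<in> {(f1, v), (f2, w)}" for h c
    using contact_along_axis(3)[OF p(1) sm[OF hc] f(3,4) p(2), of "\<lambda>X. \<bar>X\<bar> ^ 3" u "2 * L" c,
        OF _ order_trans[OF l K] order_trans[OF m[OF _ _ hc] K]] by simp
  note * = contact_order3[OF p(1) f(1,3,4) contact[of f1 v, OF insertI1]]
    contact_order3[OF p(1) f(2-4) contact[of f2 w, OF insertI2[OF insertI1]]]
  have "(dx p1 (0, 0), dx p2 (0, 0)) \<noteq> (0, 0)" using q by auto
  with * show ?thesis
    by (intro exI[of _ "dx p1 (0, 0)"] exI[of _ "dx p2 (0, 0)"] exI[of _ "dx (dx p1) (0, 0)"]
        exI[of _ "dx (dx p2) (0, 0)"]) simp
qed

text \<open>The projection identifies both points, so they differ by \<open>\<tau>\<close> times the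
  kernel direction \<open>(u, 1)\<close>. The relation with \<open>\<rho>\<close> says that the
  image line of the differential at the cross-cap point \<open>q\<close> lies in the tangent plane
  of the other sheet; it holds because \<open>g (X, 0)\<close> and \<open>(X, 0, 0)\<close> agree up
  to order \<open>X^2\<close>.\<close>

lemma A0S0_A1_conditions:
  assumes f: "smooth_on W f1" "smooth_on W f2" "open W" "q \<in> W" "q' \<in> W" "q' \<noteq> q"
    and equiv: "A_equivalent [(proj f1 f2 (u, v, w), q'), (proj f1 f2 (u, v, w), q)]
      [(\<lambda>(x, y). (x, y, 0), (0, 0)), (g, (0, 0))]" and g: "g \<in> nf_A0S0_A1"
  shows "\<exists>\<tau> \<rho>. \<tau> \<noteq> 0 \<and> q' = (fst q + \<tau> * u, snd q + \<tau>) \<and> (\<forall>f\<in>{f1, f2}.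
    f q' - f q = \<tau> * Da u f q \<and> dx f q' - dx f q = \<rho> * (Da u f q' - Da u f q))"
proof -
  obtain s where s: "g = (\<lambda>(x, y). (x, x * y, y ^ 2 + s * x ^ 2))" "s \<in> {1, -1}"
    using g unfolding nf_A0S0_A1_def by auto
  let ?P = "proj f1 f2 (u, v, w)"
  obtain V p1 p2 V' p1' p2' L d where p: "chart V p1 p2 q" "chart V' p1' p2' q'" "0 < d"
    and b: "\<And>X Y X' Y'. \<bar>X\<bar> < d \<Longrightarrow> \<bar>Y\<bar> < d \<Longrightarrow> \<bar>X'\<bar> < d \<Longrightarrow> \<bar>Y'\<bar> < d \<Longrightarrow>
      norm (?P (p1 (X, Y), p2 (X, Y)) - ?P (p1' (X', Y'), p2' (X', Y'))) \<le> L * norm (g (X, Y) - (X', Y', 0))"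
    and b': "\<And>X Y X' Y'. \<bar>X\<bar> < d \<Longrightarrow> \<bar>Y\<bar> < d \<Longrightarrow> \<bar>X'\<bar> < d \<Longrightarrow> \<bar>Y'\<bar> < d \<Longrightarrow>
      norm (?P (p1 (X, Y), p2 (X, Y)) - ?P (p1 (X', Y'), p2 (X', Y'))) \<le> L * norm (g (X, Y) - g (X', Y'))"
    and Pq: "?P q' = ?P q"
    using A_equivalent_pair[OF equiv isCont_proj[OF f(1-4)] isCont_proj[OF f(1-3,5)]]
    unfolding prod.case by blast
  note V = chartD[OF p(1)]
  note V' = chartD[OF p(2)]
  have sm: "smooth_on W h" if "(h, c) \<in> {(f1, v), (f2, w)}" for h c using that f by auto
  have proj_components: "\<bar>(fst z - u * snd z) - (fst z' - u * snd z')\<bar> \<le> norm (?P z - ?P z')"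
    "\<And>h c. (h, c) \<in> {(f1, v), (f2, w)} \<Longrightarrow>
      \<bar>(h z - c * snd z) - (h z' - c * snd z')\<bar> \<le> norm (?P z - ?P z')" for z z'
  proof -
    have "?P z - ?P z' = ((fst z - u * snd z) - (fst z' - u * snd z'),
        (f1 z - v * snd z) - (f1 z' - v * snd z'), (f2 z - w * snd z) - (f2 z' - w * snd z'))"
      by (cases z; cases z') (simp add: proj_def)
    note * = norm_triple_components[where a = "(fst z - u * snd z) - (fst z' - u * snd z')"
      and b = "(f1 z - v * snd z) - (f1 z' - v * snd z')" and c = "(f2 z - w * snd z) - (f2 z' - w * snd z')", folded this]
    show "\<bar>(fst z - u * snd z) - (fst z' - u * snd z')\<bar> \<le> norm (?P z - ?P z')" by (rule *)
    show "\<And>h c. (h, c) \<in> {(f1, v), (f2, w)} \<Longrightarrow>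
      \<bar>(h z - c * snd z) - (h z' - c * snd z')\<bar> \<le> norm (?P z - ?P z')" using *(2,3) by auto
  qed
  have even: "norm (?P (p1 (X, Y), p2 (X, Y)) - ?P (p1 (X, - Y), p2 (X, - Y)))
      \<le> (2 * \<bar>L\<bar>) * (\<bar>X\<bar> * \<bar>Y\<bar> + \<bar>Y\<bar> ^ 3)" if "\<bar>X\<bar> < d" "\<bar>Y\<bar> < d" for X Y
  proof -
    have "norm (g (X, Y) - g (X, - Y)) = 2 * (\<bar>X\<bar> * \<bar>Y\<bar>)"
      by (simp add: s(1) norm_Pair abs_mult real_sqrt_mult)
    then have "norm (?P (p1 (X, Y), p2 (X, Y)) - ?P (p1 (X, - Y), p2 (X, - Y))) \<le> L * (2 * (\<bar>X\<bar> * \<bar>Y\<bar>))"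
      using b'[of X Y X "- Y"] that by simp
    also have "\<dots> \<le> \<bar>L\<bar> * (2 * (\<bar>X\<bar> * \<bar>Y\<bar> + \<bar>Y\<bar> ^ 3))"
      by (intro mult_mono) auto
    finally show ?thesis by (simp add: mult.assoc mult.left_commute)
  qed
  \<comment> \<open>The odd part is \<open>X * Y\<close> here, so only the value at
    \<open>X = 0\<close> is controlled: \<open>q\<close> is singular for the projection.\<close>
  have contact: "dy p1 (0, 0) = u * dy p2 (0, 0)" "dy p2 (0, 0) \<noteq> 0" "Da u h q = c"
    if hc: "(h, c) \<in> {(f1, v), (f2, w)}" for h c
  proof -
    note * = contact_along_axis[OF p(1) sm[OF hc] f(3,4) p(3), of "\<lambda>X. \<bar>X\<bar>" u "2 * \<bar>L\<bar>" c,
        OF _ order_trans[OF proj_components(1)[of "(p1 (_, _), p2 (_, _))" "(p1 (_, _), p2 (_, _))",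
          unfolded fst_conv snd_conv] even]
        order_trans[OF proj_components(2)[OF hc, of "(p1 (_, _), p2 (_, _))" "(p1 (_, _), p2 (_, _))",
          unfolded fst_conv snd_conv] even]]
    from *(1,2) show "dy p1 (0, 0) = u * dy p2 (0, 0)" "dy p2 (0, 0) \<noteq> 0" by simp_all
    obtain C where "\<forall>\<^sub>F X in nhds 0. \<bar>Da u h (p1 (X, 0), p2 (X, 0)) - c\<bar> \<le> C * \<bar>X\<bar>"
      using *(3) by auto
    from eventually_nhds_x_imp_x[OF this] show "Da u h q = c" using V(5) by simp
  qed
  have ev: "\<forall>\<^sub>F t::real in nhds 0. \<bar>t\<bar> < d"
    using p(3) eventually_abs_less by blast
  have tangent: "norm (?P (p1 (X, 0), p2 (X, 0)) - ?P (p1' (X, 0), p2' (X, 0))) \<le> L * \<bar>X\<bar> ^ 2"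
    if "\<bar>X\<bar> < d" for X
  proof -
    have "norm (g (X, 0) - (X, 0, 0)) = \<bar>X\<bar> ^ 2"
      using s(2) by (auto simp: s(1) norm_Pair abs_mult)
    then show ?thesis using b[of X 0 X 0] that p(3) by simp
  qed
  note D = chart_DERIV(1)[OF V(3,1,2)] chart_DERIV(1)[OF V(4,1,2)]
    chart_DERIV(1)[OF V'(3,1,2)] chart_DERIV(1)[OF V'(4,1,2)]
  have l: "(dx p1 (0, 0) - u * dx p2 (0, 0)) - (dx p1' (0, 0) - u * dx p2' (0, 0)) = 0"
  proof (rule vanishing_order2(2))
    show "((\<lambda>X. (p1 (X, 0) - u * p2 (X, 0)) - (p1' (X, 0) - u * p2' (X, 0))) has_real_derivative
        (dx p1 (0, 0) - u * dx p2 (0, 0)) - (dx p1' (0, 0) - u * dx p2' (0, 0))) (at 0)"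
      by (intro DERIV_diff DERIV_cmult D)
    show "\<forall>\<^sub>F X in nhds 0. \<bar>(p1 (X, 0) - u * p2 (X, 0)) - (p1' (X, 0) - u * p2' (X, 0))\<bar> \<le> L * \<bar>X\<bar> ^ 2"
      using ev
    proof eventually_elim
      case (elim X)
      show ?case using order_trans[OF proj_components(1) tangent[OF elim]] by simp
    qed
  qed
  let ?s = "dx p1 (0, 0) - u * dx p2 (0, 0)"
  \<comment> \<open>Because \<open>dy p1 = u * dy p2\<close> at the origin, this product is the
    Jacobian of the chart.\<close>
  have "?s * dy p2 (0, 0) \<noteq> 0"
    using V(6) contact(1)[of f1 v] by (simp add: algebra_simps)
  then have s0: "?s \<noteq> 0" by auto
  have m: "dx h q' - dx h q = (- dx p2' (0, 0) / ?s) * (Da u h q' - Da u h q)"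
    if hc: "(h, c) \<in> {(f1, v), (f2, w)}" for h c
  proof -
    have "(dx h q * dx p1 (0, 0) + dy h q * dx p2 (0, 0) - c * dx p2 (0, 0))
        - (dx h q' * dx p1' (0, 0) + dy h q' * dx p2' (0, 0) - c * dx p2' (0, 0)) = 0"
    proof (rule vanishing_order2(2))
      have qW: "(p1 (0, 0), p2 (0, 0)) \<in> W" "(p1' (0, 0), p2' (0, 0)) \<in> W"
        using V(5) V'(5) f(4,5) by simp_all
      show "((\<lambda>X. (h (p1 (X, 0), p2 (X, 0)) - c * p2 (X, 0)) - (h (p1' (X, 0), p2' (X, 0)) - c * p2' (X, 0)))
        has_real_derivative
        (dx h q * dx p1 (0, 0) + dy h q * dx p2 (0, 0) - c * dx p2 (0, 0))
        - (dx h q' * dx p1' (0, 0) + dy h q' * dx p2' (0, 0) - c * dx p2' (0, 0))) (at 0)"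
        using DERIV_diff[OF DERIV_diff[OF DERIV_compose_pair[OF smooth_on_differentiable[OF sm[OF hc] f(3) qW(1)]
            D(1,2)] DERIV_cmult[OF D(2), of c]]
          DERIV_diff[OF DERIV_compose_pair[OF smooth_on_differentiable[OF sm[OF hc] f(3) qW(2)]
            D(3,4)] DERIV_cmult[OF D(4), of c]]] V(5) V'(5) by simp
      show "\<forall>\<^sub>F X in nhds 0. \<bar>(h (p1 (X, 0), p2 (X, 0)) - c * p2 (X, 0))
          - (h (p1' (X, 0), p2' (X, 0)) - c * p2' (X, 0))\<bar> \<le> L * \<bar>X\<bar> ^ 2"
        using ev
      proof eventually_elim
        case (elim X)
        show ?case using order_trans[OF proj_components(2)[OF hc] tangent[OF elim]] by simp
      qed
    qed
    moreover have "dy h q = c - u * dx h q" "dy h q' = Da u h q' - u * dx h q'"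
      using contact(3)[OF hc] by (simp_all add: Da_def)
    ultimately have "dx h q * ?s = dx h q' * (dx p1' (0, 0) - u * dx p2' (0, 0)) + (Da u h q' - c) * dx p2' (0, 0)"
      by (simp add: algebra_simps)
    then have "(dx h q' - dx h q) * ?s = - dx p2' (0, 0) * (Da u h q' - Da u h q)"
      using l contact(3)[OF hc] by algebra
    then have "dx h q' - dx h q = - dx p2' (0, 0) * (Da u h q' - Da u h q) / ?s"
      using s0 nonzero_eq_divide_eq by blast
    then show ?thesis by simp
  qed
  define \<tau> where "\<tau> = snd q' - snd q"
  have q': "fst q' - u * snd q' = fst q - u * snd q"
    using proj_components(1)[of q' q] Pq by simp
  have "h q' - h q = \<tau> * Da u h q" if hc: "(h, c) \<in> {(f1, v), (f2, w)}" for h c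
    using proj_components(2)[OF hc, of q' q] Pq contact(3)[OF hc] by (simp add: \<tau>_def algebra_simps)
  with m have "\<forall>f\<in>{f1, f2}. f q' - f q = \<tau> * Da u f q \<and>
      dx f q' - dx f q = (- dx p2' (0, 0) / ?s) * (Da u f q' - Da u f q)"
    by auto
  moreover have "q' = (fst q + \<tau> * u, snd q + \<tau>)"
    using q' by (simp add: \<tau>_def prod_eq_iff algebra_simps)
  moreover have "\<tau> \<noteq> 0" using calculation(2) f(6) by auto
  ultimately show ?thesis by blast
qed

section \<open>Slopes of the tangent lines\<close>

text \<open>A nonzero common kernel vector makes the gradients of \<open>Da u f1\<close> and
  \<open>Da u f2\<close> parallel, and then the unknown \<open>e1\<close>, \<open>e2\<close> cancel
  from the combination of the third-order conditions.\<close>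

lemma B2_equations:
  assumes "smooth_on W f1" "smooth_on W f2" "open W" "q \<in> W"
    and "A_equivalent [(proj f1 f2 (u, v, w), q)] [(g, (0, 0))]" "g \<in> nf_B2"
  shows "dx (Da u f1) q * dy (Da u f2) q = dx (Da u f2) q * dy (Da u f1) q"
    "dx (Da u f1) q * Da u (Da u (Da u f2)) q = dx (Da u f2) q * Da u (Da u (Da u f1)) q"
proof -
  obtain b1 b2 e1 e2 where b: "b1 \<noteq> 0 \<or> b2 \<noteq> 0" and
    1: "dx (Da u f1) q * b1 + dy (Da u f1) q * b2 = 0" "dx (Da u f2) q * b1 + dy (Da u f2) q * b2 = 0" and
    2: "Da u (Da u (Da u f1)) q + dx (Da u f1) q * e1 + dy (Da u f1) q * e2 = 0"
      "Da u (Da u (Da u f2)) q + dx (Da u f2) q * e1 + dy (Da u f2) q * e2 = 0"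
    using B2_conditions[OF assms] by auto
  have "b1 * (dx (Da u f1) q * dy (Da u f2) q - dx (Da u f2) q * dy (Da u f1) q) = 0"
    "b2 * (dx (Da u f1) q * dy (Da u f2) q - dx (Da u f2) q * dy (Da u f1) q) = 0"
    using 1 by algebra+
  with b show *: "dx (Da u f1) q * dy (Da u f2) q = dx (Da u f2) q * dy (Da u f1) q" by auto
  show "dx (Da u f1) q * Da u (Da u (Da u f2)) q = dx (Da u f2) q * Da u (Da u (Da u f1)) q"
    using 2 * by algebra
qed

text \<open>The kernel vector is a multiple of \<open>(dy (Da u f2) q, - dx (Da u f2) q)\<close>.
  Hence \<open>Q f\<close> is, up to a nonzero square factor, the second derivative of
  \<open>Da u f\<close> in that direction, and the gradient terms cancel as for
  \<open>B2_equations\<close>.\<close>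

lemma S2_equations:
  assumes "smooth_on W f1" "smooth_on W f2" "open W" "q \<in> W"
    and "A_equivalent [(proj f1 f2 (u, v, w), q)] [(g, (0, 0))]" "g \<in> nf_S2"
    and nz: "dx (Da u f2) q \<noteq> 0"
  defines "Q \<equiv> \<lambda>f. dx (dx (Da u f)) q * dy (Da u f2) q ^ 2
    - 2 * dx (dy (Da u f)) q * dx (Da u f2) q * dy (Da u f2) q + dy (dy (Da u f)) q * dx (Da u f2) q ^ 2"
  shows "dx (Da u f1) q * dy (Da u f2) q = dx (Da u f2) q * dy (Da u f1) q"
    "dx (Da u f1) q * Q f2 = dx (Da u f2) q * Q f1"
proof -
  obtain b1 b2 e1 e2 where b: "b1 \<noteq> 0 \<or> b2 \<noteq> 0" and
    1: "dx (Da u f1) q * b1 + dy (Da u f1) q * b2 = 0" "dx (Da u f2) q * b1 + dy (Da u f2) q * b2 = 0" and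
    2: "dx (dx (Da u f1)) q * b1 ^ 2 + 2 * dx (dy (Da u f1)) q * b1 * b2 + dy (dy (Da u f1)) q * b2 ^ 2
      + dx (Da u f1) q * e1 + dy (Da u f1) q * e2 = 0"
      "dx (dx (Da u f2)) q * b1 ^ 2 + 2 * dx (dy (Da u f2)) q * b1 * b2 + dy (dy (Da u f2)) q * b2 ^ 2
      + dx (Da u f2) q * e1 + dy (Da u f2) q * e2 = 0"
    using S2_conditions[OF assms(1-6)] by auto
  have "b1 * (dx (Da u f1) q * dy (Da u f2) q - dx (Da u f2) q * dy (Da u f1) q) = 0"
    "b2 * (dx (Da u f1) q * dy (Da u f2) q - dx (Da u f2) q * dy (Da u f1) q) = 0"
    using 1 by algebra+
  with b show *: "dx (Da u f1) q * dy (Da u f2) q = dx (Da u f2) q * dy (Da u f1) q" by auto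
  have b2: "b2 \<noteq> 0" using b 1(2) nz by auto
  have Q: "b2 ^ 2 * Q f = dx (Da u f2) q ^ 2 *
    (dx (dx (Da u f)) q * b1 ^ 2 + 2 * dx (dy (Da u f)) q * b1 * b2 + dy (dy (Da u f)) q * b2 ^ 2)" for f
    unfolding Q_def using 1(2) by algebra
  have "b2 ^ 2 * (dx (Da u f1) q * Q f2 - dx (Da u f2) q * Q f1) = 0"
    using Q[of f1] Q[of f2] 2 * by algebra
  then show "dx (Da u f1) q * Q f2 = dx (Da u f2) q * Q f1" using b2 by simp
qed

section \<open>The Monge jets and Taylor limits along a curve\<close>

locale monge_surface =
  fixes f1 f2 :: "R2 \<Rightarrow> real" and \<alpha> \<beta> :: real and W :: "R2 set"
  assumes W: "open W" "(0, 0) \<in> W"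
    and smooth: "smooth_on W f1" "smooth_on W f2"
    and jet1: "dx (dx f1) (0, 0) = 2" "dx (dy f1) (0, 0) = 0" "dy (dy f1) (0, 0) = 0"
      "dx (dy (dy f1)) (0, 0) = 2" "dy (dy (dy f1)) (0, 0) = 0" "dy (dy (dy (dy f1))) (0, 0) = 24 * \<alpha>"
    and jet2: "dx (dx f2) (0, 0) = 0" "dx (dy f2) (0, 0) = 1" "dy (dy f2) (0, 0) = 0"
      "dy (dy (dy f2)) (0, 0) = 6 * \<beta>"

lemma dx_eqI:
  "(\<And>x y. ((\<lambda>s. f (s, y)) has_real_derivative f' (x, y)) (at x)) \<Longrightarrow> dx f = f'"
  by (auto simp: dx_def fun_eq_iff intro!: DERIV_imp_deriv)

lemma dy_eqI:
  "(\<And>x y. ((\<lambda>s. f (x, s)) has_real_derivative f' (x, y)) (at y)) \<Longrightarrow> dy f = f'"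
  by (auto simp: dy_def fun_eq_iff intro!: DERIV_imp_deriv)

lemma monge_surface_if_monge_form:
  assumes "monge_form \<alpha> \<beta> e f1 f2"
  shows "\<exists>W. monge_surface f1 f2 \<alpha> \<beta> W"
proof -
  obtain W where W: "open W" "(0, 0) \<in> W" "smooth_on W f1" "smooth_on W f2"
    using assms unfolding monge_form_def by blast
  define F where "F = (\<lambda>(x::real, y::real). x ^ 2 + x * y ^ 2 + \<alpha> * y ^ 4)"
  define G where "G = (\<lambda>(x::real, y::real). x * y + \<beta> * y ^ 3 + (\<Sum>i\<le>4. e i * x ^ i * y ^ (4 - i)))"
  have j1: "(dx ^^ i) ((dy ^^ j) f1) (0, 0) = (dx ^^ i) ((dy ^^ j) F) (0, 0)" if "i + j \<le> 4" for i j
    using assms that unfolding monge_form_def same_jet_def F_def by blast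
  have j2: "(dx ^^ i) ((dy ^^ j) f2) (0, 0) = (dx ^^ i) ((dy ^^ j) G) (0, 0)" if "i + j \<le> 4" for i j
    using assms that unfolding monge_form_def same_jet_def G_def by blast
  have Fx: "dx F = (\<lambda>(x, y). 2 * x + y ^ 2)"
    unfolding F_def by (rule dx_eqI) (auto intro!: derivative_eq_intros)
  have Fxx: "dx (dx F) = (\<lambda>(x, y). 2)"
    unfolding Fx by (rule dx_eqI) (auto intro!: derivative_eq_intros)
  have Fy: "dy F = (\<lambda>(x, y). 2 * x * y + 4 * \<alpha> * y ^ 3)"
    unfolding F_def by (rule dy_eqI) (auto intro!: derivative_eq_intros)
  have Fxy: "dx (dy F) = (\<lambda>(x, y). 2 * y)"
    unfolding Fy by (rule dx_eqI) (auto intro!: derivative_eq_intros)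
  have Fyy: "dy (dy F) = (\<lambda>(x, y). 2 * x + 12 * \<alpha> * y ^ 2)"
    unfolding Fy by (rule dy_eqI) (auto intro!: derivative_eq_intros)
  have Fxyy: "dx (dy (dy F)) = (\<lambda>(x, y). 2)"
    unfolding Fyy by (rule dx_eqI) (auto intro!: derivative_eq_intros)
  have Fyyy: "dy (dy (dy F)) = (\<lambda>(x, y). 24 * \<alpha> * y)"
    unfolding Fyy by (rule dy_eqI) (auto intro!: derivative_eq_intros)
  have Fyyyy: "dy (dy (dy (dy F))) = (\<lambda>(x, y). 24 * \<alpha>)"
    unfolding Fyyy by (rule dy_eqI) (auto intro!: derivative_eq_intros)
  have G: "G = (\<lambda>(x, y). x * y + \<beta> * y ^ 3 + e 0 * y ^ 4 + e 1 * x * y ^ 3 + e 2 * x ^ 2 * y ^ 2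
      + e 3 * x ^ 3 * y + e 4 * x ^ 4)"
    unfolding G_def by (auto simp: fun_eq_iff eval_nat_numeral)
  have Gx: "dx G = (\<lambda>(x, y). y + e 1 * y ^ 3 + 2 * e 2 * x * y ^ 2 + 3 * e 3 * x ^ 2 * y + 4 * e 4 * x ^ 3)"
    unfolding G by (rule dx_eqI) (auto intro!: derivative_eq_intros)
  have Gxx: "dx (dx G) = (\<lambda>(x, y). 2 * e 2 * y ^ 2 + 6 * e 3 * x * y + 12 * e 4 * x ^ 2)"
    unfolding Gx by (rule dx_eqI) (auto intro!: derivative_eq_intros)
  have Gy: "dy G = (\<lambda>(x, y). x + 3 * \<beta> * y ^ 2 + 4 * e 0 * y ^ 3 + 3 * e 1 * x * y ^ 2 + 2 * e 2 * x ^ 2 * y + e 3 * x ^ 3)"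
    unfolding G by (rule dy_eqI) (auto intro!: derivative_eq_intros)
  have Gxy: "dx (dy G) = (\<lambda>(x, y). 1 + 3 * e 1 * y ^ 2 + 4 * e 2 * x * y + 3 * e 3 * x ^ 2)"
    unfolding Gy by (rule dx_eqI) (auto intro!: derivative_eq_intros)
  have Gyy: "dy (dy G) = (\<lambda>(x, y). 6 * \<beta> * y + 12 * e 0 * y ^ 2 + 6 * e 1 * x * y + 2 * e 2 * x ^ 2)"
    unfolding Gy by (rule dy_eqI) (auto intro!: derivative_eq_intros)
  have Gyyy: "dy (dy (dy G)) = (\<lambda>(x, y). 6 * \<beta> + 24 * e 0 * y + 6 * e 1 * x)"
    unfolding Gyy by (rule dy_eqI) (auto intro!: derivative_eq_intros)
  have "monge_surface f1 f2 \<alpha> \<beta> W"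
  proof
    show "dx (dx f1) (0, 0) = 2" using j1[of 2 0] Fxx by (simp add: numeral_2_eq_2)
    show "dx (dy f1) (0, 0) = 0" using j1[of 1 1] Fxy by simp
    show "dy (dy f1) (0, 0) = 0" using j1[of 0 2] Fyy by (simp add: numeral_2_eq_2)
    show "dx (dy (dy f1)) (0, 0) = 2" using j1[of 1 2] Fxyy by (simp add: numeral_2_eq_2)
    show "dy (dy (dy f1)) (0, 0) = 0" using j1[of 0 3] Fyyy by (simp add: numeral_3_eq_3)
    show "dy (dy (dy (dy f1))) (0, 0) = 24 * \<alpha>" using j1[of 0 4] Fyyyy by (simp add: eval_nat_numeral)
    show "dx (dx f2) (0, 0) = 0" using j2[of 2 0] Gxx by (simp add: numeral_2_eq_2)
    show "dx (dy f2) (0, 0) = 1" using j2[of 1 1] Gxy by simp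
    show "dy (dy f2) (0, 0) = 0" using j2[of 0 2] Gyy by (simp add: numeral_2_eq_2)
    show "dy (dy (dy f2)) (0, 0) = 6 * \<beta>" using j2[of 0 3] Gyyy by (simp add: numeral_3_eq_3)
  qed (rule W)+
  then show ?thesis by blast
qed

lemma smooth_on_real_derivative:
  fixes g :: "real \<Rightarrow> real"
  assumes "smooth_on S g" "open S"
  shows "\<And>y. y \<in> S \<Longrightarrow> (g has_real_derivative deriv g y) (at y)" "smooth_on S (deriv g)"
proof -
  have D: "(g has_real_derivative frechet_derivative g (at y) 1) (at y)" if "y \<in> S" for y
  proof -
    note hd = smooth_on_has_derivative[OF assms that]
    interpret bounded_linear "frechet_derivative g (at y)"
      using hd has_derivative_bounded_linear by blast
    have "frechet_derivative g (at y) = (*) (frechet_derivative g (at y) 1)"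
    proof
      show "frechet_derivative g (at y) h = frechet_derivative g (at y) 1 * h" for h
        using scaleR[of h 1] by simp
    qed
    with hd show ?thesis by (simp add: has_field_derivative_def)
  qed
  then show "(g has_real_derivative deriv g y) (at y)" if "y \<in> S" for y
    using DERIV_imp_deriv that by metis
  show "smooth_on S (deriv g)"
    by (rule smooth_on_cong[OF assms(2) _ smooth_on_frechet_derivative[OF assms(1), of 1]])
      (use D DERIV_imp_deriv in metis)
qed

text \<open>Smoothness supplies the second derivative \<open>K\<close>; the \<open>o(y^2)\<close>
  condition gives \<open>deriv g 0 = 0\<close>, the tangency to \<open>x = 0\<close>.\<close>

lemma tangent_graph_derivatives:
  assumes "tangent_graph g"
  shows "\<exists>K. (\<forall>\<^sub>F y in nhds 0. (g has_real_derivative deriv g y) (at y)) \<and>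
    (deriv g has_real_derivative K) (at 0) \<and> g 0 = 0 \<and> deriv g 0 = 0"
proof -
  obtain e \<kappa> where e: "e > 0" "smooth_on {-e<..<e} g" and g0: "g 0 = 0"
    and \<kappa>: "(\<lambda>y. g y - \<kappa> * y ^ 2) \<in> o[at 0](\<lambda>y. y ^ 2)"
    using assms unfolding tangent_graph_def by blast
  note D = smooth_on_real_derivative[OF e(2) open_greaterThanLessThan]
  have "\<forall>\<^sub>F y in nhds 0. y \<in> {-e<..<e}"
    using e(1) by (intro eventually_nhds_in_open) auto
  then have 1: "\<forall>\<^sub>F y in nhds 0. (g has_real_derivative deriv g y) (at y)"
    by eventually_elim (rule D(1))
  have 2: "(deriv g has_real_derivative deriv (deriv g) 0) (at 0)"
    using smooth_on_real_derivative(1)[OF D(2)] e(1) by simp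
  have "((\<lambda>y. (g y - \<kappa> * y ^ 2) / y ^ 2) \<longlongrightarrow> 0) (at 0)"
    using smalloD_tendsto[OF \<kappa>] .
  then have "((\<lambda>y. ((g y - \<kappa> * y ^ 2) / y ^ 2 + \<kappa>) * y) \<longlongrightarrow> (0 + \<kappa>) * 0) (at 0)"
    by (intro tendsto_intros)
  moreover have "\<forall>\<^sub>F y in at 0. ((g y - \<kappa> * y ^ 2) / y ^ 2 + \<kappa>) * y = g y / y"
    using eventually_at_0_neq by eventually_elim (simp add: field_simps power2_eq_square)
  ultimately have "((\<lambda>y. g y / y) \<longlongrightarrow> 0) (at 0)"
    using tendsto_cong by fastforce
  moreover have "((\<lambda>y. g y / y) \<longlongrightarrow> deriv g 0) (at 0)"
    using DERIV_imp_quotient[OF eventually_nhds_x_imp_x[OF 1] g0] .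
  ultimately have "deriv g 0 = 0"
    using tendsto_unique trivial_limit_at by blast
  then show ?thesis using 1 2 g0 by blast
qed

text \<open>\<open>K\<close> is the slope of the tangent to the Legendrian lift, the derivative of
  \<open>p = deriv g y\<close> at 0.\<close>

locale curve_on_surface = monge_surface +
  fixes g :: "real \<Rightarrow> real" and K :: real
  assumes DERIV_g: "\<forall>\<^sub>F y in nhds 0. (g has_real_derivative deriv g y) (at y)"
    and DERIV2_g: "(deriv g has_real_derivative K) (at 0)"
    and g0: "g 0 = 0" and g'0: "deriv g 0 = 0"
begin

lemma legendrian_lift_direction: "vector_derivative (legendrian_lift g) (at 0) = (0, 1, K)"
proof -
  have "(g has_vector_derivative 0) (at 0)"
    using eventually_nhds_x_imp_x[OF DERIV_g] g'0
    by (metis has_real_derivative_iff_has_vector_derivative)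
  moreover have "(deriv g has_vector_derivative K) (at 0)"
    using DERIV2_g by (metis has_real_derivative_iff_has_vector_derivative)
  ultimately have "(legendrian_lift g has_vector_derivative (0, 1, K)) (at 0)"
    unfolding legendrian_lift_def[abs_def]
    by (intro has_vector_derivative_Pair) (auto intro!: derivative_eq_intros)
  then show ?thesis by (rule vector_derivative_at)
qed

lemma curve_tendsto_nhds: "((\<lambda>y. (g y, y)) \<longlongrightarrow> (0, 0)) (nhds 0)"
proof -
  have "isCont g 0" using eventually_nhds_x_imp_x[OF DERIV_g] DERIV_isCont by blast
  then have "(g \<longlongrightarrow> 0) (nhds 0)" using g0 unfolding isCont_def tendsto_at_iff_tendsto_nhds[of g] by simp
  then show ?thesis by (intro tendsto_Pair filterlim_ident)
qed

lemma curve_tendsto: "((\<lambda>y. (g y, y)) \<longlongrightarrow> (0, 0)) (at 0)"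
  using curve_tendsto_nhds by (rule filterlim_mono) (auto simp: at_within_def)

lemma curve_in_W: "\<forall>\<^sub>F y in at 0. (g y, y) \<in> W"
  using topological_tendstoD[OF curve_tendsto W] .

lemma smooth_tendsto:
  fixes h :: "R2 \<Rightarrow> real"
  assumes "smooth_on W h" "(z \<longlongrightarrow> (0, 0)) F"
  shows "((\<lambda>t. h (z t)) \<longlongrightarrow> h (0, 0)) F"
  using smooth_on_isCont[OF assms(1) W] assms(2) by (rule isCont_tendsto_compose)

lemma limit0: "smooth_on W h \<Longrightarrow> ((\<lambda>y. h (g y, y)) \<longlongrightarrow> h (0, 0)) (at 0)" for h :: "R2 \<Rightarrow> real"
  using smooth_tendsto curve_tendsto by blast

lemma DERIV_along_curve:
  fixes h :: "R2 \<Rightarrow> real"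
  assumes "smooth_on W h"
  shows "\<forall>\<^sub>F y in nhds 0. ((\<lambda>y. h (g y, y)) has_real_derivative
    dx h (g y, y) * deriv g y + dy h (g y, y)) (at y)"
  using DERIV_g topological_tendstoD[OF curve_tendsto_nhds W]
proof eventually_elim
  case (elim y)
  then show ?case
    using DERIV_compose_pair[of h g y "\<lambda>y. y" "deriv g y" 1] smooth_on_differentiable[OF assms W(1)] by simp
qed

lemma limit1:
  fixes h :: "R2 \<Rightarrow> real"
  assumes "smooth_on W h" "h (0, 0) = 0"
  shows "((\<lambda>y. h (g y, y) / y) \<longlongrightarrow> dy h (0, 0)) (at 0)"
  using DERIV_imp_quotient[OF eventually_nhds_x_imp_x[OF DERIV_along_curve[OF assms(1)]]] assms(2)
  by (simp add: g0 g'0)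

text \<open>The second Taylor coefficient of \<open>h\<close> along the curve: the acceleration
  \<open>(K, 0)\<close> contributes \<open>dx h\<close>, the velocity \<open>(0, 1)\<close> the
  second \<open>y\<close> derivative.\<close>

lemma limit2:
  fixes h :: "R2 \<Rightarrow> real"
  assumes "smooth_on W h" "h (0, 0) = 0" "dy h (0, 0) = 0"
  shows "((\<lambda>y. h (g y, y) / y ^ 2) \<longlongrightarrow> (dx h (0, 0) * K + dy (dy h) (0, 0)) / 2) (at 0)"
proof (rule taylor_quotient2[OF DERIV_along_curve[OF assms(1)]])
  have "((\<lambda>y. dx h (g y, y) * deriv g y + dy h (g y, y)) has_real_derivative
      ((dx (dx h) (g 0, 0) * deriv g 0 + dy (dx h) (g 0, 0)) * deriv g 0 + K * dx h (g 0, 0)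
        + (dx (dy h) (g 0, 0) * deriv g 0 + dy (dy h) (g 0, 0)))) (at 0)"
    by (intro DERIV_add DERIV_mult DERIV2_g eventually_nhds_x_imp_x[OF DERIV_along_curve]
        smooth_on_dx smooth_on_dy assms W)
  then show "((\<lambda>y. dx h (g y, y) * deriv g y + dy h (g y, y)) has_real_derivative
      dx h (0, 0) * K + dy (dy h) (0, 0)) (at 0)"
    by (simp add: g0 g'0 mult.commute)
qed (use assms g0 g'0 in auto)

lemma smooth_partials:
  "smooth_on W h \<Longrightarrow> smooth_on W (dx h)" "smooth_on W h \<Longrightarrow> smooth_on W (dy h)" for h :: "R2 \<Rightarrow> real"
  using smooth_on_dx smooth_on_dy W by blast+

lemmas sm = smooth smooth_partials

text \<open>\<open>K\<close> enters through \<open>dy (dy f1)\<close> alone: its leading part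
  \<open>2 * x + 12 * \<alpha> * y ^ 2\<close> becomes \<open>(K + 12 * \<alpha>) * y ^ 2\<close> on
  \<open>x = K / 2 * y ^ 2\<close>.\<close>

lemma second_order_limits:
  "((\<lambda>y. dx (dx f1) (g y, y)) \<longlongrightarrow> 2) (at 0)"
  "((\<lambda>y. dx (dy f1) (g y, y)) \<longlongrightarrow> 0) (at 0)"
  "((\<lambda>y. dx (dy f1) (g y, y) / y) \<longlongrightarrow> 2) (at 0)"
  "((\<lambda>y. dy (dy f1) (g y, y)) \<longlongrightarrow> 0) (at 0)"
  "((\<lambda>y. dy (dy f1) (g y, y) / y) \<longlongrightarrow> 0) (at 0)"
  "((\<lambda>y. dy (dy f1) (g y, y) / y ^ 2) \<longlongrightarrow> K + 12 * \<alpha>) (at 0)"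
  "((\<lambda>y. dx (dx f2) (g y, y)) \<longlongrightarrow> 0) (at 0)"
  "((\<lambda>y. dx (dy f2) (g y, y)) \<longlongrightarrow> 1) (at 0)"
  "((\<lambda>y. dy (dy f2) (g y, y)) \<longlongrightarrow> 0) (at 0)"
  "((\<lambda>y. dy (dy f2) (g y, y) / y) \<longlongrightarrow> 6 * \<beta>) (at 0)"
proof -
  show "((\<lambda>y. dx (dx f1) (g y, y)) \<longlongrightarrow> 2) (at 0)"
    using limit0[of "dx (dx f1)"] by (simp add: jet1 sm)
  show "((\<lambda>y. dx (dy f1) (g y, y)) \<longlongrightarrow> 0) (at 0)"
    using limit0[of "dx (dy f1)"] by (simp add: jet1 sm)
  have "dy (dx (dy f1)) (0, 0) = 2"
    using dx_dy_commute[of W "dy f1" "(0, 0)"] by (simp add: jet1 sm W)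
  then show "((\<lambda>y. dx (dy f1) (g y, y) / y) \<longlongrightarrow> 2) (at 0)"
    using limit1[of "dx (dy f1)"] by (simp add: jet1 sm)
  show "((\<lambda>y. dy (dy f1) (g y, y)) \<longlongrightarrow> 0) (at 0)"
    using limit0[of "dy (dy f1)"] by (simp add: jet1 sm)
  show "((\<lambda>y. dy (dy f1) (g y, y) / y) \<longlongrightarrow> 0) (at 0)"
    using limit1[of "dy (dy f1)"] by (simp add: jet1 sm)
  show "((\<lambda>y. dy (dy f1) (g y, y) / y ^ 2) \<longlongrightarrow> K + 12 * \<alpha>) (at 0)"
    using limit2[of "dy (dy f1)"] by (simp add: jet1 sm add_divide_distrib)
  show "((\<lambda>y. dx (dx f2) (g y, y)) \<longlongrightarrow> 0) (at 0)"
    using limit0[of "dx (dx f2)"] by (simp add: jet2 sm)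
  show "((\<lambda>y. dx (dy f2) (g y, y)) \<longlongrightarrow> 1) (at 0)"
    using limit0[of "dx (dy f2)"] by (simp add: jet2 sm)
  show "((\<lambda>y. dy (dy f2) (g y, y)) \<longlongrightarrow> 0) (at 0)"
    using limit0[of "dy (dy f2)"] by (simp add: jet2 sm)
  show "((\<lambda>y. dy (dy f2) (g y, y) / y) \<longlongrightarrow> 6 * \<beta>) (at 0)"
    using limit1[of "dy (dy f2)"] by (simp add: jet2 sm)
qed

lemma limit_eq_0:
  fixes h :: "real \<Rightarrow> real"
  assumes "(h \<longlongrightarrow> l) (at 0)" "\<forall>\<^sub>F y in at 0. h y = 0"
  shows "l = 0"
  using tendsto_unique[OF _ assms(1)] tendsto_eventually[OF assms(2)] trivial_limit_at by blast

lemma parabolic_slope: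
  assumes "\<forall>\<^sub>F y in at 0. (g y, y) \<in> parabolic_set f1 f2"
  shows "K = 12 * \<beta> - 12 * \<alpha> - 18 * \<beta> ^ 2"
proof -
  let ?A = "\<lambda>y. dx (dx f1) (g y, y)" and ?B = "\<lambda>y. dx (dy f1) (g y, y)" and ?C = "\<lambda>y. dy (dy f1) (g y, y)"
  let ?L = "\<lambda>y. dx (dx f2) (g y, y)" and ?M = "\<lambda>y. dx (dy f2) (g y, y)" and ?N = "\<lambda>y. dy (dy f2) (g y, y)"
  \<comment> \<open>Sixteen times the discriminant, divided by \<open>y ^ 2\<close>. The outer
    coefficients of the asymptotic form have orders 0 and 2 in \<open>y\<close>, the middle one
    order 1.\<close>
  let ?h = "\<lambda>y. (?A y * (?N y / y) - (?C y / y) * ?L y) ^ 2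
    - 4 * (?A y * ?M y - ?B y * ?L y) * ((?B y / y) * (?N y / y) - (?C y / y ^ 2) * ?M y)"
  have "(?h \<longlongrightarrow> (2 * (6 * \<beta>) - 0 * 0) ^ 2 - 4 * (2 * 1 - 0 * 0) * (2 * (6 * \<beta>) - (K + 12 * \<alpha>) * 1)) (at 0)"
    by (intro tendsto_intros second_order_limits)
  moreover have "\<forall>\<^sub>F y in at 0. ?h y = 0"
    using assms eventually_at_0_neq
  proof eventually_elim
    case (elim y)
    have "(?A y * ?N y - ?C y * ?L y) ^ 2 - 4 * (?A y * ?M y - ?B y * ?L y) * (?B y * ?N y - ?C y * ?M y) = 0"
      using elim(1) by (simp add: parabolic_set_def Let_def power2_eq_square algebra_simps)
    moreover have "y ^ 2 * ?h y
        = (?A y * ?N y - ?C y * ?L y) ^ 2 - 4 * (?A y * ?M y - ?B y * ?L y) * (?B y * ?N y - ?C y * ?M y)"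
      using elim(2) by (simp add: field_simps power2_eq_square)
    ultimately show ?case using elim(2) by simp
  qed
  ultimately have "(2 * (6 * \<beta>) - 0 * 0) ^ 2 - 4 * (2 * 1 - 0 * 0) * (2 * (6 * \<beta>) - (K + 12 * \<alpha>) * 1) = 0"
    by (rule limit_eq_0)
  then show ?thesis by (simp add: power2_eq_square algebra_simps)
qed

end

text \<open>Serves to bound the scaled asymptotic directions at flecnodal points, which are obtained
  by choice and have no continuity to start with.\<close>

lemma quadratic_root_bound:
  fixes a b c x :: real
  assumes "a * x ^ 2 + b * x + c = 0" "a \<ge> 1"
  shows "\<bar>x\<bar> \<le> \<bar>b\<bar> + \<bar>c\<bar> + 1"
proof (rule ccontr)
  assume "\<not> ?thesis"
  then have x: "\<bar>x\<bar> > \<bar>b\<bar> + \<bar>c\<bar> + 1" by simp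
  have "(\<bar>b\<bar> + \<bar>c\<bar> + 1) * \<bar>x\<bar> \<le> \<bar>x\<bar> * \<bar>x\<bar>"
    using x by (intro mult_right_mono) auto
  also have "\<dots> = x ^ 2" by (simp add: power2_eq_square flip: abs_mult)
  also have "\<dots> \<le> a * x ^ 2" using mult_right_mono[OF assms(2), of "x ^ 2"] by simp
  also have "\<dots> = - (b * x + c)" using assms(1) by simp
  also have "\<dots> \<le> \<bar>b\<bar> * \<bar>x\<bar> + \<bar>c\<bar>" using abs_triangle_ineq[of "b * x" c] by (simp add: abs_mult)
  also have "\<dots> \<le> \<bar>b\<bar> * \<bar>x\<bar> + \<bar>c\<bar> * \<bar>x\<bar>"
    using x mult_left_mono[of 1 "\<bar>x\<bar>" "\<bar>c\<bar>"] by simp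
  finally have "\<bar>x\<bar> \<le> 0" by (simp add: algebra_simps)
  then show False using x by simp
qed

section \<open>Asymptotic directions along a curve; the B_2 and S_2 curves\<close>

context curve_on_surface
begin

lemma quotient_tendsto_imp_tendsto_0:
  fixes u :: "real \<Rightarrow> real"
  assumes "((\<lambda>y. u y / y) \<longlongrightarrow> l) (at 0)"
  shows "(u \<longlongrightarrow> 0) (at 0)"
proof -
  have "((\<lambda>y. u y / y * y) \<longlongrightarrow> l * 0) (at 0)"
    by (intro tendsto_intros assms)
  moreover have "\<forall>\<^sub>F y in at 0. u y / y * y = u y"
    using eventually_at_0_neq by eventually_elim simp
  ultimately show ?thesis using tendsto_cong by fastforce
qed

lemma third_order_limits:
  "((\<lambda>y. dx (dy (dy f1)) (g y, y)) \<longlongrightarrow> 2) (at 0)"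
  "((\<lambda>y. dy (dx (dy f1)) (g y, y)) \<longlongrightarrow> 2) (at 0)"
  "((\<lambda>y. dy (dy (dy f1)) (g y, y)) \<longlongrightarrow> 0) (at 0)"
  "((\<lambda>y. dy (dy (dy f1)) (g y, y) / y) \<longlongrightarrow> 24 * \<alpha>) (at 0)"
  "((\<lambda>y. dy (dy (dy f2)) (g y, y)) \<longlongrightarrow> 6 * \<beta>) (at 0)"
proof -
  show "((\<lambda>y. dx (dy (dy f1)) (g y, y)) \<longlongrightarrow> 2) (at 0)"
    using limit0[of "dx (dy (dy f1))"] by (simp add: jet1 sm)
  have "dy (dx (dy f1)) (0, 0) = 2"
    using dx_dy_commute[of W "dy f1" "(0, 0)"] by (simp add: jet1 sm W)
  then show "((\<lambda>y. dy (dx (dy f1)) (g y, y)) \<longlongrightarrow> 2) (at 0)"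
    using limit0[of "dy (dx (dy f1))"] by (simp add: sm)
  show "((\<lambda>y. dy (dy (dy f1)) (g y, y)) \<longlongrightarrow> 0) (at 0)"
    using limit0[of "dy (dy (dy f1))"] by (simp add: jet1 sm)
  show "((\<lambda>y. dy (dy (dy f1)) (g y, y) / y) \<longlongrightarrow> 24 * \<alpha>) (at 0)"
    using limit1[of "dy (dy (dy f1))"] by (simp add: jet1 sm)
  show "((\<lambda>y. dy (dy (dy f2)) (g y, y)) \<longlongrightarrow> 6 * \<beta>) (at 0)"
    using limit0[of "dy (dy (dy f2))"] by (simp add: jet2 sm)
qed

lemmas third_order_continuity =
  limit0[OF smooth_partials(1)[OF smooth_partials(1)[OF smooth_partials(1)]], OF smooth(1)]
  limit0[OF smooth_partials(1)[OF smooth_partials(1)[OF smooth_partials(1)]], OF smooth(2)]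
  limit0[OF smooth_partials(1)[OF smooth_partials(1)[OF smooth_partials(2)]], OF smooth(1)]
  limit0[OF smooth_partials(1)[OF smooth_partials(1)[OF smooth_partials(2)]], OF smooth(2)]
  limit0[OF smooth_partials(1)[OF smooth_partials(2)[OF smooth_partials(2)]], OF smooth(2)]

text \<open>The equation says that the gradients of \<open>Da u f1\<close> and
  \<open>Da u f2\<close> are parallel, which expands to four times the asymptotic form at
  \<open>p = u\<close>. Divided by \<open>y ^ 2\<close> it ties \<open>K\<close> to the rate
  \<open>p\<close> at which the asymptotic direction turns; this serves the B_2, S_2 and flecnodal
  curves alike.\<close>

lemma asymptotic_slope:
  assumes u: "((\<lambda>y. u y / y) \<longlongrightarrow> p) (at 0)"
    and eq: "\<forall>\<^sub>F y in at 0.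
      (u y * dx (dx f1) (g y, y) + dx (dy f1) (g y, y)) * (u y * dx (dy f2) (g y, y) + dy (dy f2) (g y, y))
      = (u y * dx (dx f2) (g y, y) + dx (dy f2) (g y, y)) * (u y * dx (dy f1) (g y, y) + dy (dy f1) (g y, y))"
  shows "K = 2 * p ^ 2 + 12 * \<beta> * p + 12 * \<beta> - 12 * \<alpha>"
proof -
  note u0 = quotient_tendsto_imp_tendsto_0[OF u]
  let ?A = "\<lambda>y. dx (dx f1) (g y, y)" and ?B = "\<lambda>y. dx (dy f1) (g y, y)" and ?C = "\<lambda>y. dy (dy f1) (g y, y)"
  let ?L = "\<lambda>y. dx (dx f2) (g y, y)" and ?M = "\<lambda>y. dx (dy f2) (g y, y)" and ?N = "\<lambda>y. dy (dy f2) (g y, y)"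
  let ?h = "\<lambda>y. (u y / y * ?A y + ?B y / y) * (u y / y * ?M y + ?N y / y)
    - (u y * ?L y + ?M y) * (u y / y * (?B y / y) + ?C y / y ^ 2)"
  have "(?h \<longlongrightarrow> (p * 2 + 2) * (p * 1 + 6 * \<beta>) - (0 * 0 + 1) * (p * 2 + (K + 12 * \<alpha>))) (at 0)"
    by (intro tendsto_intros second_order_limits u u0)
  moreover have "\<forall>\<^sub>F y in at 0. ?h y = 0"
    using eq eventually_at_0_neq
  proof eventually_elim
    case (elim y)
    have "y ^ 2 * ?h y = (u y * ?A y + ?B y) * (u y * ?M y + ?N y) - (u y * ?L y + ?M y) * (u y * ?B y + ?C y)"
      using elim(2) by (simp add: field_simps power2_eq_square)
    then show ?case using elim by simp
  qed
  ultimately have "(p * 2 + 2) * (p * 1 + 6 * \<beta>) - (0 * 0 + 1) * (p * 2 + (K + 12 * \<alpha>)) = 0"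
    by (rule limit_eq_0)
  then show ?thesis by (simp add: power2_eq_square algebra_simps)
qed

text \<open>The direction \<open>u y\<close> varies with the point but is frozen inside
  \<open>Da (u y)\<close>, so no derivative of \<open>u\<close> appears.\<close>

lemma Da_partials_on_curve:
  assumes "smooth_on W f"
  shows "\<forall>\<^sub>F y in at 0.
    dx (Da (u y) f) (g y, y) = u y * dx (dx f) (g y, y) + dx (dy f) (g y, y) \<and>
    dy (Da (u y) f) (g y, y) = u y * dx (dy f) (g y, y) + dy (dy f) (g y, y) \<and>
    dx (dx (Da (u y) f)) (g y, y) = u y * dx (dx (dx f)) (g y, y) + dx (dx (dy f)) (g y, y) \<and>
    dx (dy (Da (u y) f)) (g y, y) = u y * dx (dx (dy f)) (g y, y) + dx (dy (dy f)) (g y, y) \<and>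
    dy (dy (Da (u y) f)) (g y, y) = u y * dx (dy (dy f)) (g y, y) + dy (dy (dy f)) (g y, y) \<and>
    Da (u y) (Da (u y) f) (g y, y) = u y ^ 2 * dx (dx f) (g y, y) + 2 * u y * dx (dy f) (g y, y)
      + dy (dy f) (g y, y) \<and>
    Da (u y) (Da (u y) (Da (u y) f)) (g y, y) = u y ^ 3 * dx (dx (dx f)) (g y, y)
      + 3 * u y ^ 2 * dx (dx (dy f)) (g y, y) + 3 * u y * dx (dy (dy f)) (g y, y) + dy (dy (dy f)) (g y, y)"
  using curve_in_W
proof eventually_elim
  case (elim y)
  note z = assms W(1) elim
  have "dy (dx (dy f)) (g y, y) = dx (dy (dy f)) (g y, y)"
    using dx_dy_commute[OF smooth_on_dy[OF z(1,2)] z(2,3)] by simp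
  then show ?case
    unfolding partials_Da[OF z] partials2_Da_commute[OF z] Da2[OF z] Da3[OF z]
    using dy_dx_dx[OF z] by (simp add: Da_def)
qed

text \<open>The exponent of \<open>y\<close> in each line is the weight left over: 4 for
  \<open>f1\<close> or 3 for \<open>f2\<close>, less 1 for each \<open>Da\<close> or
  \<open>dy\<close> and 2 for each \<open>dx\<close>.\<close>

lemma Da_limits:
  assumes u: "((\<lambda>y. u y / y) \<longlongrightarrow> p) (at 0)"
  shows "((\<lambda>y. dx (Da (u y) f1) (g y, y) / y) \<longlongrightarrow> 2 * p + 2) (at 0)"
    "((\<lambda>y. dx (Da (u y) f2) (g y, y)) \<longlongrightarrow> 1) (at 0)"
    "((\<lambda>y. dy (Da (u y) f2) (g y, y) / y) \<longlongrightarrow> p + 6 * \<beta>) (at 0)"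
    "((\<lambda>y. Da (u y) (Da (u y) f1) (g y, y) / y ^ 2) \<longlongrightarrow> 2 * p ^ 2 + 4 * p + K + 12 * \<alpha>) (at 0)"
    "((\<lambda>y. Da (u y) (Da (u y) f2) (g y, y) / y) \<longlongrightarrow> 2 * p + 6 * \<beta>) (at 0)"
    "((\<lambda>y. Da (u y) (Da (u y) (Da (u y) f1)) (g y, y) / y) \<longlongrightarrow> 6 * p + 24 * \<alpha>) (at 0)"
    "((\<lambda>y. Da (u y) (Da (u y) (Da (u y) f2)) (g y, y)) \<longlongrightarrow> 6 * \<beta>) (at 0)"
proof -
  note u0 = quotient_tendsto_imp_tendsto_0[OF u]
  note ev1 = eventually_conj[OF Da_partials_on_curve[OF smooth(1), of u] eventually_at_0_neq]
  note ev2 = eventually_conj[OF Da_partials_on_curve[OF smooth(2), of u] eventually_at_0_neq]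
  note lims = second_order_limits third_order_limits u u0
    third_order_continuity
  have "((\<lambda>y. u y / y * dx (dx f1) (g y, y) + dx (dy f1) (g y, y) / y) \<longlongrightarrow> p * 2 + 2) (at 0)"
    by (intro tendsto_intros lims)
  then show "((\<lambda>y. dx (Da (u y) f1) (g y, y) / y) \<longlongrightarrow> 2 * p + 2) (at 0)"
    by (rule Lim_transform_eventually[OF tendsto_eq_rhs]) (use ev1 in \<open>auto elim!: eventually_mono simp: field_simps\<close>)
  have "((\<lambda>y. u y * dx (dx f2) (g y, y) + dx (dy f2) (g y, y)) \<longlongrightarrow> 0 * 0 + 1) (at 0)"
    by (intro tendsto_intros lims)
  then show "((\<lambda>y. dx (Da (u y) f2) (g y, y)) \<longlongrightarrow> 1) (at 0)"
    by (rule Lim_transform_eventually[OF tendsto_eq_rhs]) (use ev2 in \<open>auto elim!: eventually_mono\<close>)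
  have "((\<lambda>y. u y / y * dx (dy f2) (g y, y) + dy (dy f2) (g y, y) / y) \<longlongrightarrow> p * 1 + 6 * \<beta>) (at 0)"
    by (intro tendsto_intros lims)
  then show "((\<lambda>y. dy (Da (u y) f2) (g y, y) / y) \<longlongrightarrow> p + 6 * \<beta>) (at 0)"
    by (rule Lim_transform_eventually[OF tendsto_eq_rhs]) (use ev2 in \<open>auto elim!: eventually_mono simp: field_simps\<close>)
  have "((\<lambda>y. (u y / y) ^ 2 * dx (dx f1) (g y, y) + 2 * (u y / y) * (dx (dy f1) (g y, y) / y)
      + dy (dy f1) (g y, y) / y ^ 2) \<longlongrightarrow> p ^ 2 * 2 + 2 * p * 2 + (K + 12 * \<alpha>)) (at 0)"
    by (intro tendsto_intros lims)
  then show "((\<lambda>y. Da (u y) (Da (u y) f1) (g y, y) / y ^ 2) \<longlongrightarrow> 2 * p ^ 2 + 4 * p + K + 12 * \<alpha>) (at 0)"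
    by (rule Lim_transform_eventually[OF tendsto_eq_rhs])
      (use ev1 in \<open>auto elim!: eventually_mono simp: field_simps power2_eq_square\<close>)
  have "((\<lambda>y. (u y / y) * u y * dx (dx f2) (g y, y) + 2 * (u y / y) * dx (dy f2) (g y, y)
      + dy (dy f2) (g y, y) / y) \<longlongrightarrow> p * 0 * 0 + 2 * p * 1 + 6 * \<beta>) (at 0)"
    by (intro tendsto_intros lims)
  then show "((\<lambda>y. Da (u y) (Da (u y) f2) (g y, y) / y) \<longlongrightarrow> 2 * p + 6 * \<beta>) (at 0)"
    by (rule Lim_transform_eventually[OF tendsto_eq_rhs])
      (use ev2 in \<open>auto elim!: eventually_mono simp: field_simps power2_eq_square\<close>)
  have "((\<lambda>y. u y / y * u y ^ 2 * dx (dx (dx f1)) (g y, y) + 3 * (u y / y) * u y * dx (dx (dy f1)) (g y, y)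
      + 3 * (u y / y) * dx (dy (dy f1)) (g y, y) + dy (dy (dy f1)) (g y, y) / y)
      \<longlongrightarrow> p * 0 ^ 2 * dx (dx (dx f1)) (0, 0) + 3 * p * 0 * dx (dx (dy f1)) (0, 0) + 3 * p * 2 + 24 * \<alpha>) (at 0)"
    by (intro tendsto_intros lims)
  then show "((\<lambda>y. Da (u y) (Da (u y) (Da (u y) f1)) (g y, y) / y) \<longlongrightarrow> 6 * p + 24 * \<alpha>) (at 0)"
    by (rule Lim_transform_eventually[OF tendsto_eq_rhs])
      (use ev1 in \<open>auto elim!: eventually_mono simp: field_simps power2_eq_square power3_eq_cube\<close>)
  have "((\<lambda>y. u y ^ 3 * dx (dx (dx f2)) (g y, y) + 3 * u y ^ 2 * dx (dx (dy f2)) (g y, y)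
      + 3 * u y * dx (dy (dy f2)) (g y, y) + dy (dy (dy f2)) (g y, y))
      \<longlongrightarrow> 0 ^ 3 * dx (dx (dx f2)) (0, 0) + 3 * 0 ^ 2 * dx (dx (dy f2)) (0, 0)
        + 3 * 0 * dx (dy (dy f2)) (0, 0) + 6 * \<beta>) (at 0)"
    by (intro tendsto_intros lims)
  then show "((\<lambda>y. Da (u y) (Da (u y) (Da (u y) f2)) (g y, y)) \<longlongrightarrow> 6 * \<beta>) (at 0)"
    by (rule Lim_transform_eventually[OF tendsto_eq_rhs]) (use ev2 in \<open>auto elim!: eventually_mono\<close>)
qed

lemma asymptotic_slope':
  assumes u: "((\<lambda>y. u y / y) \<longlongrightarrow> p) (at 0)"
    and eq: "\<forall>\<^sub>F y in at 0. dx (Da (u y) f1) (g y, y) * dy (Da (u y) f2) (g y, y)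
      = dx (Da (u y) f2) (g y, y) * dy (Da (u y) f1) (g y, y)"
  shows "K = 2 * p ^ 2 + 12 * \<beta> * p + 12 * \<beta> - 12 * \<alpha>"
proof (rule asymptotic_slope[OF u])
  show "\<forall>\<^sub>F y in at 0.
      (u y * dx (dx f1) (g y, y) + dx (dy f1) (g y, y)) * (u y * dx (dy f2) (g y, y) + dy (dy f2) (g y, y))
      = (u y * dx (dx f2) (g y, y) + dx (dy f2) (g y, y)) * (u y * dx (dy f1) (g y, y) + dy (dy f1) (g y, y))"
    using eq Da_partials_on_curve[OF smooth(1), of u] Da_partials_on_curve[OF smooth(2), of u]
    by eventually_elim simp
qed

text \<open>Smoothness of the direction along the stratum provides the limit \<open>p\<close> of
  \<open>u / y\<close>. Membership holds only eventually, on a range of \<open>y\<close> that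
  depends on \<open>r\<close>.\<close>

lemma stratum_germ_direction:
  assumes "stratum_germ S g"
  shows "\<exists>u p R. ((\<lambda>y. fst (u y) / y) \<longlongrightarrow> p) (at 0) \<and> R > 0 \<and>
    (\<forall>r. 0 < r \<and> r < R \<longrightarrow> (\<forall>\<^sub>F y in at 0. ((g y, y), u y) \<in> S r))"
proof -
  obtain U e R where U: "U 0 = 0" "e > 0" "smooth_on {-e<..<e} U" "R > 0"
    and S: "\<And>r. 0 < r \<Longrightarrow> r < R \<Longrightarrow> \<forall>\<^sub>F z in nhds (0, 0). z \<in> insert (0, 0) (S r) \<longleftrightarrow>
            fst z = (g (snd (fst z)), snd (fst z)) \<and> snd z = U (snd (fst z))"
    using assms unfolding stratum_germ_def by blast
  have "smooth_on {-e<..<e} (\<lambda>y. fst (U y))"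
    by (rule smooth_on_bounded_linear[OF _ bounded_linear_fst U(3)]) simp
  from smooth_on_real_derivative(1)[OF this, of 0]
  have "((\<lambda>y. fst (U y)) has_real_derivative deriv (\<lambda>y. fst (U y)) 0) (at 0)"
    using U(2) by simp
  from DERIV_imp_quotient[OF this]
  have "((\<lambda>y. fst (U y) / y) \<longlongrightarrow> deriv (\<lambda>y. fst (U y)) 0) (at 0)"
    using U(1) by simp
  moreover have "\<forall>\<^sub>F y in at 0. ((g y, y), U y) \<in> S r" if "0 < r" "r < R" for r
  proof -
    have "isCont U 0" using smooth_on_isCont[OF U(3)] U(2) by simp
    then have "(U \<longlongrightarrow> 0) (at 0)" using U(1) by (simp add: isCont_def)
    then have "((\<lambda>y. ((g y, y), U y)) \<longlongrightarrow> (0, 0)) (at 0)"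
      using tendsto_Pair[OF curve_tendsto] by (simp add: zero_prod_def)
    from eventually_compose_filterlim[OF S[OF that] this]
    show ?thesis using eventually_at_0_neq by eventually_elim (auto simp: zero_prod_def)
  qed
  ultimately show ?thesis using U(4) by blast
qed

text \<open>Parallel gradients give \<open>K\<close> in terms of \<open>p\<close>; the third-order
  equation, divided by \<open>y\<close>, becomes a linear equation for \<open>p\<close>.\<close>

lemma B2_slope:
  assumes "stratum_germ (stratum f1 f2 nf_B2) g"
  shows "\<exists>p. (2 * \<beta> - 1) * p = 4 * \<alpha> - 2 * \<beta> \<and> K = 2 * p ^ 2 + 12 * \<beta> * p + 12 * \<beta> - 12 * \<alpha>"
proof -
  obtain d p R where d: "((\<lambda>y. fst (d y) / y) \<longlongrightarrow> p) (at 0)" "R > 0"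
    "\<And>r. 0 < r \<Longrightarrow> r < R \<Longrightarrow> \<forall>\<^sub>F y in at 0. ((g y, y), d y) \<in> stratum f1 f2 nf_B2 r"
    using stratum_germ_direction[OF assms] by blast
  have half: "0 < R / 2" "R / 2 < R" using d(2) by simp_all
  let ?u = "\<lambda>y. fst (d y)"
  let ?X1 = "\<lambda>y. dx (Da (?u y) f1) (g y, y)" and ?X2 = "\<lambda>y. dx (Da (?u y) f2) (g y, y)"
  let ?T1 = "\<lambda>y. Da (?u y) (Da (?u y) (Da (?u y) f1)) (g y, y)"
  let ?T2 = "\<lambda>y. Da (?u y) (Da (?u y) (Da (?u y) f2)) (g y, y)"
  have ev: "\<forall>\<^sub>F y in at 0. ?X1 y * dy (Da (?u y) f2) (g y, y) = ?X2 y * dy (Da (?u y) f1) (g y, y) \<and>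
      ?X1 y * ?T2 y = ?X2 y * ?T1 y"
    using d(3)[OF half] curve_in_W
  proof eventually_elim
    case (elim y)
    obtain u v w where d: "d y = (u, v, w)" by (cases "d y")
    from elim obtain n where "n \<in> nf_B2" "A_equivalent [(proj f1 f2 (u, v, w), (g y, y))] [(n, (0, 0))]"
      using d by (auto simp: stratum_def)
    then show ?case using B2_equations[OF smooth W(1) elim(2)] d by simp
  qed
  note L = Da_limits[OF d(1)]
  have "((\<lambda>y. ?X1 y / y * ?T2 y - ?X2 y * (?T1 y / y)) \<longlongrightarrow> (2 * p + 2) * (6 * \<beta>) - 1 * (6 * p + 24 * \<alpha>)) (at 0)"
    by (intro tendsto_intros L)
  moreover have "\<forall>\<^sub>F y in at 0. ?X1 y / y * ?T2 y - ?X2 y * (?T1 y / y) = 0"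
    using ev eventually_at_0_neq by eventually_elim (simp add: field_simps)
  ultimately have "(2 * p + 2) * (6 * \<beta>) - 1 * (6 * p + 24 * \<alpha>) = 0" by (rule limit_eq_0)
  then have "(2 * \<beta> - 1) * p = 4 * \<alpha> - 2 * \<beta>" by (simp add: algebra_simps)
  moreover have "K = 2 * p ^ 2 + 12 * \<beta> * p + 12 * \<beta> - 12 * \<alpha>"
    by (rule asymptotic_slope'[OF d(1)]) (use ev in \<open>auto elim!: eventually_mono\<close>)
  ultimately show ?thesis by blast
qed

lemma S2_slope:
  assumes "stratum_germ (stratum f1 f2 nf_S2) g"
  shows "\<exists>p. (6 * \<beta> + 1) * p = 12 * \<alpha> - 18 * \<beta> \<and> K = 2 * p ^ 2 + 12 * \<beta> * p + 12 * \<beta> - 12 * \<alpha>"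
proof -
  obtain d p R where d: "((\<lambda>y. fst (d y) / y) \<longlongrightarrow> p) (at 0)" "R > 0"
    "\<And>r. 0 < r \<Longrightarrow> r < R \<Longrightarrow> \<forall>\<^sub>F y in at 0. ((g y, y), d y) \<in> stratum f1 f2 nf_S2 r"
    using stratum_germ_direction[OF assms] by blast
  have half: "0 < R / 2" "R / 2 < R" using d(2) by simp_all
  let ?u = "\<lambda>y. fst (d y)"
  note L = Da_limits[OF d(1)]
  note u0 = quotient_tendsto_imp_tendsto_0[OF d(1)]
  let ?X1 = "\<lambda>y. dx (Da (?u y) f1) (g y, y)" and ?X2 = "\<lambda>y. dx (Da (?u y) f2) (g y, y)"
    and ?Y2 = "\<lambda>y. dy (Da (?u y) f2) (g y, y)"
  let ?Q = "\<lambda>f y. dx (dx (Da (?u y) f)) (g y, y) * ?Y2 y ^ 2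
    - 2 * dx (dy (Da (?u y) f)) (g y, y) * ?X2 y * ?Y2 y + dy (dy (Da (?u y) f)) (g y, y) * ?X2 y ^ 2"
  have "\<forall>\<^sub>F y in at 0. ?X2 y \<noteq> 0"
    using tendsto_imp_eventually_ne[OF L(2)] by simp
  then have ev: "\<forall>\<^sub>F y in at 0. ?X1 y * ?Y2 y = ?X2 y * dy (Da (?u y) f1) (g y, y) \<and>
      ?X1 y * ?Q f2 y = ?X2 y * ?Q f1 y"
    using d(3)[OF half] curve_in_W
  proof eventually_elim
    case (elim y)
    obtain u v w where d: "d y = (u, v, w)" by (cases "d y")
    from elim obtain n where "n \<in> nf_S2" "A_equivalent [(proj f1 f2 (u, v, w), (g y, y))] [(n, (0, 0))]"
      using d by (auto simp: stratum_def)
    then show ?case using S2_equations[OF smooth W(1) elim(3)] elim(1) d by simp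
  qed
  \<comment> \<open>\<open>?q1\<close> is \<open>?Q f1\<close> divided by \<open>y\<close>, whereas
    \<open>?q2\<close> is \<open>?Q f2\<close> itself: \<open>Q\<close> has the weight of
    \<open>dy (dy (Da u f))\<close>, which is 1 for \<open>f1\<close> and 0 for
    \<open>f2\<close>.\<close>
  let ?q1 = "\<lambda>y. (?u y * dx (dx (dx f1)) (g y, y) + dx (dx (dy f1)) (g y, y)) * (?Y2 y / y) * ?Y2 y
    - 2 * (?u y * dx (dx (dy f1)) (g y, y) + dx (dy (dy f1)) (g y, y)) * ?X2 y * (?Y2 y / y)
    + (?u y / y * dx (dy (dy f1)) (g y, y) + dy (dy (dy f1)) (g y, y) / y) * ?X2 y ^ 2"
  let ?q2 = "\<lambda>y. (?u y * dx (dx (dx f2)) (g y, y) + dx (dx (dy f2)) (g y, y)) * ?Y2 y ^ 2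
    - 2 * (?u y * dx (dx (dy f2)) (g y, y) + dx (dy (dy f2)) (g y, y)) * ?X2 y * ?Y2 y
    + (?u y * dx (dy (dy f2)) (g y, y) + dy (dy (dy f2)) (g y, y)) * ?X2 y ^ 2"
  note Y0 = quotient_tendsto_imp_tendsto_0[OF L(3)]
  note lims = third_order_limits L Y0 d(1) u0
    third_order_continuity
  have q1: "(?q1 \<longlongrightarrow> (0 * dx (dx (dx f1)) (0, 0) + dx (dx (dy f1)) (0, 0)) * (p + 6 * \<beta>) * 0
    - 2 * (0 * dx (dx (dy f1)) (0, 0) + 2) * 1 * (p + 6 * \<beta>) + (p * 2 + 24 * \<alpha>) * 1 ^ 2) (at 0)"
    by (intro tendsto_intros lims)
  have q2: "(?q2 \<longlongrightarrow> (0 * dx (dx (dx f2)) (0, 0) + dx (dx (dy f2)) (0, 0)) * 0 ^ 2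
    - 2 * (0 * dx (dx (dy f2)) (0, 0) + dx (dy (dy f2)) (0, 0)) * 1 * 0
    + (0 * dx (dy (dy f2)) (0, 0) + 6 * \<beta>) * 1 ^ 2) (at 0)"
    by (intro tendsto_intros lims)
  note tendsto_diff[OF tendsto_mult[OF L(1) q2] tendsto_mult[OF L(2) q1]]
  moreover have "\<forall>\<^sub>F y in at 0. ?X1 y / y * ?q2 y - ?X2 y * ?q1 y = 0"
    using ev eventually_at_0_neq Da_partials_on_curve[OF smooth(1), of ?u] Da_partials_on_curve[OF smooth(2), of ?u]
  proof eventually_elim
    case (elim y)
    have "?q2 y = ?Q f2 y" using elim(4) by simp
    moreover have "y * ?q1 y = ?Q f1 y"
      using elim(2,3) by (simp add: field_simps power2_eq_square)
    moreover have "y * (?X1 y / y * ?q2 y - ?X2 y * ?q1 y) = ?X1 y * ?q2 y - ?X2 y * (y * ?q1 y)"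
      using elim(2) by (simp add: right_diff_distrib)
    ultimately have "y * (?X1 y / y * ?q2 y - ?X2 y * ?q1 y) = 0" using elim(1) by simp
    then show ?case using elim(2) by simp
  qed
  ultimately have "(2 * p + 2) * (6 * \<beta>) - (- 4 * (p + 6 * \<beta>) + (p * 2 + 24 * \<alpha>)) = 0"
    using limit_eq_0 by fastforce
  then have "(6 * \<beta> + 1) * p = 12 * \<alpha> - 18 * \<beta>" by (simp add: algebra_simps)
  moreover have "K = 2 * p ^ 2 + 12 * \<beta> * p + 12 * \<beta> - 12 * \<alpha>"
    by (rule asymptotic_slope'[OF d(1)]) (use ev in \<open>auto elim!: eventually_mono\<close>)
  ultimately show ?thesis by blast
qed

end

section \<open>The flecnodal curve\<close>

lemma DERIV_imp_dx: "((\<lambda>s. f (s, y)) has_real_derivative d) (at x) \<Longrightarrow> dx f (x, y) = d"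
  by (simp add: dx_def DERIV_imp_deriv)

lemma DERIV_imp_dy: "((\<lambda>s. f (x, s)) has_real_derivative d) (at y) \<Longrightarrow> dy f (x, y) = d"
  by (simp add: dy_def DERIV_imp_deriv)

context curve_on_surface
begin

text \<open>The direction \<open>p\<close> is held constant while differentiating; the factor 4
  clears the halves in the definition of the form.\<close>

lemma asymptotic_form_partials:
  assumes "z \<in> W"
  defines "A \<equiv> dx (dx f1)" and "B \<equiv> dx (dy f1)" and "C \<equiv> dy (dy f1)"
    and "L \<equiv> dx (dx f2)" and "M \<equiv> dx (dy f2)" and "N \<equiv> dy (dy f2)"
  shows "4 * dx (asymptotic_form f1 f2 p) z =
      (dx A z * M z + A z * dx M z - dx B z * L z - B z * dx L z) * p ^ 2
      + (dx A z * N z + A z * dx N z - dx C z * L z - C z * dx L z) * p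
      + (dx B z * N z + B z * dx N z - dx C z * M z - C z * dx M z)" (is ?X)
    and "4 * dy (asymptotic_form f1 f2 p) z =
      (dy A z * M z + A z * dy M z - dy B z * L z - B z * dy L z) * p ^ 2
      + (dy A z * N z + A z * dy N z - dy C z * L z - C z * dy L z) * p
      + (dy B z * N z + B z * dy N z - dy C z * M z - C z * dy M z)" (is ?Y)
proof -
  have F: "asymptotic_form f1 f2 p = (\<lambda>z. ((A z * M z - B z * L z) * p ^ 2 + (A z * N z - C z * L z) * p
      + (B z * N z - C z * M z)) / 4)"
    by (auto simp: fun_eq_iff asymptotic_form_def Let_def A_def B_def C_def L_def M_def N_def field_simps)
  have sm2: "smooth_on W A" "smooth_on W B" "smooth_on W C" "smooth_on W L" "smooth_on W M" "smooth_on W N"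
    unfolding A_def B_def C_def L_def M_def N_def by (intro sm)+
  obtain x y where z: "z = (x, y)" by (cases z)
  have zW: "(x, y) \<in> W" using assms(1) z by simp
  note D = sm2[THEN chart_DERIV(1)[OF _ W(1) zW]] and E = sm2[THEN chart_DERIV(2)[OF _ W(1) zW]]
  have "((\<lambda>s. asymptotic_form f1 f2 p (s, y)) has_real_derivative
      ((dx A z * M z + A z * dx M z - dx B z * L z - B z * dx L z) * p ^ 2
      + (dx A z * N z + A z * dx N z - dx C z * L z - C z * dx L z) * p
      + (dx B z * N z + B z * dx N z - dx C z * M z - C z * dx M z)) / 4) (at x)"
    unfolding F z
    by (rule DERIV_cong[OF DERIV_cdivide[OF DERIV_add[OF DERIV_add[OF
        DERIV_cmult_right[OF DERIV_diff[OF DERIV_mult[OF D(1,5)] DERIV_mult[OF D(2,4)]]]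
        DERIV_cmult_right[OF DERIV_diff[OF DERIV_mult[OF D(1,6)] DERIV_mult[OF D(3,4)]]]]
        DERIV_diff[OF DERIV_mult[OF D(2,6)] DERIV_mult[OF D(3,5)]]]]])
      (simp add: algebra_simps)
  from DERIV_imp_dx[of "asymptotic_form f1 f2 p", OF this] show ?X by (simp add: z)
  have "((\<lambda>s. asymptotic_form f1 f2 p (x, s)) has_real_derivative
      ((dy A z * M z + A z * dy M z - dy B z * L z - B z * dy L z) * p ^ 2
      + (dy A z * N z + A z * dy N z - dy C z * L z - C z * dy L z) * p
      + (dy B z * N z + B z * dy N z - dy C z * M z - C z * dy M z)) / 4) (at y)"
    unfolding F z
    by (rule DERIV_cong[OF DERIV_cdivide[OF DERIV_add[OF DERIV_add[OF
        DERIV_cmult_right[OF DERIV_diff[OF DERIV_mult[OF E(1,5)] DERIV_mult[OF E(2,4)]]]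
        DERIV_cmult_right[OF DERIV_diff[OF DERIV_mult[OF E(1,6)] DERIV_mult[OF E(3,4)]]]]
        DERIV_diff[OF DERIV_mult[OF E(2,6)] DERIV_mult[OF E(3,5)]]]]])
      (simp add: algebra_simps)
  from DERIV_imp_dy[of "asymptotic_form f1 f2 p", OF this] show ?Y by (simp add: z)
qed

text \<open>The asymptotic equation bounds \<open>u / y\<close>. The second flecnodal equation,
  divided by \<open>y\<close>, is then linear in \<open>u / y\<close> up to vanishing terms, with
  leading coefficient \<open>12 * \<beta> - 2\<close>. If this is nonzero, \<open>u / y\<close>
  converges; if it is zero, boundedness of \<open>u / y\<close> forces the constant term to vanish,
  which gives \<open>\<alpha> = \<beta>\<close>.\<close>

lemma flecnodal_slope:
  assumes "\<forall>\<^sub>F y in at 0. (g y, y) \<in> flecnodal_set f1 f2"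
  shows "6 * \<beta> = 1 \<Longrightarrow> \<alpha> = \<beta>"
    and "6 * \<beta> \<noteq> 1 \<Longrightarrow>
      \<exists>p. (6 * \<beta> - 1) * p = 12 * (\<alpha> - \<beta>) \<and> K = 2 * p ^ 2 + 12 * \<beta> * p + 12 * \<beta> - 12 * \<alpha>"
proof -
  define A B C where "A = dx (dx f1)" and "B = dx (dy f1)" and "C = dy (dy f1)"
  define L M N where "L = dx (dx f2)" and "M = dx (dy f2)" and "N = dy (dy f2)"
  \<comment> \<open>The flecnodal set provides a direction at each point separately, so
    \<open>u\<close> is a choice without regularity.\<close>
  define u where "u y = (SOME p. asymptotic_form f1 f2 p (g y, y) = 0 \<and>
     dy (asymptotic_form f1 f2 p) (g y, y) + p * dx (asymptotic_form f1 f2 p) (g y, y) = 0)" for y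
  have ev: "\<forall>\<^sub>F y in at 0. asymptotic_form f1 f2 (u y) (g y, y) = 0 \<and>
     dy (asymptotic_form f1 f2 (u y)) (g y, y) + u y * dx (asymptotic_form f1 f2 (u y)) (g y, y) = 0"
    using assms
  proof eventually_elim
    case (elim y)
    then show ?case unfolding u_def flecnodal_set_def by (rule_tac someI_ex) simp
  qed
  let ?q = "\<lambda>y. (g y, y)"
  have lims: "((\<lambda>y. A (?q y)) \<longlongrightarrow> 2) (at 0)" "((\<lambda>y. B (?q y)) \<longlongrightarrow> 0) (at 0)"
    "((\<lambda>y. B (?q y) / y) \<longlongrightarrow> 2) (at 0)" "((\<lambda>y. C (?q y)) \<longlongrightarrow> 0) (at 0)"
    "((\<lambda>y. C (?q y) / y) \<longlongrightarrow> 0) (at 0)" "((\<lambda>y. C (?q y) / y ^ 2) \<longlongrightarrow> K + 12 * \<alpha>) (at 0)"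
    "((\<lambda>y. L (?q y)) \<longlongrightarrow> 0) (at 0)" "((\<lambda>y. M (?q y)) \<longlongrightarrow> 1) (at 0)"
    "((\<lambda>y. N (?q y)) \<longlongrightarrow> 0) (at 0)" "((\<lambda>y. N (?q y) / y) \<longlongrightarrow> 6 * \<beta>) (at 0)"
    "((\<lambda>y. dx C (?q y)) \<longlongrightarrow> 2) (at 0)" "((\<lambda>y. dy B (?q y)) \<longlongrightarrow> 2) (at 0)"
    "((\<lambda>y. dy C (?q y)) \<longlongrightarrow> 0) (at 0)" "((\<lambda>y. dy C (?q y) / y) \<longlongrightarrow> 24 * \<alpha>) (at 0)"
    "((\<lambda>y. dy N (?q y)) \<longlongrightarrow> 6 * \<beta>) (at 0)"
    unfolding A_def B_def C_def L_def M_def N_def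
    by (fact second_order_limits third_order_limits)+
  have bdd: "((\<lambda>y. dx A (?q y)) \<longlongrightarrow> dx A (0, 0)) (at 0)" "((\<lambda>y. dx B (?q y)) \<longlongrightarrow> dx B (0, 0)) (at 0)"
    "((\<lambda>y. dx L (?q y)) \<longlongrightarrow> dx L (0, 0)) (at 0)" "((\<lambda>y. dx M (?q y)) \<longlongrightarrow> dx M (0, 0)) (at 0)"
    "((\<lambda>y. dx N (?q y)) \<longlongrightarrow> dx N (0, 0)) (at 0)" "((\<lambda>y. dy A (?q y)) \<longlongrightarrow> dy A (0, 0)) (at 0)"
    "((\<lambda>y. dy L (?q y)) \<longlongrightarrow> dy L (0, 0)) (at 0)" "((\<lambda>y. dy M (?q y)) \<longlongrightarrow> dy M (0, 0)) (at 0)"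
    unfolding A_def B_def L_def M_def N_def by (intro limit0 sm)+
  let ?a = "\<lambda>y. A (?q y) * M (?q y) - B (?q y) * L (?q y)"
  let ?b = "\<lambda>y. A (?q y) * (N (?q y) / y) - (C (?q y) / y) * L (?q y)"
  let ?c = "\<lambda>y. (B (?q y) / y) * (N (?q y) / y) - (C (?q y) / y ^ 2) * M (?q y)"
  have a: "(?a \<longlongrightarrow> 2 * 1 - 0 * 0) (at 0)" and b: "(?b \<longlongrightarrow> 2 * (6 * \<beta>) - 0 * 0) (at 0)"
    and c: "(?c \<longlongrightarrow> 2 * (6 * \<beta>) - (K + 12 * \<alpha>) * 1) (at 0)"
    by (intro tendsto_intros lims)+
  \<comment> \<open>The limit of the root bound plus 1, so that the strict inequality holds
    eventually.\<close>
  define bnd where "bnd = \<bar>2 * (6 * \<beta>)\<bar> + \<bar>2 * (6 * \<beta>) - (K + 12 * \<alpha>)\<bar> + 2"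
  have "((\<lambda>y. \<bar>?b y\<bar> + \<bar>?c y\<bar> + 1) \<longlongrightarrow> \<bar>2 * (6 * \<beta>) - 0 * 0\<bar> + \<bar>2 * (6 * \<beta>) - (K + 12 * \<alpha>) * 1\<bar> + 1) (at 0)"
    by (intro tendsto_add tendsto_rabs b c tendsto_const)
  then have "\<forall>\<^sub>F y in at 0. \<bar>?b y\<bar> + \<bar>?c y\<bar> + 1 < bnd"
    by (rule order_tendstoD) (simp add: bnd_def)
  moreover have "\<forall>\<^sub>F y in at 0. 1 < ?a y"
    by (rule order_tendstoD[OF a]) simp
  ultimately have bound: "\<forall>\<^sub>F y in at 0. \<bar>u y / y\<bar> \<le> bnd"
    using ev eventually_at_0_neq
  proof eventually_elim
    case (elim y)
    have "4 * asymptotic_form f1 f2 (u y) (?q y) = (A (?q y) * M (?q y) - B (?q y) * L (?q y)) * u y ^ 2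
        + (A (?q y) * N (?q y) - C (?q y) * L (?q y)) * u y + (B (?q y) * N (?q y) - C (?q y) * M (?q y))"
      by (simp add: asymptotic_form_def Let_def A_def B_def C_def L_def M_def N_def field_simps)
    also have "\<dots> = y ^ 2 * (?a y * (u y / y) ^ 2 + ?b y * (u y / y) + ?c y)"
      using elim(4) by (simp add: field_simps power2_eq_square)
    finally have "?a y * (u y / y) ^ 2 + ?b y * (u y / y) + ?c y = 0"
      using elim(3,4) by simp
    from quadratic_root_bound[OF this] elim(1,2) show ?case by linarith
  qed
  have u0: "(u \<longlongrightarrow> 0) (at 0)"
  proof (rule Lim_null_comparison[where g = "\<lambda>y. bnd * \<bar>y\<bar>"])
    show "\<forall>\<^sub>F y in at 0. norm (u y) \<le> bnd * \<bar>y\<bar>"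
      using bound eventually_at_0_neq by eventually_elim (simp add: field_simps)
    show "((\<lambda>y. bnd * \<bar>y\<bar>) \<longlongrightarrow> 0) (at 0)" by (auto intro!: tendsto_eq_intros)
  qed
  \<comment> \<open>Four times \<open>F_y + u F_x\<close> is \<open>u * ?e1 + y * ?e0\<close>:
    \<open>?e1\<close> collects all terms with a factor \<open>u\<close>, and \<open>?e0\<close> is
    the remaining part of \<open>F_y\<close> divided by \<open>y\<close>.\<close>
  let ?e1 = "\<lambda>y. (dy A (?q y) * M (?q y) + A (?q y) * dy M (?q y) - dy B (?q y) * L (?q y) - B (?q y) * dy L (?q y)) * u y
      + (dy A (?q y) * N (?q y) + A (?q y) * dy N (?q y) - dy C (?q y) * L (?q y) - C (?q y) * dy L (?q y))
      + ((dx A (?q y) * M (?q y) + A (?q y) * dx M (?q y) - dx B (?q y) * L (?q y) - B (?q y) * dx L (?q y)) * u y ^ 2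
      + (dx A (?q y) * N (?q y) + A (?q y) * dx N (?q y) - dx C (?q y) * L (?q y) - C (?q y) * dx L (?q y)) * u y
      + (dx B (?q y) * N (?q y) + B (?q y) * dx N (?q y) - dx C (?q y) * M (?q y) - C (?q y) * dx M (?q y)))"
  let ?e0 = "\<lambda>y. dy B (?q y) * (N (?q y) / y) + (B (?q y) / y) * dy N (?q y)
      - (dy C (?q y) / y) * M (?q y) - (C (?q y) / y) * dy M (?q y)"
  have e1: "(?e1 \<longlongrightarrow> (dy A (0, 0) * 1 + 2 * dy M (0, 0) - 2 * 0 - 0 * dy L (0, 0)) * 0
      + (dy A (0, 0) * 0 + 2 * (6 * \<beta>) - 0 * 0 - 0 * dy L (0, 0))
      + ((dx A (0, 0) * 1 + 2 * dx M (0, 0) - dx B (0, 0) * 0 - 0 * dx L (0, 0)) * 0 ^ 2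
      + (dx A (0, 0) * 0 + 2 * dx N (0, 0) - 2 * 0 - 0 * dx L (0, 0)) * 0
      + (dx B (0, 0) * 0 + 0 * dx N (0, 0) - 2 * 1 - 0 * dx M (0, 0)))) (at 0)"
    by (intro tendsto_intros lims bdd u0)
  have e0: "(?e0 \<longlongrightarrow> 2 * (6 * \<beta>) + 2 * (6 * \<beta>) - (24 * \<alpha>) * 1 - 0 * dy M (0, 0)) (at 0)"
    by (intro tendsto_intros lims bdd)
  have e: "(?e1 \<longlongrightarrow> 12 * \<beta> - 2) (at 0)" "(?e0 \<longlongrightarrow> 24 * \<beta> - 24 * \<alpha>) (at 0)"
    using e1 e0 by simp_all
  have ev2: "\<forall>\<^sub>F y in at 0. u y / y * ?e1 y + ?e0 y = 0"
    using ev curve_in_W eventually_at_0_neq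
  proof eventually_elim
    case (elim y)
    have "4 * dy (asymptotic_form f1 f2 (u y)) (?q y) + u y * (4 * dx (asymptotic_form f1 f2 (u y)) (?q y)) = 0"
      using conjunct2[OF elim(1)] by simp
    then have "u y * ?e1 y + (dy B (?q y) * N (?q y) + B (?q y) * dy N (?q y)
        - dy C (?q y) * M (?q y) - C (?q y) * dy M (?q y)) = 0"
      unfolding asymptotic_form_partials[OF elim(2)] A_def[symmetric] B_def[symmetric] C_def[symmetric]
        L_def[symmetric] M_def[symmetric] N_def[symmetric] by algebra
    moreover have "y * ?e0 y = dy B (?q y) * N (?q y) + B (?q y) * dy N (?q y)
        - dy C (?q y) * M (?q y) - C (?q y) * dy M (?q y)"
      using elim(3) by (simp add: field_simps)
    moreover have "y * (u y / y * ?e1 y + ?e0 y) = u y * ?e1 y + y * ?e0 y"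
      using elim(3) by (simp only: distrib_left[of y] mult.assoc[symmetric] times_divide_eq_right
          nonzero_mult_div_cancel_left simp_thms)
    ultimately have "y * (u y / y * ?e1 y + ?e0 y) = 0" by linarith
    then show ?case using elim(3) by simp
  qed
  have linear_eq: "\<bar>c\<bar> = \<bar>a\<bar> * \<bar>b\<bar>" "b \<noteq> 0 \<Longrightarrow> - c / b = a" if "a * b + c = 0" for a b c :: real
  proof -
    have "c = - (a * b)" using that by simp
    then show "\<bar>c\<bar> = \<bar>a\<bar> * \<bar>b\<bar>" "b \<noteq> 0 \<Longrightarrow> - c / b = a" by (simp_all add: abs_mult)
  qed
  show "\<alpha> = \<beta>" if \<beta>: "6 * \<beta> = 1"
  proof -
    have "12 * \<beta> - 2 = 0" using \<beta> by simp
    with e(1) have "(?e1 \<longlongrightarrow> 0) (at 0)" by (simp only:)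
    from tendsto_mult_right_zero[OF tendsto_rabs_zero[OF this], of bnd]
    have "((\<lambda>y. bnd * \<bar>?e1 y\<bar>) \<longlongrightarrow> 0) (at 0)" .
    moreover have "\<forall>\<^sub>F y in at 0. norm (?e0 y) \<le> bnd * \<bar>?e1 y\<bar>"
      using ev2 bound
    proof eventually_elim
      case (elim y)
      have "norm (?e0 y) = \<bar>u y / y\<bar> * \<bar>?e1 y\<bar>"
        unfolding real_norm_def by (rule linear_eq(1)[OF elim(1)])
      also have "\<dots> \<le> bnd * \<bar>?e1 y\<bar>" using elim(2) by (rule mult_right_mono) simp
      finally show ?case .
    qed
    ultimately have "(?e0 \<longlongrightarrow> 0) (at 0)"
      by (rule Lim_null_comparison[rotated])
    then have "24 * \<beta> - 24 * \<alpha> = 0" using e(2) tendsto_unique trivial_limit_at by blast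
    then show ?thesis by simp
  qed
  show "\<exists>p. (6 * \<beta> - 1) * p = 12 * (\<alpha> - \<beta>) \<and> K = 2 * p ^ 2 + 12 * \<beta> * p + 12 * \<beta> - 12 * \<alpha>"
    if \<beta>: "6 * \<beta> \<noteq> 1"
  proof -
    define p where "p = - (24 * \<beta> - 24 * \<alpha>) / (12 * \<beta> - 2)"
    have "((\<lambda>y. - ?e0 y / ?e1 y) \<longlongrightarrow> p) (at 0)"
      unfolding p_def by (rule tendsto_divide[OF tendsto_minus[OF e(2)] e(1)]) (use \<beta> in simp)
    moreover have "\<forall>\<^sub>F y in at 0. ?e1 y \<noteq> 0"
      using tendsto_imp_eventually_ne[OF e(1)] \<beta> by simp
    with ev2 have "\<forall>\<^sub>F y in at 0. - ?e0 y / ?e1 y = u y / y"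
      by eventually_elim (rule linear_eq(2))
    ultimately have p: "((\<lambda>y. u y / y) \<longlongrightarrow> p) (at 0)"
      by (rule Lim_transform_eventually)
    have "K = 2 * p ^ 2 + 12 * \<beta> * p + 12 * \<beta> - 12 * \<alpha>"
    proof (rule asymptotic_slope[OF p], use ev in eventually_elim)
      case (elim y)
      have "4 * asymptotic_form f1 f2 (u y) (?q y)
        = (u y * A (?q y) + B (?q y)) * (u y * M (?q y) + N (?q y))
          - (u y * L (?q y) + M (?q y)) * (u y * B (?q y) + C (?q y))"
        by (simp add: asymptotic_form_def Let_def A_def B_def C_def L_def M_def N_def field_simps power2_eq_square)
      with elim show ?case by (simp add: A_def B_def C_def L_def M_def N_def)
    qed
    moreover have "(6 * \<beta> - 1) * p = 12 * (\<alpha> - \<beta>)"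
    proof -
      have "12 * \<beta> - 2 \<noteq> 0" using \<beta> by simp
      then have "p * (12 * \<beta> - 2) = - (24 * \<beta> - 24 * \<alpha>)" by (simp add: p_def)
      then show ?thesis by (simp add: algebra_simps)
    qed
    ultimately show ?thesis by blast
  qed
qed

end

section \<open>Taylor expansion between the two points of the bi-germ\<close>

lemma taylor_along_direction:
  assumes "smooth_on W f" "open W" "\<And>s. \<bar>s\<bar> \<le> \<bar>\<tau>\<bar> \<Longrightarrow> (x + s * u, y + s) \<in> W"
  shows "\<exists>\<xi>. \<bar>\<xi>\<bar> \<le> \<bar>\<tau>\<bar> \<and> f (x + \<tau> * u, y + \<tau>) =
    (\<Sum>m<n. (Da u ^^ m) f (x, y) / fact m * \<tau> ^ m) + (Da u ^^ n) f (x + \<xi> * u, y + \<xi>) / fact n * \<tau> ^ n"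
proof -
  have sm: "smooth_on W ((Da u ^^ m) f)" for m
    by (induction m) (use assms smooth_on_Da in auto)
  have "\<forall>m t. m < n \<and> \<bar>t\<bar> \<le> \<bar>\<tau>\<bar> \<longrightarrow> ((\<lambda>s. (Da u ^^ m) f (x + s * u, y + s)) has_real_derivative
      (Da u ^^ Suc m) f (x + t * u, y + t)) (at t)"
  proof (intro allI impI)
    fix m t assume t: "m < n \<and> \<bar>t\<bar> \<le> \<bar>\<tau>\<bar>"
    have "((\<lambda>s. x + s * u) has_real_derivative u) (at t)" "((\<lambda>s. y + s) has_real_derivative 1) (at t)"
      by (auto intro!: derivative_eq_intros)
    from DERIV_compose_pair[OF smooth_on_differentiable[OF sm[of m] assms(2) assms(3)] this] t
    show "((\<lambda>s. (Da u ^^ m) f (x + s * u, y + s)) has_real_derivative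
      (Da u ^^ Suc m) f (x + t * u, y + t)) (at t)"
      by (simp add: Da_def mult.commute)
  qed
  from Maclaurin_bi_le[OF _ this, of "\<lambda>s. f (x + s * u, y + s)"]
  show ?thesis by simp
qed

text \<open>Expanding along the segment between the points, the coincidence
  \<open>f q' - f q = \<tau> * Da u f q\<close> loses its first-order terms and can be divided by
  \<open>\<tau> ^ 2\<close>. It also removes \<open>D2\<close> from the expansion of
  \<open>Da u f q'\<close>, so the tangency relation acquires the factor
  \<open>\<rho> * \<tau>\<close>, which is eliminated between \<open>f1\<close> and
  \<open>f2\<close>. The six points come from the Taylor remainders.\<close>

lemma A0S0_A1_equations:
  assumes f: "smooth_on W f1" "smooth_on W f2" "open W" and W: "ball 0 (4 * r) \<subseteq> W"
    and q: "(x, y) \<in> ball 0 r" "q' \<in> ball 0 r" "q' \<noteq> (x, y)"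
    and equiv: "A_equivalent [(proj f1 f2 (u, v, w), q'), (proj f1 f2 (u, v, w), (x, y))]
      [(\<lambda>(x, y). (x, y, 0), (0, 0)), (g, (0, 0))]" and g: "g \<in> nf_A0S0_A1"
  defines "D2 \<equiv> \<lambda>f. Da u (Da u f)" and "D3 \<equiv> \<lambda>f. Da u (Da u (Da u f))"
    and "D4 \<equiv> \<lambda>f. Da u (Da u (Da u (Da u f)))"
  shows "\<exists>\<tau> z1 z2 z3 z4 z5 z6. \<tau> \<noteq> 0 \<and> \<bar>\<tau>\<bar> \<le> 2 * r \<and> {z1, z2, z3, z4, z5, z6} \<subseteq> ball 0 (4 * r) \<and>
    D2 f1 (x, y) / 2 + \<tau> * D3 f1 (x, y) / 6 + \<tau> ^ 2 * D4 f1 z1 / 24 = 0 \<and>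
    D2 f2 (x, y) / 2 + \<tau> * D3 f2 (x, y) / 6 + \<tau> ^ 2 * D4 f2 z2 / 24 = 0 \<and>
    (dx (Da u f1) (x, y) + \<tau> / 2 * D2 (dx f1) z3) * (D3 f2 (x, y) / 6 + \<tau> * (D4 f2 z6 / 6 - D4 f2 z2 / 12))
    = (dx (Da u f2) (x, y) + \<tau> / 2 * D2 (dx f2) z4) * (D3 f1 (x, y) / 6 + \<tau> * (D4 f1 z5 / 6 - D4 f1 z1 / 12))"
proof -
  have r: "r > 0" using q(2) by (metis ball_eq_empty empty_iff linorder_not_le)
  have qW: "(x, y) \<in> W" "q' \<in> W" using q(1,2) W r by auto
  obtain \<tau> \<rho> where \<tau>: "\<tau> \<noteq> 0" "q' = (x + \<tau> * u, y + \<tau>)"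
    and c: "\<And>f. f \<in> {f1, f2} \<Longrightarrow> f q' - f (x, y) = \<tau> * Da u f (x, y) \<and>
      dx f q' - dx f (x, y) = \<rho> * (Da u f q' - Da u f (x, y))"
    using A0S0_A1_conditions[OF f qW q(3) equiv g] by auto
  have n: "norm (x, y) < r" "norm q' < r" using q(1,2) by auto
  have "norm (q' - (x, y)) < 2 * r"
    using norm_triangle_ineq4[of q' "(x, y)"] n by linarith
  moreover have d: "q' - (x, y) = (\<tau> * u, \<tau>)" using \<tau>(2) by simp
  ultimately have n2: "norm (\<tau> * u, \<tau>) < 2 * r" by simp
  have \<tau>r: "\<bar>\<tau>\<bar> \<le> 2 * r"
    using norm_snd_le[of \<tau> "\<tau> * u"] n2 by simp
  \<comment> \<open>Remainder points satisfy \<open>\<bar>s\<bar> \<le> \<bar>\<tau>\<bar>\<close>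
    and may lie on the far side of \<open>(x, y)\<close>; their norm is below
    \<open>r + 2 * r\<close> in either case.\<close>
  have seg: "(x + s * u, y + s) \<in> ball 0 (4 * r)" if "\<bar>s\<bar> \<le> \<bar>\<tau>\<bar>" for s
  proof -
    have "(x + s * u, y + s) = (x, y) + (s / \<tau>) *\<^sub>R (\<tau> * u, \<tau>)"
      using \<tau>(1) by simp
    then have "norm (x + s * u, y + s) \<le> norm (x, y) + norm ((s / \<tau>) *\<^sub>R (\<tau> * u, \<tau>))"
      by (simp only: norm_triangle_ineq)
    then have "norm (x + s * u, y + s) \<le> norm (x, y) + \<bar>s / \<tau>\<bar> * norm (\<tau> * u, \<tau>)"
      by (simp only: norm_scaleR)
    also have "\<dots> \<le> norm (x, y) + 1 * norm (\<tau> * u, \<tau>)"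
      using that \<tau>(1) by (intro add_left_mono mult_right_mono) (auto simp: field_simps)
    finally show ?thesis using n n2 r by simp
  qed
  then have segW: "\<And>s. \<bar>s\<bar> \<le> \<bar>\<tau>\<bar> \<Longrightarrow> (x + s * u, y + s) \<in> W" using W by blast
  have taylor: "\<exists>z1 z3 z5. {z1, z3, z5} \<subseteq> ball 0 (4 * r) \<and>
      D2 f (x, y) / 2 + \<tau> * D3 f (x, y) / 6 + \<tau> ^ 2 * D4 f z1 / 24 = 0 \<and>
      dx (Da u f) (x, y) + \<tau> / 2 * D2 (dx f) z3
        = \<rho> * \<tau> * (D3 f (x, y) / 6 + \<tau> * (D4 f z5 / 6 - D4 f z1 / 12))"
    if "f \<in> {f1, f2}" for f
  proof -
    have sm: "smooth_on W f" using f that by auto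
    obtain \<xi> where 1: "\<bar>\<xi>\<bar> \<le> \<bar>\<tau>\<bar>" "f q' = f (x, y) + Da u f (x, y) * \<tau> + D2 f (x, y) / 2 * \<tau> ^ 2
        + D3 f (x, y) / 6 * \<tau> ^ 3 + D4 f (x + \<xi> * u, y + \<xi>) / 24 * \<tau> ^ 4"
      using taylor_along_direction[OF sm f(3) segW, where n = 4 and \<tau> = \<tau>]
      by (auto simp: eval_nat_numeral D2_def D3_def D4_def \<tau>(2))
    obtain \<eta> where 2: "\<bar>\<eta>\<bar> \<le> \<bar>\<tau>\<bar>" "dx f q' = dx f (x, y) + Da u (dx f) (x, y) * \<tau>
        + D2 (dx f) (x + \<eta> * u, y + \<eta>) / 2 * \<tau> ^ 2"
      using taylor_along_direction[OF smooth_on_dx[OF sm f(3)] f(3) segW, where n = 2 and \<tau> = \<tau>]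
      by (auto simp: eval_nat_numeral D2_def \<tau>(2))
    obtain \<zeta> where 3: "\<bar>\<zeta>\<bar> \<le> \<bar>\<tau>\<bar>" "Da u f q' = Da u f (x, y) + D2 f (x, y) * \<tau>
        + D3 f (x, y) / 2 * \<tau> ^ 2 + D4 f (x + \<zeta> * u, y + \<zeta>) / 6 * \<tau> ^ 3"
      using taylor_along_direction[OF smooth_on_Da[OF sm f(3)] f(3) segW, where n = 3 and \<tau> = \<tau>]
      by (auto simp: eval_nat_numeral D2_def D3_def D4_def \<tau>(2))
    let ?a = "D2 f (x, y)" and ?T = "D3 f (x, y)" and ?d1 = "D4 f (x + \<xi> * u, y + \<xi>)"
      and ?d5 = "D4 f (x + \<zeta> * u, y + \<zeta>)"
    have "\<tau> ^ 2 * (?a / 2 + \<tau> * ?T / 6 + \<tau> ^ 2 * ?d1 / 24) = 0"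
      using 1(2) c[OF that] by (simp add: algebra_simps eval_nat_numeral)
    then have e: "?a / 2 + \<tau> * ?T / 6 + \<tau> ^ 2 * ?d1 / 24 = 0" using \<tau>(1) by simp
    \<comment> \<open>Splitting off \<open>2 * \<tau>\<close> times the left side of
      \<open>e\<close> removes \<open>D2\<close>: the coefficient of the third power of
      \<open>Da\<close> becomes \<open>1/2 - 2/6\<close>, and \<open>1/12\<close> is
      \<open>2/24\<close>.\<close>
    have "Da u f q' - Da u f (x, y) = \<tau> ^ 2 * (?T / 6 + \<tau> * (?d5 / 6 - ?d1 / 12))
        + 2 * \<tau> * (?a / 2 + \<tau> * ?T / 6 + \<tau> ^ 2 * ?d1 / 24)"
      using 3(2) by (simp add: algebra_simps eval_nat_numeral)
    then have "Da u f q' - Da u f (x, y) = \<tau> ^ 2 * (?T / 6 + \<tau> * (?d5 / 6 - ?d1 / 12))"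
      unfolding e by simp
    moreover have "dx f q' - dx f (x, y) = \<tau> * (Da u (dx f) (x, y) + \<tau> / 2 * D2 (dx f) (x + \<eta> * u, y + \<eta>))"
      using 2(2) by (simp add: algebra_simps eval_nat_numeral)
    ultimately have "\<tau> * (Da u (dx f) (x, y) + \<tau> / 2 * D2 (dx f) (x + \<eta> * u, y + \<eta>))
        = \<tau> * (\<rho> * \<tau> * (?T / 6 + \<tau> * (?d5 / 6 - ?d1 / 12)))"
      using c[OF that] by (auto simp: power2_eq_square mult.assoc mult.left_commute)
    then have "dx (Da u f) (x, y) + \<tau> / 2 * D2 (dx f) (x + \<eta> * u, y + \<eta>)
        = \<rho> * \<tau> * (?T / 6 + \<tau> * (?d5 / 6 - ?d1 / 12))"
      using \<tau>(1) partials_Da_commute(1)[OF sm f(3) qW(1)] by simp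
    then show ?thesis using e seg 1(1) 2(1) 3(1) by blast
  qed
  obtain z1 z3 z5 where z: "{z1, z3, z5} \<subseteq> ball 0 (4 * r)"
    "D2 f1 (x, y) / 2 + \<tau> * D3 f1 (x, y) / 6 + \<tau> ^ 2 * D4 f1 z1 / 24 = 0"
    "dx (Da u f1) (x, y) + \<tau> / 2 * D2 (dx f1) z3
        = \<rho> * \<tau> * (D3 f1 (x, y) / 6 + \<tau> * (D4 f1 z5 / 6 - D4 f1 z1 / 12))"
    using taylor[of f1] by blast
  obtain z2 z4 z6 where z': "{z2, z4, z6} \<subseteq> ball 0 (4 * r)"
    "D2 f2 (x, y) / 2 + \<tau> * D3 f2 (x, y) / 6 + \<tau> ^ 2 * D4 f2 z2 / 24 = 0"
    "dx (Da u f2) (x, y) + \<tau> / 2 * D2 (dx f2) z4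
        = \<rho> * \<tau> * (D3 f2 (x, y) / 6 + \<tau> * (D4 f2 z6 / 6 - D4 f2 z2 / 12))"
    using taylor[of f2] by blast
  show ?thesis
  proof (intro exI conjI)
    show "{z1, z2, z3, z4, z5, z6} \<subseteq> ball 0 (4 * r)" using z(1) z'(1) by blast
    show "(dx (Da u f1) (x, y) + \<tau> / 2 * D2 (dx f1) z3) * (D3 f2 (x, y) / 6 + \<tau> * (D4 f2 z6 / 6 - D4 f2 z2 / 12))
      = (dx (Da u f2) (x, y) + \<tau> / 2 * D2 (dx f2) z4) * (D3 f1 (x, y) / 6 + \<tau> * (D4 f1 z5 / 6 - D4 f1 z1 / 12))"
      unfolding z(3) z'(3) by (simp only: mult.assoc mult.commute mult.left_commute)
  qed (fact \<tau>(1) \<tau>r z(2) z'(2))+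
qed

context curve_on_surface
begin

text \<open>The points \<open>z n\<close> need not lie on the curve. Every term except the pure
  \<open>y\<close> derivative carries a factor \<open>u n\<close>, which tends to 0.\<close>

lemma Da_sequence_limits:
  assumes "u \<longlonglongrightarrow> 0" "z \<longlonglongrightarrow> (0, 0)" "\<And>n. z n \<in> W" "smooth_on W f"
  shows "(\<lambda>n. Da (u n) (Da (u n) (Da (u n) (Da (u n) f))) (z n)) \<longlonglongrightarrow> dy (dy (dy (dy f))) (0, 0)"
    "(\<lambda>n. Da (u n) (Da (u n) (dx f)) (z n)) \<longlonglongrightarrow> dx (dy (dy f)) (0, 0)"
proof -
  have lim: "(\<lambda>n. h (z n)) \<longlonglongrightarrow> h (0, 0)" if "smooth_on W h" for h :: "R2 \<Rightarrow> real"
    using smooth_tendsto[OF that assms(2)] .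
  have "(\<lambda>n. u n ^ 4 * dx (dx (dx (dx f))) (z n) + 4 * u n ^ 3 * dx (dx (dx (dy f))) (z n)
    + 6 * u n ^ 2 * dx (dx (dy (dy f))) (z n) + 4 * u n * dx (dy (dy (dy f))) (z n) + dy (dy (dy (dy f))) (z n))
    \<longlonglongrightarrow> 0 ^ 4 * dx (dx (dx (dx f))) (0, 0) + 4 * 0 ^ 3 * dx (dx (dx (dy f))) (0, 0)
    + 6 * 0 ^ 2 * dx (dx (dy (dy f))) (0, 0) + 4 * 0 * dx (dy (dy (dy f))) (0, 0) + dy (dy (dy (dy f))) (0, 0)"
    by (intro tendsto_intros lim assms(1) smooth_partials assms(4))
  then show "(\<lambda>n. Da (u n) (Da (u n) (Da (u n) (Da (u n) f))) (z n)) \<longlonglongrightarrow> dy (dy (dy (dy f))) (0, 0)"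
    using Da4[OF assms(4) W(1) assms(3)] by simp
  have "(\<lambda>n. u n ^ 2 * dx (dx (dx f)) (z n) + 2 * u n * dx (dy (dx f)) (z n) + dy (dy (dx f)) (z n))
    \<longlonglongrightarrow> 0 ^ 2 * dx (dx (dx f)) (0, 0) + 2 * 0 * dx (dy (dx f)) (0, 0) + dy (dy (dx f)) (0, 0)"
    by (intro tendsto_intros lim assms(1) smooth_partials assms(4))
  moreover have "dy (dy (dx f)) (0, 0) = dy (dx (dy f)) (0, 0)"
    by (rule partials_cong[OF dx_dy_commute[symmetric, OF assms(4) W(1)] W])
      (assumption | intro smooth_partials assms(4))+
  moreover have "\<dots> = dx (dy (dy f)) (0, 0)"
    using dx_dy_commute[OF smooth_partials(2)[OF assms(4)] W] by simp
  ultimately show "(\<lambda>n. Da (u n) (Da (u n) (dx f)) (z n)) \<longlonglongrightarrow> dx (dy (dy f)) (0, 0)"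
    using Da2[OF smooth_partials(1)[OF assms(4)] W(1) assms(3)] by simp
qed

text \<open>The second point is known only to exist, so witnesses are chosen for radii tending to 0,
  which forces \<open>\<tau>\<close> to 0. Convergence of \<open>t = \<tau> / y\<close> is then read
  off an equation linear in \<open>t\<close>: for \<open>\<beta> \<noteq> 0\<close> the coincidence
  of \<open>f2\<close>, where the coefficient tends to \<open>\<beta>\<close>, and for
  \<open>\<beta> = 0\<close> the tangency relation, where it tends to \<open>2 * \<alpha>\<close>.
  Hence the hypothesis \<open>nz\<close>.\<close>

lemma A0S0_A1_slope:
  assumes "stratum_germ (bi_stratum f1 f2 nf_A0S0_A1) g" and nz: "\<beta> \<noteq> 0 \<or> \<alpha> \<noteq> 0"
  shows "\<exists>T. 4 * \<alpha> + 6 * \<beta> ^ 2 - 5 * \<beta> + 2 * (\<beta> ^ 2 - \<beta> + \<alpha>) * T = 0 \<and>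
    K = 12 * \<beta> - 12 * \<alpha> - 18 * \<beta> ^ 2 + 2 * T ^ 2 * (\<beta> ^ 2 - \<beta> + \<alpha>)"
proof -
  obtain d p R where d: "((\<lambda>y. fst (d y) / y) \<longlongrightarrow> p) (at 0)" "R > 0"
    "\<And>r. 0 < r \<Longrightarrow> r < R \<Longrightarrow> \<forall>\<^sub>F y in at 0. ((g y, y), d y) \<in> bi_stratum f1 f2 nf_A0S0_A1 r"
    using stratum_germ_direction[OF assms(1)] by blast
  obtain e where e: "e > 0" "ball 0 e \<subseteq> W"
    using W open_contains_ball unfolding zero_prod_def by blast
  \<comment> \<open>Below \<open>R\<close>, so that the curve describes the stratum, and at most
    \<open>e / 4\<close>, so that all intermediate points stay in \<open>W\<close>.\<close>
  let ?r = "\<lambda>n. min (R / 2) (e / 4) / real (Suc n)"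
  let ?u = "\<lambda>y. fst (d y)"
  define D2 where "D2 y f = Da (?u y) (Da (?u y) f)" for y f
  define D3 where "D3 y f = Da (?u y) (Da (?u y) (Da (?u y) f))" for y f
  define D4 where "D4 y f = Da (?u y) (Da (?u y) (Da (?u y) (Da (?u y) f)))" for y f
  define Q where "Q n y \<tau> z1 z2 z3 z4 z5 z6 \<longleftrightarrow> y \<noteq> 0 \<and> \<bar>y\<bar> < 1 / real (Suc n) \<and>
    \<bar>\<tau>\<bar> \<le> 2 * ?r n \<and> {z1, z2, z3, z4, z5, z6} \<subseteq> ball 0 (4 * ?r n) \<and>
    D2 y f1 (g y, y) / 2 + \<tau> * D3 y f1 (g y, y) / 6 + \<tau> ^ 2 * D4 y f1 z1 / 24 = 0 \<and>
    D2 y f2 (g y, y) / 2 + \<tau> * D3 y f2 (g y, y) / 6 + \<tau> ^ 2 * D4 y f2 z2 / 24 = 0 \<and>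
    (dx (Da (?u y) f1) (g y, y) + \<tau> / 2 * D2 y (dx f1) z3) * (D3 y f2 (g y, y) / 6 + \<tau> * (D4 y f2 z6 / 6 - D4 y f2 z2 / 12))
    = (dx (Da (?u y) f2) (g y, y) + \<tau> / 2 * D2 y (dx f2) z4) * (D3 y f1 (g y, y) / 6 + \<tau> * (D4 y f1 z5 / 6 - D4 y f1 z1 / 12))"
    for n y \<tau> z1 z2 z3 z4 z5 z6
  have r: "0 < ?r n" "?r n < R" "4 * ?r n \<le> e" for n
  proof -
    have m: "0 < min (R / 2) (e / 4)" using d(2) e(1) by simp
    then show "0 < ?r n" by simp
    have "?r n \<le> min (R / 2) (e / 4) / 1"
      using m by (intro divide_left_mono) auto
    moreover have "min (R / 2) (e / 4) \<le> R / 2" "min (R / 2) (e / 4) \<le> e / 4" by simp_all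
    ultimately show "?r n < R" "4 * ?r n \<le> e" using d(2) by linarith+
  qed
  have "\<exists>y \<tau> z1 z2 z3 z4 z5 z6. Q n y \<tau> z1 z2 z3 z4 z5 z6" for n
  proof -
    have "\<forall>\<^sub>F y::real in at 0. \<bar>y\<bar> < 1 / real (Suc n)"
      by (intro order_tendstoD(2)[of "\<lambda>t. \<bar>t\<bar>" 0]) (auto intro!: tendsto_eq_intros)
    then have "\<forall>\<^sub>F y in at 0. ((g y, y), d y) \<in> bi_stratum f1 f2 nf_A0S0_A1 (?r n) \<and> y \<noteq> 0 \<and> \<bar>y\<bar> < 1 / real (Suc n)"
      using d(3)[OF r(1,2)] eventually_at_0_neq by eventually_elim simp
    from eventually_happens'[OF trivial_limit_at this]
    obtain y where y: "((g y, y), d y) \<in> bi_stratum f1 f2 nf_A0S0_A1 (?r n)" "y \<noteq> 0" "\<bar>y\<bar> < 1 / real (Suc n)"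
      by blast
    obtain u v w where uvw: "d y = (u, v, w)" by (cases "d y")
    obtain q' h where q': "(g y, y) \<in> ball 0 (?r n)" "q' \<in> ball 0 (?r n)" "q' \<noteq> (g y, y)" "h \<in> nf_A0S0_A1"
      "A_equivalent [(proj f1 f2 (u, v, w), q'), (proj f1 f2 (u, v, w), (g y, y))]
        [(\<lambda>(x, y). (x, y, 0), (0, 0)), (h, (0, 0))]"
      using y(1) unfolding bi_stratum_def uvw by blast
    have "ball 0 (4 * ?r n) \<subseteq> W"
      using e(2) subset_ball[OF r(3)] by blast
    have u: "u = ?u y" using uvw by simp
    note A0S0_A1_equations[OF smooth W(1) \<open>ball 0 (4 * ?r n) \<subseteq> W\<close> q'(1-3,5,4), unfolded u]
    then show ?thesis unfolding Q_def D2_def D3_def D4_def using y(2,3)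
      by - (rule exI[of _ y], elim exE conjE, intro exI conjI, assumption+)
  qed
  then obtain y \<tau> z1 z2 z3 z4 z5 z6 where
    "\<And>n. Q n (y n) (\<tau> n) (z1 n) (z2 n) (z3 n) (z4 n) (z5 n) (z6 n)"
    by metis
  note Q = this[unfolded Q_def]
  have inv: "(\<lambda>n. c / real (Suc n)) \<longlonglongrightarrow> 0" for c
    using tendsto_mult_right_zero[OF LIMSEQ_inverse_real_of_nat, of c] by (simp add: divide_inverse)
  have y0: "y \<longlonglongrightarrow> 0"
    by (rule Lim_null_comparison[OF _ inv[of 1]]) (use Q in \<open>auto simp: less_imp_le\<close>)
  have y_at: "filterlim y (at 0) sequentially"
    using y0 Q by (auto simp: filterlim_at)
  have \<tau>0: "\<tau> \<longlonglongrightarrow> 0"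
    by (rule Lim_null_comparison[OF _ inv[of "2 * min (R / 2) (e / 4)"]]) (use Q in auto)
  have z0: "z \<longlonglongrightarrow> (0, 0)" if "\<And>n. z n \<in> ball 0 (4 * ?r n)" for z :: "nat \<Rightarrow> R2"
  proof -
    have "z \<longlonglongrightarrow> 0"
      by (rule Lim_null_comparison[OF _ inv[of "4 * min (R / 2) (e / 4)"]]) (use that in \<open>auto simp: less_imp_le\<close>)
    then show ?thesis by (simp add: zero_prod_def)
  qed
  have zW: "z n \<in> W" if "\<And>n. z n \<in> ball 0 (4 * ?r n)" for z n
    using that[of n] e(2) subset_ball[OF r(3)] by blast
  have zb: "\<And>n. z1 n \<in> ball 0 (4 * ?r n)" "\<And>n. z2 n \<in> ball 0 (4 * ?r n)" "\<And>n. z3 n \<in> ball 0 (4 * ?r n)"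
     "\<And>n. z4 n \<in> ball 0 (4 * ?r n)" "\<And>n. z5 n \<in> ball 0 (4 * ?r n)" "\<And>n. z6 n \<in> ball 0 (4 * ?r n)"
    using Q by blast+
  note Lat = Da_limits[OF d(1), folded D2_def D3_def]
  note L = Lat[THEN filterlim_compose[OF _ y_at]] filterlim_compose[OF d(1) y_at]
  have u0: "(\<lambda>n. ?u (y n)) \<longlonglongrightarrow> 0"
    using filterlim_compose[OF quotient_tendsto_imp_tendsto_0[OF d(1)] y_at] .
  have M4: "(\<lambda>n. D4 (y n) f1 (z n)) \<longlonglongrightarrow> 24 * \<alpha>" "(\<lambda>n. D4 (y n) f2 (z n)) \<longlonglongrightarrow> dy (dy (dy (dy f2))) (0, 0)"
    "(\<lambda>n. D2 (y n) (dx f1) (z n)) \<longlonglongrightarrow> 2" "(\<lambda>n. D2 (y n) (dx f2) (z n)) \<longlonglongrightarrow> dx (dy (dy f2)) (0, 0)"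
    if "\<And>n. z n \<in> ball 0 (4 * ?r n)" for z
    using Da_sequence_limits[OF u0 z0[OF that] zW[OF that] smooth(1)]
      Da_sequence_limits[OF u0 z0[OF that] zW[OF that] smooth(2)]
    by (simp_all add: D2_def D4_def jet1)
  \<comment> \<open>These derivatives of \<open>f2\<close> are not among the data of the locale;
    they occur only with a factor \<open>\<tau>\<close>, which tends to 0.\<close>
  define c4 c2 where "c4 = dy (dy (dy (dy f2))) (0, 0)" and "c2 = dx (dy (dy f2)) (0, 0)"
  note M = M4(1)[OF zb(1)] M4(1)[OF zb(5)] M4(2)[OF zb(2), folded c4_def] M4(2)[OF zb(6), folded c4_def]
    M4(3)[OF zb(3)] M4(4)[OF zb(4), folded c2_def]
  define X1 where "X1 n = dx (Da (?u (y n)) f1) (g (y n), y n) / y n" for n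
  define X2 where "X2 n = dx (Da (?u (y n)) f2) (g (y n), y n)" for n
  define A1 where "A1 n = D2 (y n) f1 (g (y n), y n) / y n ^ 2" for n
  define A2 where "A2 n = D2 (y n) f2 (g (y n), y n) / y n" for n
  define T1 where "T1 n = D3 (y n) f1 (g (y n), y n) / y n" for n
  define T2 where "T2 n = D3 (y n) f2 (g (y n), y n)" for n
  define t where "t n = \<tau> n / y n" for n
  define E1 E5 E2 E6 e3 e4 where "E1 n = D4 (y n) f1 (z1 n)" and "E5 n = D4 (y n) f1 (z5 n)"
    and "E2 n = D4 (y n) f2 (z2 n)" and "E6 n = D4 (y n) f2 (z6 n)"
    and "e3 n = D2 (y n) (dx f1) (z3 n)" and "e4 n = D2 (y n) (dx f2) (z4 n)" for n
  have lims: "X1 \<longlonglongrightarrow> 2 * p + 2" "X2 \<longlonglongrightarrow> 1" "A1 \<longlonglongrightarrow> 2 * p ^ 2 + 4 * p + K + 12 * \<alpha>"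
    "A2 \<longlonglongrightarrow> 2 * p + 6 * \<beta>" "T1 \<longlonglongrightarrow> 6 * p + 24 * \<alpha>" "T2 \<longlonglongrightarrow> 6 * \<beta>"
    "E1 \<longlonglongrightarrow> 24 * \<alpha>" "E5 \<longlonglongrightarrow> 24 * \<alpha>" "E2 \<longlonglongrightarrow> c4" "E6 \<longlonglongrightarrow> c4" "e3 \<longlonglongrightarrow> 2" "e4 \<longlonglongrightarrow> c2"
    using L M unfolding X1_def[abs_def] X2_def[abs_def] A1_def[abs_def] A2_def[abs_def] T1_def[abs_def] T2_def[abs_def]
      E1_def[abs_def] E2_def[abs_def] E5_def[abs_def] E6_def[abs_def] e3_def[abs_def] e4_def[abs_def]
    by - assumption+
  \<comment> \<open>The three equations with \<open>\<tau> = y * t\<close>, divided by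
    \<open>y ^ 2\<close>, \<open>y\<close> and \<open>y\<close>. A factor \<open>\<tau>\<close> left
    in place tends to 0.\<close>
  have eq1: "A1 n / 2 + t n * T1 n / 6 + t n ^ 2 * E1 n / 24 = 0"
    and eq2: "A2 n / 2 + t n * (T2 n / 6 + \<tau> n * E2 n / 24) = 0"
    and eqX: "(X1 n + t n / 2 * e3 n) * (T2 n / 6 + \<tau> n * (E6 n / 6 - E2 n / 12))
      = (X2 n + \<tau> n / 2 * e4 n) * (T1 n / 6 + t n * (E5 n / 6 - E1 n / 12))" for n
  proof -
    have yn: "y n \<noteq> 0" using Q[of n] by blast
    have defs: "D2 (y n) f1 (g (y n), y n) = y n ^ 2 * A1 n" "D2 (y n) f2 (g (y n), y n) = y n * A2 n"
      "D3 (y n) f1 (g (y n), y n) = y n * T1 n" "D3 (y n) f2 (g (y n), y n) = T2 n"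
      "dx (Da (?u (y n)) f1) (g (y n), y n) = y n * X1 n" "dx (Da (?u (y n)) f2) (g (y n), y n) = X2 n"
      "\<tau> n = y n * t n"
      using yn by (simp_all add: A1_def A2_def T1_def T2_def X1_def X2_def t_def)
    have Qn: "y n ^ 2 * A1 n / 2 + (y n * t n) * (y n * T1 n) / 6 + (y n * t n) ^ 2 * E1 n / 24 = 0"
      "y n * A2 n / 2 + (y n * t n) * T2 n / 6 + (y n * t n) ^ 2 * E2 n / 24 = 0"
      "(y n * X1 n + (y n * t n) / 2 * e3 n) * (T2 n / 6 + \<tau> n * (E6 n / 6 - E2 n / 12))
      = (X2 n + \<tau> n / 2 * e4 n) * (y n * T1 n / 6 + (y n * t n) * (E5 n / 6 - E1 n / 12))"
      using Q[of n, folded E1_def E2_def E5_def E6_def e3_def e4_def, unfolded defs(1-6)]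
      unfolding defs(7) by blast+
    have "y n ^ 2 * (A1 n / 2 + t n * T1 n / 6 + t n ^ 2 * E1 n / 24) = 0"
      using Qn(1) by (simp add: algebra_simps power2_eq_square)
    then show "A1 n / 2 + t n * T1 n / 6 + t n ^ 2 * E1 n / 24 = 0" using yn by simp
    have "y n * (A2 n / 2 + t n * (T2 n / 6 + \<tau> n * E2 n / 24)) = 0"
      using Qn(2) unfolding defs(7) by (simp add: algebra_simps power2_eq_square)
    then show "A2 n / 2 + t n * (T2 n / 6 + \<tau> n * E2 n / 24) = 0" using yn by simp
    have "y n * ((X1 n + t n / 2 * e3 n) * (T2 n / 6 + \<tau> n * (E6 n / 6 - E2 n / 12)))
      = y n * ((X2 n + \<tau> n / 2 * e4 n) * (T1 n / 6 + t n * (E5 n / 6 - E1 n / 12)))"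
    proof -
      have "y n * X1 n + y n * t n / 2 * e3 n = y n * (X1 n + t n / 2 * e3 n)"
        "y n * T1 n / 6 + y n * t n * (E5 n / 6 - E1 n / 12) = y n * (T1 n / 6 + t n * (E5 n / 6 - E1 n / 12))"
        by (simp_all add: algebra_simps)
      from Qn(3)[unfolded this] show ?thesis
        by (simp only: mult.assoc mult.left_commute)
    qed
    then show "(X1 n + t n / 2 * e3 n) * (T2 n / 6 + \<tau> n * (E6 n / 6 - E2 n / 12))
      = (X2 n + \<tau> n / 2 * e4 n) * (T1 n / 6 + t n * (E5 n / 6 - E1 n / 12))" using yn by simp
  qed
  have "\<exists>T. t \<longlonglongrightarrow> T"
  proof (cases "\<beta> = 0")
    case False
    have lim: "(\<lambda>n. T2 n / 6 + \<tau> n * E2 n / 24) \<longlonglongrightarrow> 6 * \<beta> / 6 + 0 * c4 / 24"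
      by (intro tendsto_intros lims \<tau>0) simp_all
    then have "\<forall>\<^sub>F n in sequentially. T2 n / 6 + \<tau> n * E2 n / 24 \<noteq> 0"
      by (rule tendsto_imp_eventually_ne) (use False in simp)
    then have "\<forall>\<^sub>F n in sequentially. - (A2 n / 2) / (T2 n / 6 + \<tau> n * E2 n / 24) = t n"
    proof eventually_elim
      case (elim n)
      have "- (A2 n / 2) = t n * (T2 n / 6 + \<tau> n * E2 n / 24)" using eq2[of n] by linarith
      then show ?case using elim by simp
    qed
    moreover have "(\<lambda>n. - (A2 n / 2) / (T2 n / 6 + \<tau> n * E2 n / 24)) \<longlonglongrightarrow>
        - ((2 * p + 6 * \<beta>) / 2) / (6 * \<beta> / 6 + 0 * c4 / 24)"
      by (intro tendsto_divide tendsto_minus lims lim tendsto_const) (use False in simp_all)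
    ultimately show ?thesis using Lim_transform_eventually by blast
  next
    case True
    let ?B2 = "\<lambda>n. T2 n / 6 + \<tau> n * (E6 n / 6 - E2 n / 12)"
    let ?den = "\<lambda>n. (X2 n + \<tau> n / 2 * e4 n) * (E5 n / 6 - E1 n / 12) - e3 n / 2 * ?B2 n"
    let ?num = "\<lambda>n. X1 n * ?B2 n - (X2 n + \<tau> n / 2 * e4 n) * (T1 n / 6)"
    have den: "?den \<longlonglongrightarrow> (1 + 0 / 2 * c2) * (24 * \<alpha> / 6 - 24 * \<alpha> / 12) - 2 / 2 * (6 * \<beta> / 6 + 0 * (c4 / 6 - c4 / 12))"
      by (intro tendsto_intros lims \<tau>0) simp_all
    have num: "?num \<longlonglongrightarrow> (2 * p + 2) * (6 * \<beta> / 6 + 0 * (c4 / 6 - c4 / 12)) - (1 + 0 / 2 * c2) * ((6 * p + 24 * \<alpha>) / 6)"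
      by (intro tendsto_intros lims \<tau>0) simp_all
    have den0: "(1 + 0 / 2 * c2) * (24 * \<alpha> / 6 - 24 * \<alpha> / 12) - 2 / 2 * (6 * \<beta> / 6 + 0 * (c4 / 6 - c4 / 12)) \<noteq> 0"
      using nz True by simp
    have "\<forall>\<^sub>F n in sequentially. ?den n \<noteq> 0"
      by (rule tendsto_imp_eventually_ne[OF den den0])
    then have "\<forall>\<^sub>F n in sequentially. ?num n / ?den n = t n"
    proof eventually_elim
      case (elim n)
      have "?num n = t n * ?den n" using eqX[of n] by (simp add: algebra_simps)
      then show ?case using elim by simp
    qed
    then show ?thesis using Lim_transform_eventually[OF tendsto_divide[OF num den den0]] by blast
  qed
  then obtain T where T: "t \<longlonglongrightarrow> T" by blast
  have "(\<lambda>n. A1 n / 2 + t n * T1 n / 6 + t n ^ 2 * E1 n / 24) \<longlonglongrightarrow>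
      (2 * p ^ 2 + 4 * p + K + 12 * \<alpha>) / 2 + T * (6 * p + 24 * \<alpha>) / 6 + T ^ 2 * (24 * \<alpha>) / 24"
    by (intro tendsto_intros lims T) simp_all
  then have 1: "(2 * p ^ 2 + 4 * p + K + 12 * \<alpha>) / 2 + T * (6 * p + 24 * \<alpha>) / 6 + T ^ 2 * (24 * \<alpha>) / 24 = 0"
    unfolding eq1 by (simp add: LIMSEQ_const_iff)
  have "(\<lambda>n. A2 n / 2 + t n * (T2 n / 6 + \<tau> n * E2 n / 24)) \<longlonglongrightarrow>
      (2 * p + 6 * \<beta>) / 2 + T * (6 * \<beta> / 6 + 0 * c4 / 24)"
    by (intro tendsto_intros lims T \<tau>0) simp_all
  then have 2: "(2 * p + 6 * \<beta>) / 2 + T * (6 * \<beta> / 6 + 0 * c4 / 24) = 0"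
    unfolding eq2 by (simp add: LIMSEQ_const_iff)
  have "(\<lambda>n. (X1 n + t n / 2 * e3 n) * (T2 n / 6 + \<tau> n * (E6 n / 6 - E2 n / 12))
      - (X2 n + \<tau> n / 2 * e4 n) * (T1 n / 6 + t n * (E5 n / 6 - E1 n / 12))) \<longlonglongrightarrow>
      (2 * p + 2 + T / 2 * 2) * (6 * \<beta> / 6 + 0 * (c4 / 6 - c4 / 12))
      - (1 + 0 / 2 * c2) * ((6 * p + 24 * \<alpha>) / 6 + T * (24 * \<alpha> / 6 - 24 * \<alpha> / 12))"
    by (intro tendsto_intros lims T \<tau>0) simp_all
  then have 3: "(2 * p + 2 + T / 2 * 2) * (6 * \<beta> / 6 + 0 * (c4 / 6 - c4 / 12))
      - (1 + 0 / 2 * c2) * ((6 * p + 24 * \<alpha>) / 6 + T * (24 * \<alpha> / 6 - 24 * \<alpha> / 12)) = 0"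
    unfolding eqX by (simp add: LIMSEQ_const_iff)
  \<comment> \<open>The coincidence of \<open>f2\<close> gives \<open>p\<close>, the tangency
    relation then gives the equation for \<open>T\<close>, and the coincidence of \<open>f1\<close>
    gives \<open>K\<close>.\<close>
  have p: "p = - 3 * \<beta> - \<beta> * T" using 2 by (simp add: field_simps)
  have tau: "4 * \<alpha> + 6 * \<beta> ^ 2 - 5 * \<beta> + 2 * (\<beta> ^ 2 - \<beta> + \<alpha>) * T = 0"
    using 3 unfolding p by (simp add: field_simps power2_eq_square)
  have "K = - 2 * p ^ 2 - 4 * p - 12 * \<alpha> - 2 * T * (p + 4 * \<alpha>) - 2 * T ^ 2 * \<alpha>"
    using 1 by (simp add: field_simps)
  then have "K = 12 * \<beta> - 12 * \<alpha> - 18 * \<beta> ^ 2 + 2 * T ^ 2 * (\<beta> ^ 2 - \<beta> + \<alpha>)"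
    using p tau by algebra
  with tau show ?thesis by blast
qed

end

section \<open>Recovering the moduli from the cross-ratios\<close>

lemma tangent_graph_if_curve_of: "curve_of f1 f2 L g \<Longrightarrow> tangent_graph g"
  by (cases L) (auto simp: set_germ_def stratum_germ_def)

context monge_surface
begin

lemma curve_of_slope:
  assumes "curve_of f1 f2 L g"
  shows "\<exists>K. curve_on_surface f1 f2 \<alpha> \<beta> W g K"
proof -
  obtain K where "\<forall>\<^sub>F y in nhds 0. (g has_real_derivative deriv g y) (at y)"
    "(deriv g has_real_derivative K) (at 0)" "g 0 = 0" "deriv g 0 = 0"
    using tangent_graph_derivatives[OF tangent_graph_if_curve_of[OF assms]] by blast
  then have "curve_on_surface f1 f2 \<alpha> \<beta> W g K" by unfold_locales
  then show ?thesis by blast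
qed

text \<open>All curve germs with label \<open>L\<close> yield the same vector, which determines the
  definite description without identifying the germs themselves.\<close>

lemma line_eqI:
  assumes ex: "line f1 f2 L \<noteq> None" "L \<noteq> Lg"
    and K: "\<And>g K. curve_of f1 f2 L g \<Longrightarrow> curve_on_surface f1 f2 \<alpha> \<beta> W g K \<Longrightarrow> K = k"
  shows "line f1 f2 L = Some (0, 1, k)"
proof -
  have *: "vector_derivative (legendrian_lift g) (at 0) = (0, 1, k)" if "curve_of f1 f2 L g" for g
    using curve_of_slope[OF that] K[OF that] curve_on_surface.legendrian_lift_direction by blast
  obtain g where g: "curve_of f1 f2 L g"
    using ex by (auto simp: line_def split: if_splits)
  have "(THE v. \<exists>g. curve_of f1 f2 L g \<and> v = vector_derivative (legendrian_lift g) (at 0)) = (0, 1, k)"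
    using g * by (intro the_equality) auto
  then show ?thesis using g ex(2) by (auto simp: line_def)
qed

lemma set_germ_eventually:
  assumes "set_germ Z g" "curve_on_surface f1 f2 \<alpha> \<beta> W g K"
  shows "\<forall>\<^sub>F y in at 0. (g y, y) \<in> Z"
proof -
  interpret curve_on_surface f1 f2 \<alpha> \<beta> W g K by fact
  have "\<forall>\<^sub>F q in nhds (0, 0). q \<in> insert (0, 0) Z \<longleftrightarrow> fst q = g (snd q)"
    using assms(1) by (simp add: set_germ_def)
  from eventually_compose_filterlim[OF this curve_tendsto]
  show ?thesis using eventually_at_0_neq by eventually_elim auto
qed

lemma slopes:
  assumes "curve_on_surface f1 f2 \<alpha> \<beta> W g K"
  shows "curve_of f1 f2 LP g \<Longrightarrow> K = 12 * \<beta> - 12 * \<alpha> - 18 * \<beta> ^ 2"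
    and "curve_of f1 f2 LB g \<Longrightarrow>
      \<exists>p. (2 * \<beta> - 1) * p = 4 * \<alpha> - 2 * \<beta> \<and> K = 2 * p ^ 2 + 12 * \<beta> * p + 12 * \<beta> - 12 * \<alpha>"
    and "curve_of f1 f2 LS g \<Longrightarrow>
      \<exists>p. (6 * \<beta> + 1) * p = 12 * \<alpha> - 18 * \<beta> \<and> K = 2 * p ^ 2 + 12 * \<beta> * p + 12 * \<beta> - 12 * \<alpha>"
    and "curve_of f1 f2 LF g \<Longrightarrow> 6 * \<beta> = 1 \<Longrightarrow> \<alpha> = \<beta>"
    and "curve_of f1 f2 LF g \<Longrightarrow> 6 * \<beta> \<noteq> 1 \<Longrightarrow>
      \<exists>p. (6 * \<beta> - 1) * p = 12 * (\<alpha> - \<beta>) \<and> K = 2 * p ^ 2 + 12 * \<beta> * p + 12 * \<beta> - 12 * \<alpha>"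
    and "curve_of f1 f2 Ls01 g \<Longrightarrow> \<beta> \<noteq> 0 \<or> \<alpha> \<noteq> 0 \<Longrightarrow>
      \<exists>T. 4 * \<alpha> + 6 * \<beta> ^ 2 - 5 * \<beta> + 2 * (\<beta> ^ 2 - \<beta> + \<alpha>) * T = 0 \<and>
        K = 12 * \<beta> - 12 * \<alpha> - 18 * \<beta> ^ 2 + 2 * T ^ 2 * (\<beta> ^ 2 - \<beta> + \<alpha>)"
proof -
  interpret curve_on_surface f1 f2 \<alpha> \<beta> W g K by fact
  show "curve_of f1 f2 LP g \<Longrightarrow> K = 12 * \<beta> - 12 * \<alpha> - 18 * \<beta> ^ 2"
    using parabolic_slope set_germ_eventually[OF _ assms] by simp
  show "curve_of f1 f2 LB g \<Longrightarrow>
      \<exists>p. (2 * \<beta> - 1) * p = 4 * \<alpha> - 2 * \<beta> \<and> K = 2 * p ^ 2 + 12 * \<beta> * p + 12 * \<beta> - 12 * \<alpha>"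
    using B2_slope by simp
  show "curve_of f1 f2 LS g \<Longrightarrow>
      \<exists>p. (6 * \<beta> + 1) * p = 12 * \<alpha> - 18 * \<beta> \<and> K = 2 * p ^ 2 + 12 * \<beta> * p + 12 * \<beta> - 12 * \<alpha>"
    using S2_slope by simp
  show "curve_of f1 f2 LF g \<Longrightarrow> 6 * \<beta> = 1 \<Longrightarrow> \<alpha> = \<beta>"
    using flecnodal_slope(1) set_germ_eventually[OF _ assms] by simp
  show "curve_of f1 f2 LF g \<Longrightarrow> 6 * \<beta> \<noteq> 1 \<Longrightarrow>
      \<exists>p. (6 * \<beta> - 1) * p = 12 * (\<alpha> - \<beta>) \<and> K = 2 * p ^ 2 + 12 * \<beta> * p + 12 * \<beta> - 12 * \<alpha>"
    using flecnodal_slope(2) set_germ_eventually[OF _ assms] by simp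
  show "curve_of f1 f2 Ls01 g \<Longrightarrow> \<beta> \<noteq> 0 \<or> \<alpha> \<noteq> 0 \<Longrightarrow>
      \<exists>T. 4 * \<alpha> + 6 * \<beta> ^ 2 - 5 * \<beta> + 2 * (\<beta> ^ 2 - \<beta> + \<alpha>) * T = 0 \<and>
        K = 12 * \<beta> - 12 * \<alpha> - 18 * \<beta> ^ 2 + 2 * T ^ 2 * (\<beta> ^ 2 - \<beta> + \<alpha>)"
    using A0S0_A1_slope by simp
qed

end

text \<open>A relation between the moduli and the table of cross-ratios, with no reference to the
  surface, so that the moduli can be chosen from the table. The inequalities come from the
  denominators of the slopes.\<close>

definition cr_equations ::
  "real \<Rightarrow> real \<Rightarrow> (line_label \<times> line_label \<times> line_label \<times> line_label \<Rightarrow> real option) \<Rightarrow> bool" where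
  "cr_equations \<alpha> \<beta> c \<longleftrightarrow> 6 * \<beta> \<noteq> 1 \<and> 6 * \<beta> \<noteq> - 1 \<and> 2 * \<beta> \<noteq> 1 \<and> \<beta> ^ 2 - \<beta> + \<alpha> \<noteq> 0 \<and>
     c (LP, Lg, LS, LF) = Some (((6 * \<beta> - 1) / (6 * \<beta> + 1)) ^ 2) \<and>
     c (LP, Lg, LB, LF) = Some (((6 * \<beta> - 1) / (3 * (2 * \<beta> - 1))) ^ 2) \<and>
     c (LP, Lg, Ls01, LB) = Some ((2 * \<beta> - 1) ^ 2 / (4 * (\<beta> ^ 2 - \<beta> + \<alpha>)))"

lemma square_quotients_eq:
  fixes a b c d :: real
  assumes "(a / b) ^ 2 = (c / d) ^ 2" "b \<noteq> 0" "d \<noteq> 0"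
  shows "a * d = c * b \<or> a * d = - (c * b)"
proof -
  have "a / b = c / d \<or> a / b = - (c / d)" using assms(1) by (simp add: power2_eq_iff)
  then show ?thesis
  proof
    assume "a / b = c / d"
    then show ?thesis using assms(2,3) by (simp add: frac_eq_eq)
  next
    assume "a / b = - (c / d)"
    then have "a / b = (- c) / d" by simp
    then have "a * d = (- c) * b" using frac_eq_eq[OF assms(2,3)] by blast
    then show ?thesis by simp
  qed
qed

text \<open>In \<open>t = 6 * \<beta>\<close> the first two cross-ratios are squares of injective
  fractional linear functions, so each determines \<open>t\<close> up to an involution: a change of
  sign means \<open>t * t' = 1\<close> for the first and \<open>t * t' + 3 = 2 * (t + t')\<close>
  for the second. Both at once give \<open>t = 1\<close>, which is excluded. For known
  \<open>\<beta>\<close> the third is injective in \<alpha>.\<close>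

lemma cr_equations_unique:
  assumes "cr_equations \<alpha> \<beta> c" "cr_equations \<alpha>' \<beta>' c"
  shows "\<alpha> = \<alpha>'" "\<beta> = \<beta>'"
proof -
  define t t' where "t = 6 * \<beta>" and "t' = 6 * \<beta>'"
  have t: "t \<noteq> 1" "t \<noteq> - 1" "t \<noteq> 3" "t' \<noteq> - 1" "t' \<noteq> 3"
    using assms by (auto simp: cr_equations_def t_def t'_def)
  have nz: "t + 1 \<noteq> 0" "t' + 1 \<noteq> 0" "t - 3 \<noteq> 0" "t' - 3 \<noteq> 0" using t by linarith+
  have "((t - 1) / (t + 1)) ^ 2 = ((t' - 1) / (t' + 1)) ^ 2"
    using assms by (simp add: cr_equations_def t_def t'_def)
  note 1 = square_quotients_eq[OF this nz(1,2)]
  have "3 * (2 * \<beta> - 1) = t - 3" "3 * (2 * \<beta>' - 1) = t' - 3" by (simp_all add: t_def t'_def)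
  then have "((t - 1) / (t - 3)) ^ 2 = ((t' - 1) / (t' - 3)) ^ 2"
    using assms unfolding cr_equations_def t_def[symmetric] t'_def[symmetric] by (metis option.inject)
  note 2 = square_quotients_eq[OF this nz(3,4)]
  have "t = t'"
  proof (rule ccontr)
    assume ne: "t \<noteq> t'"
    have "t * t' = 1" using 1 ne by (auto simp: algebra_simps)
    moreover have "t * t' + 3 = 2 * (t + t')" using 2 ne by (auto simp: algebra_simps)
    ultimately have "(t - 1) ^ 2 = 0" by algebra
    then show False using t(1) by simp
  qed
  then show "\<beta> = \<beta>'" by (simp add: t_def t'_def)
  define E E' where "E = \<beta> ^ 2 - \<beta> + \<alpha>" and "E' = \<beta> ^ 2 - \<beta> + \<alpha>'"
  have "(2 * \<beta> - 1) ^ 2 / (4 * E) = (2 * \<beta> - 1) ^ 2 / (4 * E')" "E \<noteq> 0" "E' \<noteq> 0" "2 * \<beta> - 1 \<noteq> 0"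
    using assms \<open>\<beta> = \<beta>'\<close> by (auto simp: cr_equations_def E_def E'_def)
  then have "E = E'" by (simp add: frac_eq_eq)
  then show "\<alpha> = \<alpha>'" by (simp add: E_def E'_def)
qed

text \<open>With \<open>D = 4 \<alpha> + 6 \<beta>\<^sup>2 - 5 \<beta>\<close> the slopes of \<open>LB\<close>, \<open>LF\<close>, \<open>LS\<close> and
  \<open>Ls01\<close> exceed that of \<open>LP\<close> by \<open>2 (D / (2 \<beta> - 1))\<^sup>2\<close>,
  \<open>2 (3 D / (6 \<beta> - 1))\<^sup>2\<close>, \<open>2 (3 D / (6 \<beta> + 1))\<^sup>2\<close> and
  \<open>D\<^sup>2 / (2 (\<beta>\<^sup>2 - \<beta> + \<alpha>))\<close>. If \<open>D = 0\<close>, or if one of the denominators vanishes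
  (which forces \<open>D = 0\<close>), then \<open>LB\<close> or \<open>LF\<close> coincides with \<open>LP\<close>.\<close>

lemma (in monge_surface) cr_equations_cr_invariants:
  assumes gen: "lines_in_general_position f1 f2"
  shows "cr_equations \<alpha> \<beta> (cr_invariants f1 f2)"
proof -
  define P where "P = 12 * \<beta> - 12 * \<alpha> - 18 * \<beta> ^ 2"
  define D where "D = 4 * \<alpha> + 6 * \<beta> ^ 2 - 5 * \<beta>"
  define E where "E = \<beta> ^ 2 - \<beta> + \<alpha>"
  have ex: "line f1 f2 L \<noteq> None" if "L \<noteq> Ls02" for L
    using gen that by (simp add: lines_in_general_position_def)
  have ne: "line f1 f2 L \<noteq> line f1 f2 LP" if "L \<noteq> LP" for L
    using gen that by (simp add: lines_in_general_position_def)
  \<comment> \<open>Completing the square. The value \<open>p = - 3 * \<beta>\<close> is the limit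
    of \<open>u / y\<close> for the double asymptotic direction \<open>u\<close> on the parabolic
    curve, whose slope is \<open>P\<close>.\<close>
  have asymptotic: "2 * p ^ 2 + 12 * \<beta> * p + 12 * \<beta> - 12 * \<alpha> = P + 2 * (p + 3 * \<beta>) ^ 2" for p
    by (simp add: P_def power2_eq_square algebra_simps)
  have LP: "line f1 f2 LP = Some (0, 1, P)"
    by (rule line_eqI) (use ex slopes(1) in \<open>auto simp: P_def\<close>)
  have LB: "line f1 f2 LB = Some (0, 1, P + 2 * (D / (2 * \<beta> - 1)) ^ 2)" if "2 * \<beta> \<noteq> 1"
  proof (rule line_eqI)
    fix g K assume "curve_of f1 f2 LB g" "curve_on_surface f1 f2 \<alpha> \<beta> W g K"
    then obtain p where p: "(2 * \<beta> - 1) * p = 4 * \<alpha> - 2 * \<beta>" "K = P + 2 * (p + 3 * \<beta>) ^ 2"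
      using slopes(2) asymptotic by metis
    have "(p + 3 * \<beta>) * (2 * \<beta> - 1) = D"
      using p(1) by (simp add: D_def power2_eq_square algebra_simps)
    then have "p + 3 * \<beta> = D / (2 * \<beta> - 1)" using that by (simp add: eq_divide_eq)
    then show "K = P + 2 * (D / (2 * \<beta> - 1)) ^ 2" using p(2) by simp
  qed (use ex in auto)
  have LF: "line f1 f2 LF = Some (0, 1, P + 2 * (3 * D / (6 * \<beta> - 1)) ^ 2)" if nz: "6 * \<beta> \<noteq> 1"
  proof (rule line_eqI)
    fix g K assume "curve_of f1 f2 LF g" "curve_on_surface f1 f2 \<alpha> \<beta> W g K"
    then obtain p where p: "(6 * \<beta> - 1) * p = 12 * (\<alpha> - \<beta>)" "K = P + 2 * (p + 3 * \<beta>) ^ 2"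
      using slopes(5)[OF _ _ nz] asymptotic by metis
    have "(p + 3 * \<beta>) * (6 * \<beta> - 1) = 3 * D"
      using p(1) by (simp add: D_def power2_eq_square algebra_simps)
    then have "p + 3 * \<beta> = 3 * D / (6 * \<beta> - 1)" using that by (simp add: eq_divide_eq)
    then show "K = P + 2 * (3 * D / (6 * \<beta> - 1)) ^ 2" using p(2) by simp
  qed (use ex in auto)
  have LS: "line f1 f2 LS = Some (0, 1, P + 2 * (3 * D / (6 * \<beta> + 1)) ^ 2)" if "6 * \<beta> + 1 \<noteq> 0"
  proof (rule line_eqI)
    fix g K assume "curve_of f1 f2 LS g" "curve_on_surface f1 f2 \<alpha> \<beta> W g K"
    then obtain p where p: "(6 * \<beta> + 1) * p = 12 * \<alpha> - 18 * \<beta>" "K = P + 2 * (p + 3 * \<beta>) ^ 2"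
      using slopes(3) asymptotic by metis
    have "(p + 3 * \<beta>) * (6 * \<beta> + 1) = 3 * D"
      using p(1) by (simp add: D_def power2_eq_square algebra_simps)
    then have "p + 3 * \<beta> = 3 * D / (6 * \<beta> + 1)" using that by (simp add: eq_divide_eq)
    then show "K = P + 2 * (3 * D / (6 * \<beta> + 1)) ^ 2" using p(2) by simp
  qed (use ex in auto)
  have curve: "\<exists>g K. curve_of f1 f2 L g \<and> curve_on_surface f1 f2 \<alpha> \<beta> W g K" if "L \<noteq> Ls02" "L \<noteq> Lg" for L
    using ex[OF that(1)] that(2) curve_of_slope by (auto simp: line_def split: if_splits)
  have D: "D \<noteq> 0"
  proof
    assume D: "D = 0"
    show False
    \<comment> \<open>\<open>LB\<close> has an explicit slope unless \<open>2 * \<beta> = 1\<close>,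
      and in that case \<open>LF\<close> has one.\<close>
    proof (cases "2 * \<beta> = 1")
      case True
      then have "6 * \<beta> \<noteq> 1" by simp
      from LF[OF this] D LP ne[of LF] show False by simp
    next
      case False
      from LB[OF this] D LP ne[of LB] show False by simp
    qed
  qed
  have 1: "2 * \<beta> \<noteq> 1"
  proof
    assume \<beta>: "2 * \<beta> = 1"
    obtain g K where "curve_of f1 f2 LB g" "curve_on_surface f1 f2 \<alpha> \<beta> W g K" using curve[of LB] by auto
    then have "4 * \<alpha> = 2 * \<beta>" using slopes(2) \<beta> by fastforce
    then have "D = 0" using \<beta> unfolding D_def by algebra
    then show False using D by simp
  qed
  have 2: "6 * \<beta> \<noteq> 1"
  proof
    assume \<beta>: "6 * \<beta> = 1"
    obtain g K where "curve_of f1 f2 LF g" "curve_on_surface f1 f2 \<alpha> \<beta> W g K" using curve[of LF] by auto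
    then have "\<alpha> = \<beta>" using slopes(4) \<beta> by blast
    then have "D = \<beta> * (6 * \<beta> - 1)" by (simp add: D_def power2_eq_square algebra_simps)
    then have "D = 0" using \<beta> by simp
    then show False using D by simp
  qed
  have 3: "6 * \<beta> + 1 \<noteq> 0"
  proof
    assume \<beta>: "6 * \<beta> + 1 = 0"
    obtain g K where "curve_of f1 f2 LS g" "curve_on_surface f1 f2 \<alpha> \<beta> W g K" using curve[of LS] by auto
    then have "12 * \<alpha> = 18 * \<beta>" using slopes(3) \<beta> by fastforce
    then have "D = 0" using \<beta> unfolding D_def by algebra
    then show False using D by simp
  qed
  \<comment> \<open>\<open>D\<close> vanishes at \<open>\<alpha> = \<beta> = 0\<close>; this is the
    condition under which the bi-germ slope was obtained.\<close>
  have nz: "\<beta> \<noteq> 0 \<or> \<alpha> \<noteq> 0" using D by (auto simp: D_def)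
  have s01: "E \<noteq> 0 \<and> K = P + D ^ 2 / (2 * E)"
    if g: "curve_of f1 f2 Ls01 g" "curve_on_surface f1 f2 \<alpha> \<beta> W g K" for g K
  proof -
    obtain T where T: "D + 2 * E * T = 0" "K = P + 2 * T ^ 2 * E"
      using slopes(6)[OF g(2,1) nz] by (auto simp: D_def E_def P_def)
    have "E \<noteq> 0" using T(1) D by auto
    moreover have "2 * T ^ 2 * E * (2 * E) = D ^ 2" using T(1) by algebra
    ultimately show ?thesis using T(2) by (simp add: eq_divide_eq)
  qed
  have E: "E \<noteq> 0" using s01 curve[of Ls01] by auto
  have Ls01: "line f1 f2 Ls01 = Some (0, 1, P + D ^ 2 / (2 * E))"
    by (rule line_eqI) (use ex s01 in auto)
  have Lg: "line f1 f2 Lg = Some (0, 0, 1)" by (simp add: line_def)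
  \<comment> \<open>With the vertical line in second place the cross-ratio is a quotient of slope
    differences to \<open>LP\<close>, so \<open>P\<close> cancels.\<close>
  have cr: "cross_ratio (0, 1, P) (0, 0, 1) (0, 1, P + k) (0, 1, P + k') = k / k'" for k k'
    by (simp add: cross_ratio_def)
  note lines = LP Lg LS[OF 3] LF[OF 2] LB[OF 1] Ls01
  have d: "2 * \<beta> - 1 \<noteq> 0" "6 * \<beta> - 1 \<noteq> 0" using 1 2 by simp_all
  have "cr_invariants f1 f2 (LP, Lg, LS, LF)
      = Some (2 * (3 * D / (6 * \<beta> + 1)) ^ 2 / (2 * (3 * D / (6 * \<beta> - 1)) ^ 2))"
    using D d by (simp add: cr_invariants_def lines cr)
  also have "2 * (3 * D / (6 * \<beta> + 1)) ^ 2 / (2 * (3 * D / (6 * \<beta> - 1)) ^ 2) = ((6 * \<beta> - 1) / (6 * \<beta> + 1)) ^ 2"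
    using D by (simp add: power_divide power_mult_distrib)
  finally have c1: "cr_invariants f1 f2 (LP, Lg, LS, LF) = Some (((6 * \<beta> - 1) / (6 * \<beta> + 1)) ^ 2)" .
  have "cr_invariants f1 f2 (LP, Lg, LB, LF)
      = Some (2 * (D / (2 * \<beta> - 1)) ^ 2 / (2 * (3 * D / (6 * \<beta> - 1)) ^ 2))"
    using D d by (simp add: cr_invariants_def lines cr)
  also have "2 * (D / (2 * \<beta> - 1)) ^ 2 / (2 * (3 * D / (6 * \<beta> - 1)) ^ 2) = ((6 * \<beta> - 1) / (3 * (2 * \<beta> - 1))) ^ 2"
    using D by (simp add: power_divide power_mult_distrib del: right_diff_distrib_numeral)
  finally have c2: "cr_invariants f1 f2 (LP, Lg, LB, LF) = Some (((6 * \<beta> - 1) / (3 * (2 * \<beta> - 1))) ^ 2)" .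
  have "cr_invariants f1 f2 (LP, Lg, Ls01, LB) = Some (D ^ 2 / (2 * E) / (2 * (D / (2 * \<beta> - 1)) ^ 2))"
    using D d by (simp add: cr_invariants_def lines cr)
  also have "D ^ 2 / (2 * E) / (2 * (D / (2 * \<beta> - 1)) ^ 2) = (2 * \<beta> - 1) ^ 2 / (4 * E)"
    using D by (simp add: power_divide)
  finally have c3: "cr_invariants f1 f2 (LP, Lg, Ls01, LB) = Some ((2 * \<beta> - 1) ^ 2 / (4 * E))" .
  have "6 * \<beta> \<noteq> - 1" using 3 by linarith
  then show ?thesis
    unfolding cr_equations_def using 1 2 E c1 c2 c3 by (simp add: E_def)
qed

theorem mainTheorem1:
  shows "\<exists>\<Phi> \<Psi> :: (line_label \<times> line_label \<times> line_label \<times> line_label \<Rightarrow> real option) \<Rightarrow> real.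
    \<forall>(f1 :: real \<times> real \<Rightarrow> real) (f2 :: real \<times> real \<Rightarrow> real) (\<alpha> :: real) (\<beta> :: real)
       (e :: nat \<Rightarrow> real).
      monge_form \<alpha> \<beta> e f1 f2 \<longrightarrow> P3_point f1 f2 \<longrightarrow> lines_in_general_position f1 f2 \<longrightarrow>
        \<alpha> = \<Phi> (cr_invariants f1 f2) \<and> \<beta> = \<Psi> (cr_invariants f1 f2)"
proof (intro exI allI impI)
  \<comment> \<open>Where a table admits a solution of \<open>cr_equations\<close> the choice is
    unique; on all other tables the value is arbitrary.\<close>
  let ?\<Phi> = "\<lambda>c. SOME \<alpha>. \<exists>\<beta>. cr_equations \<alpha> \<beta> c" and ?\<Psi> = "\<lambda>c. SOME \<beta>. \<exists>\<alpha>. cr_equations \<alpha> \<beta> c"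
  fix f1 f2 :: "real \<times> real \<Rightarrow> real" and \<alpha> \<beta> :: real and e :: "nat \<Rightarrow> real"
  assume "monge_form \<alpha> \<beta> e f1 f2" and gen: "lines_in_general_position f1 f2"
  then obtain W where "monge_surface f1 f2 \<alpha> \<beta> W" using monge_surface_if_monge_form by blast
  then have *: "cr_equations \<alpha> \<beta> (cr_invariants f1 f2)"
    using monge_surface.cr_equations_cr_invariants gen by blast
  have "?\<Phi> (cr_invariants f1 f2) = \<alpha>" "?\<Psi> (cr_invariants f1 f2) = \<beta>"
    by (rule some_equality; use * cr_equations_unique in blast)+
  then show "\<alpha> = ?\<Phi> (cr_invariants f1 f2) \<and> \<beta> = ?\<Psi> (cr_invariants f1 f2)" by simp
qed

end
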